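(* Let $R_k$ be a root system of a finite Weyl group $W_k$, with Iwahori-Hecke algebra $H_k(p^2,q^2)$, and let $w_{k,0}$ be the longest element of $W_k$. If $x\in H_k(p^2,q^2)$, write $[x]_{q=1}$ (respectively $[x]_{p=1}$, $[x]_{p=q=1}$) for the value of $x$ when $q$ (respectively $p$, both $p$ and $q$) is specialized to $1$. Then $$\left[\frac{([T_{w_{k,0}}]_{p=1})^2-1}{q-q^{-1}}\right]_{q=1}=\sum_{\alpha\in R_{k,\ell}^+}s_\alpha=z_{k,\ell},$$ $$\left[\frac{([T_{w_{k,0}}]_{q=1})^2-1}{p-p^{-1}}\right]_{p=1}=\sum_{\alpha\in R_{k,s}^+}s_\alpha=z_{k,s},$$ $$[T_{w_{k,0}}]_{p=q=1}=w_{k,0}=z_{k,0}.$$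
   Context: $R_k^+$ is the set of positive roots with respect to simple roots $\alpha_i$ indexed by the nodes $i$ of the Dynkin diagram; $s_\alpha\in W_k$ is the reflection in the hyperplane perpendicular to $\alpha$. $R_{k,s}^+$ and $R_{k,\ell}^+$ are the sets of short and long positive roots. If all roots have the same length, all are regarded as long: then $R_{k,s}^+=\emptyset$, the Iwahori-Hecke algebra is an algebra $H_k(q^2)$ over $\mathbb{C}(q)$, and only the single parameter $q$ occurs (no specialization of $p$ is needed). The Iwahori-Hecke algebra $H_k(p^2,q^2)$ is the algebra over $\mathbb{C}(p,q)$ with generators $T_i$ (one for each node $i$) and relations: $T_iT_jT_i\cdots=T_jT_iT_j\cdots$ ($m_{ij}$ factors on each side, $m_{ij}$ the order of $s_{\alpha_i}s_{\alpha_j}$), and $T_i^2=(p-p^{-1})T_i+1$ if $\alpha_i$ is short, $T_i^2=(q-q^{-1})T_i+1$ if $\alpha_i$ is long. For $w\in W_k$ with reduced expression $w=s_{i_1}\cdots s_{i_r}$ (where $s_i=s_{\alpha_i}$), $T_w=T_{i_1}\cdots T_{i_r}$, which is independent of the reduced expression. Specialization: it is performed in the integral form of $H_k(p^2,q^2)$, i.e. the algebra over $\mathbb{Z}[q,q^{-1},p,p^{-1}]$ with the same generators and relations (with basis $T_w$, $w\in W_k$), by base change along $p\mapsto1$ and/or $q\mapsto1$; at $p=q=1$ it becomes the integral group ring of $W_k$ with $T_w\mapsto w$. The elements being specialized lie in (the appropriate specialization of) the integral form. The elements $z_{k,s}=\sum_{\alpha\in R_{k,s}^+}s_\alpha$,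 $z_{k,\ell}=\sum_{\alpha\in R_{k,\ell}^+}s_\alpha$ are central in $\mathbb{C}W_k$; $z_{k,0}$ denotes $w_{k,0}$, which is central when $w_{k,0}$ acts by $-1$ in the reflection representation. *)

theory Defs
  imports
    "HOL-Analysis.Analysis"
    "HOL-Algebra.Bij"
    "HOL-Algebra.QuotRing"
    "HOL-Algebra.Generated_Groups"
    "HOL-Algebra.Multiplicative_Group"
    "HOL-Library.Poly_Mapping"
    "HOL-Computational_Algebra.Polynomial"
    "HOL-Computational_Algebra.Fraction_Field"
begin

definition reflection :: "'v::euclidean_space \<Rightarrow> 'v \<Rightarrow> 'v" where
  "reflection \<alpha> v = v - (2 * (v \<bullet> \<alpha>) / (\<alpha> \<bullet> \<alpha>)) *\<^sub>R \<alpha>"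

text \<open>Reduced crystallographic root systems, not necessarily irreducible. The roots are not required
  to span the ambient space (the root system lives in their span), so that the empty system and the
  root systems of parabolic subgroups are included.\<close>

definition root_system :: "'v::euclidean_space set \<Rightarrow> bool" where
  "root_system R \<longleftrightarrow> finite R \<and> 0 \<notin> R
     \<and> (\<forall>\<alpha>\<in>R. \<forall>\<beta>\<in>R. reflection \<alpha> \<beta> \<in> R)
     \<and> (\<forall>\<alpha>\<in>R. \<forall>\<beta>\<in>R. 2 * (\<beta> \<bullet> \<alpha>) / (\<alpha> \<bullet> \<alpha>) \<in> \<int>)
     \<and> (\<forall>\<alpha>\<in>R. \<forall>c. c *\<^sub>R \<alpha> \<in> R \<longrightarrow> c = 1 \<or> c = - 1)"

text \<open>The simple roots also serve as the nodes of the Dynkin diagram.\<close>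

definition positive_roots :: "'v::euclidean_space set \<Rightarrow> 'v set \<Rightarrow> 'v set" where
  "positive_roots R \<Delta> = {\<beta> \<in> R. \<exists>c::'v \<Rightarrow> nat. \<beta> = (\<Sum>\<alpha>\<in>\<Delta>. of_nat (c \<alpha>) *\<^sub>R \<alpha>)}"

definition simple_roots :: "'v::euclidean_space set \<Rightarrow> 'v set \<Rightarrow> bool" where
  "simple_roots R \<Delta> \<longleftrightarrow> \<Delta> \<subseteq> R \<and> independent \<Delta>
     \<and> (\<forall>\<beta>\<in>R. \<beta> \<in> positive_roots R \<Delta> \<or> - \<beta> \<in> positive_roots R \<Delta>)"

text \<open>If all roots have the same length, all of them are long. For a reducible system, lengths are
  compared across components. This covers the componentwise convention as well: reflections and the
  Weyl group do not change when each component is rescaled so that its longest roots have norm 1.\<close>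

definition short_root :: "'v::euclidean_space set \<Rightarrow> 'v \<Rightarrow> bool" where
  "short_root R \<alpha> \<longleftrightarrow> (\<exists>\<beta>\<in>R. norm \<alpha> < norm \<beta>)"

definition short_positive_roots :: "'v::euclidean_space set \<Rightarrow> 'v set \<Rightarrow> 'v set" where
  "short_positive_roots R \<Delta> = {\<alpha> \<in> positive_roots R \<Delta>. short_root R \<alpha>}"

definition long_positive_roots :: "'v::euclidean_space set \<Rightarrow> 'v set \<Rightarrow> 'v set" where
  "long_positive_roots R \<Delta> = {\<alpha> \<in> positive_roots R \<Delta>. \<not> short_root R \<alpha>}"

definition weyl_group :: "'v::euclidean_space set \<Rightarrow> ('v \<Rightarrow> 'v) monoid" where
  "weyl_group R = subgroup_generated (BijGroup UNIV) (reflection ` R)"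

definition word_prod :: "('g, 'b) monoid_scheme \<Rightarrow> ('i \<Rightarrow> 'g) \<Rightarrow> 'i list \<Rightarrow> 'g" where
  "word_prod G x ws = foldr (\<lambda>i g. x i \<otimes>\<^bsub>G\<^esub> g) ws \<one>\<^bsub>G\<^esub>"

definition weyl_word :: "'v::euclidean_space set \<Rightarrow> 'v list \<Rightarrow> 'v \<Rightarrow> 'v" where
  "weyl_word R = word_prod (weyl_group R) reflection"

definition weyl_length :: "'v::euclidean_space set \<Rightarrow> 'v set \<Rightarrow> ('v \<Rightarrow> 'v) \<Rightarrow> nat" where
  "weyl_length R \<Delta> w = (LEAST n. \<exists>ws \<in> lists \<Delta>. length ws = n \<and> weyl_word R ws = w)"

definition reduced_expression ::
    "'v::euclidean_space set \<Rightarrow> 'v set \<Rightarrow> ('v \<Rightarrow> 'v) \<Rightarrow> 'v list \<Rightarrow> bool" where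
  "reduced_expression R \<Delta> w ws \<longleftrightarrow>
     ws \<in> lists \<Delta> \<and> weyl_word R ws = w \<and> length ws = weyl_length R \<Delta> w"

definition longest_element :: "'v::euclidean_space set \<Rightarrow> 'v set \<Rightarrow> 'v \<Rightarrow> 'v" where
  "longest_element R \<Delta> = (THE w. w \<in> carrier (weyl_group R) \<and>
     (\<forall>u \<in> carrier (weyl_group R). weyl_length R \<Delta> u \<le> weyl_length R \<Delta> w))"

text \<open>The free associative algebra on \<open>\<Delta>\<close> over the coefficient ring \<open>'a\<close>: finitely
  supported combinations of words.\<close>

definition free_algebra :: "'i set \<Rightarrow> ('i list \<Rightarrow>\<^sub>0 'a::comm_ring_1) ring" where
  "free_algebra \<Delta> =
     \<lparr>carrier = {x. Poly_Mapping.keys x \<subseteq> lists \<Delta>},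
      mult = (\<lambda>x y. \<Sum>u\<in>Poly_Mapping.keys x. \<Sum>v\<in>Poly_Mapping.keys y.
         Poly_Mapping.single (u @ v) (Poly_Mapping.lookup x u * Poly_Mapping.lookup y v)),
      one = Poly_Mapping.single [] 1, zero = 0, add = (+)\<rparr>"

fun alternating_word :: "'i \<Rightarrow> 'i \<Rightarrow> nat \<Rightarrow> 'i list" where
  "alternating_word i j 0 = []"
| "alternating_word i j (Suc m) = i # alternating_word j i m"

text \<open>The coefficients \<open>P\<close> and \<open>Q\<close> stand for \<open>p - p\<^sup>-\<^sup>1\<close> and \<open>q - q\<^sup>-\<^sup>1\<close>, the only form in which the
  parameters enter the relations.\<close>

definition hecke_relations ::
    "'v::euclidean_space set \<Rightarrow> 'v set \<Rightarrow> 'a::comm_ring_1 \<Rightarrow> 'a \<Rightarrow> ('v list \<Rightarrow>\<^sub>0 'a) set" where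
  "hecke_relations R \<Delta> P Q =
     {Poly_Mapping.single (alternating_word i j m) 1 - Poly_Mapping.single (alternating_word j i m) 1
        | i j m. i \<in> \<Delta> \<and> j \<in> \<Delta> \<and> i \<noteq> j \<and>
            m = group.ord (weyl_group R) (reflection i \<otimes>\<^bsub>weyl_group R\<^esub> reflection j)}
   \<union> {Poly_Mapping.single [i, i] 1
        - (Poly_Mapping.single [i] (if short_root R i then P else Q) + Poly_Mapping.single [] 1)
        | i. i \<in> \<Delta>}"

definition hecke_ideal ::
    "'v::euclidean_space set \<Rightarrow> 'v set \<Rightarrow> 'a::comm_ring_1 \<Rightarrow> 'a \<Rightarrow> ('v list \<Rightarrow>\<^sub>0 'a) set" where
  "hecke_ideal R \<Delta> P Q = Idl\<^bsub>free_algebra \<Delta>\<^esub> (hecke_relations R \<Delta> P Q)"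

definition hecke_algebra ::
    "'v::euclidean_space set \<Rightarrow> 'v set \<Rightarrow> 'a::comm_ring_1 \<Rightarrow> 'a \<Rightarrow> ('v list \<Rightarrow>\<^sub>0 'a) set ring" where
  "hecke_algebra R \<Delta> P Q = free_algebra \<Delta> Quot hecke_ideal R \<Delta> P Q"

definition hecke_class ::
    "'v::euclidean_space set \<Rightarrow> 'v set \<Rightarrow> 'a::comm_ring_1 \<Rightarrow> 'a \<Rightarrow>
      ('v list \<Rightarrow>\<^sub>0 'a) \<Rightarrow> ('v list \<Rightarrow>\<^sub>0 'a) set" where
  "hecke_class R \<Delta> P Q x = hecke_ideal R \<Delta> P Q +>\<^bsub>free_algebra \<Delta>\<^esub> x"

definition hecke_scalar ::
    "'v::euclidean_space set \<Rightarrow> 'v set \<Rightarrow> 'a::comm_ring_1 \<Rightarrow> 'a \<Rightarrow> 'a \<Rightarrow> ('v list \<Rightarrow>\<^sub>0 'a) set" where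
  "hecke_scalar R \<Delta> P Q a = hecke_class R \<Delta> P Q (Poly_Mapping.single [] a)"

definition hecke_gen ::
    "'v::euclidean_space set \<Rightarrow> 'v set \<Rightarrow> 'a::comm_ring_1 \<Rightarrow> 'a \<Rightarrow> 'v \<Rightarrow> ('v list \<Rightarrow>\<^sub>0 'a) set" where
  "hecke_gen R \<Delta> P Q i = hecke_class R \<Delta> P Q (Poly_Mapping.single [i] 1)"

definition hecke_T ::
    "'v::euclidean_space set \<Rightarrow> 'v set \<Rightarrow> 'a::comm_ring_1 \<Rightarrow> 'a \<Rightarrow>
      ('v \<Rightarrow> 'v) \<Rightarrow> ('v list \<Rightarrow>\<^sub>0 'a) set" where
  "hecke_T R \<Delta> P Q w = word_prod (hecke_algebra R \<Delta> P Q) (hecke_gen R \<Delta> P Q)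
     (SOME ws. reduced_expression R \<Delta> w ws)"

text \<open>The map from the Hecke algebra with parameters \<open>P, Q\<close> to the one with parameters
  \<open>\<phi> P, \<phi> Q\<close> induced by a homomorphism \<open>\<phi>\<close> of coefficient rings, as the common class of the images
  of all representatives. The target presents the extension of scalars along \<open>\<phi>\<close>.\<close>

definition base_change ::
    "'v::euclidean_space set \<Rightarrow> 'v set \<Rightarrow> 'a::comm_ring_1 \<Rightarrow> 'a \<Rightarrow> ('a \<Rightarrow> 'b::comm_ring_1) \<Rightarrow>
      ('v list \<Rightarrow>\<^sub>0 'a) set \<Rightarrow> ('v list \<Rightarrow>\<^sub>0 'b) set" where
  "base_change R \<Delta> P Q \<phi> X =
     the_elem ((\<lambda>x. hecke_class R \<Delta> (\<phi> P) (\<phi> Q) (Poly_Mapping.map \<phi> x)) ` X)"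

text \<open>Specialization along \<open>\<phi>\<close> of an element \<open>x\<close> of the Hecke algebra with parameters \<open>\<iota> P, \<iota> Q\<close>
  over a field, where \<open>\<iota>\<close> embeds the ring \<open>'a\<close> into that field: \<open>x\<close> is taken back to the
  integral form over \<open>'a\<close>, and the scalars are then extended along \<open>\<phi>\<close>.\<close>

definition specialize ::
    "'v::euclidean_space set \<Rightarrow> 'v set \<Rightarrow> 'a::comm_ring_1 \<Rightarrow> 'a \<Rightarrow> ('a \<Rightarrow> 'k::field) \<Rightarrow>
      ('a \<Rightarrow> 'b::comm_ring_1) \<Rightarrow> ('v list \<Rightarrow>\<^sub>0 'k) set \<Rightarrow> ('v list \<Rightarrow>\<^sub>0 'b) set" where
  "specialize R \<Delta> P Q \<iota> \<phi> x = base_change R \<Delta> P Q \<phi>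
     (THE y. y \<in> carrier (hecke_algebra R \<Delta> P Q) \<and> base_change R \<Delta> P Q \<iota> y = x)"

text \<open>Laurent polynomials with integer coefficients, in one variable and in the two variables
  \<open>p, q\<close>; a monomial is given by its exponent(s), and multiplication is convolution.\<close>

type_synonym laurent = "int \<Rightarrow>\<^sub>0 int"
type_synonym laurent2 = "(int \<times> int) \<Rightarrow>\<^sub>0 int"

abbreviation lmonom :: "int \<Rightarrow> laurent" where
  "lmonom a \<equiv> Poly_Mapping.single a 1"

abbreviation lmonom2 :: "int \<Rightarrow> int \<Rightarrow> laurent2" where
  "lmonom2 a b \<equiv> Poly_Mapping.single (a, b) 1"

text \<open>The first type serves as \<open>\<complex>(q)\<close> and as \<open>\<complex>(p)\<close>, the second one is \<open>\<complex>(p,q)\<close>.\<close>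

type_synonym ratfun = "complex poly fract"
type_synonym ratfun2 = "complex poly poly fract"

definition rvar :: ratfun where "rvar = Fract [:0, 1:] 1"
definition rvar_p :: ratfun2 where "rvar_p = Fract [:[:0, 1:]:] 1"
definition rvar_q :: ratfun2 where "rvar_q = Fract [:0, 1:] 1"

definition laurent_incl :: "laurent \<Rightarrow> ratfun" where
  "laurent_incl f = (\<Sum>a\<in>Poly_Mapping.keys f. of_int (Poly_Mapping.lookup f a) * rvar powi a)"

definition laurent2_incl :: "laurent2 \<Rightarrow> ratfun2" where
  "laurent2_incl f = (\<Sum>(a, b)\<in>Poly_Mapping.keys f.
     of_int (Poly_Mapping.lookup f (a, b)) * rvar_p powi a * rvar_q powi b)"

definition laurent_at_1 :: "laurent \<Rightarrow> int" where
  "laurent_at_1 f = (\<Sum>a\<in>Poly_Mapping.keys f. Poly_Mapping.lookup f a)"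

definition laurent2_at_p1 :: "laurent2 \<Rightarrow> laurent" where
  "laurent2_at_p1 f = (\<Sum>(a, b)\<in>Poly_Mapping.keys f.
     Poly_Mapping.single b (Poly_Mapping.lookup f (a, b)))"

definition laurent2_at_q1 :: "laurent2 \<Rightarrow> laurent" where
  "laurent2_at_q1 f = (\<Sum>(a, b)\<in>Poly_Mapping.keys f.
     Poly_Mapping.single a (Poly_Mapping.lookup f (a, b)))"

definition laurent2_at_pq1 :: "laurent2 \<Rightarrow> int" where
  "laurent2_at_pq1 f = (\<Sum>a\<in>Poly_Mapping.keys f. Poly_Mapping.lookup f a)"

text \<open>\<open>[x]\<^bsub>p=1\<^esub>\<close> for \<open>x\<close> in the Hecke algebra over \<open>\<complex>(p,q)\<close>. The value is computed over
  \<open>\<int>[q,q\<^sup>-\<^sup>1]\<close> and then regarded as an element of the algebra over \<open>\<complex>(q)\<close>, in which division by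
  \<open>q - q\<^sup>-\<^sup>1\<close> makes sense; similarly for \<open>[x]\<^bsub>q=1\<^esub>\<close>.\<close>

definition at_p1 ::
    "'v::euclidean_space set \<Rightarrow> 'v set \<Rightarrow> ('v list \<Rightarrow>\<^sub>0 ratfun2) set \<Rightarrow> ('v list \<Rightarrow>\<^sub>0 ratfun) set" where
  "at_p1 R \<Delta> x = base_change R \<Delta> 0 (lmonom 1 - lmonom (- 1)) laurent_incl
     (specialize R \<Delta> (lmonom2 1 0 - lmonom2 (- 1) 0) (lmonom2 0 1 - lmonom2 0 (- 1))
       laurent2_incl laurent2_at_p1 x)"

definition at_q1 ::
    "'v::euclidean_space set \<Rightarrow> 'v set \<Rightarrow> ('v list \<Rightarrow>\<^sub>0 ratfun2) set \<Rightarrow> ('v list \<Rightarrow>\<^sub>0 ratfun) set" where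
  "at_q1 R \<Delta> x = base_change R \<Delta> (lmonom 1 - lmonom (- 1)) 0 laurent_incl
     (specialize R \<Delta> (lmonom2 1 0 - lmonom2 (- 1) 0) (lmonom2 0 1 - lmonom2 0 (- 1))
       laurent2_incl laurent2_at_q1 x)"

text \<open>At \<open>p = q = 1\<close> the integral form is the integral group ring of the Weyl group, whose elements
  are represented as finitely supported integer functions on group elements: the class of a word
  goes to the product of the corresponding simple reflections.\<close>

definition hecke_to_group_ring ::
    "'v::euclidean_space set \<Rightarrow> ('v list \<Rightarrow>\<^sub>0 int) set \<Rightarrow> (('v \<Rightarrow> 'v) \<Rightarrow>\<^sub>0 int)" where
  "hecke_to_group_ring R X = the_elem ((\<lambda>x. \<Sum>ws\<in>Poly_Mapping.keys x.
     Poly_Mapping.single (weyl_word R ws) (Poly_Mapping.lookup x ws)) ` X)"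

text \<open>The value at \<open>q = 1\<close> of an element of the algebra over \<open>\<complex>(q)\<close> with \<open>p\<close> already set to 1, and
  vice versa.\<close>

definition at_p1_q1 ::
    "'v::euclidean_space set \<Rightarrow> 'v set \<Rightarrow> ('v list \<Rightarrow>\<^sub>0 ratfun) set \<Rightarrow> (('v \<Rightarrow> 'v) \<Rightarrow>\<^sub>0 int)" where
  "at_p1_q1 R \<Delta> x = hecke_to_group_ring R
     (specialize R \<Delta> 0 (lmonom 1 - lmonom (- 1)) laurent_incl laurent_at_1 x)"

definition at_q1_p1 ::
    "'v::euclidean_space set \<Rightarrow> 'v set \<Rightarrow> ('v list \<Rightarrow>\<^sub>0 ratfun) set \<Rightarrow> (('v \<Rightarrow> 'v) \<Rightarrow>\<^sub>0 int)" where
  "at_q1_p1 R \<Delta> x = hecke_to_group_ring R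
     (specialize R \<Delta> (lmonom 1 - lmonom (- 1)) 0 laurent_incl laurent_at_1 x)"

definition at_pq1 ::
    "'v::euclidean_space set \<Rightarrow> 'v set \<Rightarrow> ('v list \<Rightarrow>\<^sub>0 ratfun2) set \<Rightarrow> (('v \<Rightarrow> 'v) \<Rightarrow>\<^sub>0 int)" where
  "at_pq1 R \<Delta> x = hecke_to_group_ring R
     (specialize R \<Delta> (lmonom2 1 0 - lmonom2 (- 1) 0) (lmonom2 0 1 - lmonom2 0 (- 1))
       laurent2_incl laurent2_at_pq1 x)"

definition z_long :: "'v::euclidean_space set \<Rightarrow> 'v set \<Rightarrow> (('v \<Rightarrow> 'v) \<Rightarrow>\<^sub>0 int)" where
  "z_long R \<Delta> = (\<Sum>\<alpha>\<in>long_positive_roots R \<Delta>. Poly_Mapping.single (reflection \<alpha>) 1)"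

definition z_short :: "'v::euclidean_space set \<Rightarrow> 'v set \<Rightarrow> (('v \<Rightarrow> 'v) \<Rightarrow>\<^sub>0 int)" where
  "z_short R \<Delta> = (\<Sum>\<alpha>\<in>short_positive_roots R \<Delta>. Poly_Mapping.single (reflection \<alpha>) 1)"

definition z_zero :: "'v::euclidean_space set \<Rightarrow> 'v set \<Rightarrow> (('v \<Rightarrow> 'v) \<Rightarrow>\<^sub>0 int)" where
  "z_zero R \<Delta> = Poly_Mapping.single (longest_element R \<Delta>) 1"

definition T_pq ::
    "'v::euclidean_space set \<Rightarrow> 'v set \<Rightarrow> ('v \<Rightarrow> 'v) \<Rightarrow> ('v list \<Rightarrow>\<^sub>0 ratfun2) set" where
  "T_pq R \<Delta> = hecke_T R \<Delta> (rvar_p - inverse rvar_p) (rvar_q - inverse rvar_q)"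

text \<open>The algebra over \<open>\<complex>(q)\<close> obtained at \<open>p = 1\<close>. If there are no short roots, the coefficient 0
  does not occur in the relations, and this is the one-parameter algebra \<open>H(q\<^sup>2)\<close>.\<close>

definition hecke_q :: "'v::euclidean_space set \<Rightarrow> 'v set \<Rightarrow> ('v list \<Rightarrow>\<^sub>0 ratfun) set ring" where
  "hecke_q R \<Delta> = hecke_algebra R \<Delta> 0 (rvar - inverse rvar)"

definition T_q ::
    "'v::euclidean_space set \<Rightarrow> 'v set \<Rightarrow> ('v \<Rightarrow> 'v) \<Rightarrow> ('v list \<Rightarrow>\<^sub>0 ratfun) set" where
  "T_q R \<Delta> = hecke_T R \<Delta> 0 (rvar - inverse rvar)"

definition hecke_p :: "'v::euclidean_space set \<Rightarrow> 'v set \<Rightarrow> ('v list \<Rightarrow>\<^sub>0 ratfun) set ring" where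
  "hecke_p R \<Delta> = hecke_algebra R \<Delta> (rvar - inverse rvar) 0"

text \<open>The quotients \<open>(t\<^sup>2 - 1) / (q - q\<^sup>-\<^sup>1)\<close> and \<open>(t\<^sup>2 - 1) / (p - p\<^sup>-\<^sup>1)\<close> in these algebras.\<close>

definition square_quot_q ::
    "'v::euclidean_space set \<Rightarrow> 'v set \<Rightarrow> ('v list \<Rightarrow>\<^sub>0 ratfun) set \<Rightarrow> ('v list \<Rightarrow>\<^sub>0 ratfun) set" where
  "square_quot_q R \<Delta> t = hecke_scalar R \<Delta> 0 (rvar - inverse rvar) (inverse (rvar - inverse rvar))
     \<otimes>\<^bsub>hecke_q R \<Delta>\<^esub> (t [^]\<^bsub>hecke_q R \<Delta>\<^esub> (2::nat) \<ominus>\<^bsub>hecke_q R \<Delta>\<^esub> \<one>\<^bsub>hecke_q R \<Delta>\<^esub>)"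

definition square_quot_p ::
    "'v::euclidean_space set \<Rightarrow> 'v set \<Rightarrow> ('v list \<Rightarrow>\<^sub>0 ratfun) set \<Rightarrow> ('v list \<Rightarrow>\<^sub>0 ratfun) set" where
  "square_quot_p R \<Delta> t = hecke_scalar R \<Delta> (rvar - inverse rvar) 0 (inverse (rvar - inverse rvar))
     \<otimes>\<^bsub>hecke_p R \<Delta>\<^esub> (t [^]\<^bsub>hecke_p R \<Delta>\<^esub> (2::nat) \<ominus>\<^bsub>hecke_p R \<Delta>\<^esub> \<one>\<^bsub>hecke_p R \<Delta>\<^esub>)"

end

theory Submission
  imports Defs "HOL-Computational_Algebra.Polynomial_Factorial"
begin

text \<open>Let \<open>s\<^sub>1 \<dots> s\<^sub>n\<close> be a reduced word of the longest element \<open>w\<^sub>0\<close>. As \<open>w\<^sub>0\<close> is an involution, the reversed word is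
  reduced for \<open>w\<^sub>0\<close> as well, so by Matsumoto's theorem \<open>T\<^sup>2 = T\<^sub>1 \<dots> T\<^sub>n T\<^sub>n \<dots> T\<^sub>1\<close>. Applying the quadratic relations from
  the middle outwards gives \<open>T\<^sup>2 = 1 + \<Sum>\<^sub>k c\<^sub>k T\<^sub>1 \<dots> T\<^sub>k \<dots> T\<^sub>1\<close> with \<open>c\<^sub>k\<close> the parameter of the \<open>k\<close>-th letter. If one of
  the two parameters is \<open>0\<close>, the other one can be divided out, and at \<open>p = q = 1\<close> the palindromic products become the
  reflections in the roots \<open>s\<^sub>1 \<dots> s\<^sub>k\<^sub>-\<^sub>1 \<alpha>\<^sub>k\<close>, which enumerate the positive roots. That specialization is well defined
  needs the integral form to embed into the algebra over the field; this follows from the basis \<open>T\<^sub>w\<close>, whose linear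
  independence comes from commuting left and right operators on functions on the Weyl group.\<close>

section \<open>Reflections and root bases\<close>

text \<open>Specialization is a definite description: it takes the unique preimage of an element in
  the integral form. Uniqueness means that base change along an injective ring map is faithful, and
  generators and relations alone never show that a class is nonzero. A concrete module is needed,
  and the relation that is hard to verify on it is the braid relation. As left and right operators
  commute, it is enough to verify it on the single vector \<delta> at the identity, where it says
  that both alternating words are reduced words of one element. Commutation in turn rests on the
  parameter being constant on orbits of roots, as the group preserves lengths. The same invariance
  makes c_k the parameter of the enumerated root itself and not merely of the letter \<alpha>_k, so
  that killing one parameter keeps exactly the reflections in roots of the other length. After
  division the remaining coefficients are 0 and 1, so one formula is valid over the rational
  functions, the Laurent polynomials and the integers, and serves as its own integral lift.\<close>

lemma reflection_linear: "linear (reflection \<alpha>)"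
proof (rule linearI)
  show "reflection \<alpha> (x + y) = reflection \<alpha> x + reflection \<alpha> y" for x y
    by (simp add: reflection_def inner_add_left distrib_left add_divide_distrib scaleR_add_left)
  show "reflection \<alpha> (c *\<^sub>R x) = c *\<^sub>R reflection \<alpha> x" for c x
    by (simp add: reflection_def scaleR_diff_right mult.left_commute)
qed

lemma inner_reflection: "reflection \<alpha> x \<bullet> reflection \<alpha> y = x \<bullet> y"
proof (cases "\<alpha> = 0")
  case False
  define k where "k v = 2 * (v \<bullet> \<alpha>) / (\<alpha> \<bullet> \<alpha>)" for v
  have k: "k v * (\<alpha> \<bullet> \<alpha>) = 2 * (v \<bullet> \<alpha>)" for v
    using False by (simp add: k_def)
  have "reflection \<alpha> x \<bullet> reflection \<alpha> y
      = x \<bullet> y - k y * (x \<bullet> \<alpha>) - k x * (y \<bullet> \<alpha>) + k x * (k y * (\<alpha> \<bullet> \<alpha>))"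
    unfolding reflection_def k_def[symmetric]
    by (simp add: inner_diff_left inner_diff_right inner_commute[of \<alpha> x] inner_commute[of \<alpha> y] algebra_simps)
  also have "\<dots> = x \<bullet> y - k y * (x \<bullet> \<alpha>) + k x * (y \<bullet> \<alpha>)"
    by (simp add: k)
  also have "k y * (x \<bullet> \<alpha>) = k x * (y \<bullet> \<alpha>)"
    by (simp add: k_def)
  finally show ?thesis by simp
qed (simp add: reflection_def)

lemma reflection_self: "reflection \<alpha> \<alpha> = - \<alpha>"
  by (cases "\<alpha> = 0") (simp_all add: reflection_def scaleR_2)

lemma reflection_involution [simp]: "reflection \<alpha> (reflection \<alpha> v) = v"
proof -
  define k where "k = 2 * (v \<bullet> \<alpha>) / (\<alpha> \<bullet> \<alpha>)"
  have v: "reflection \<alpha> v = v - k *\<^sub>R \<alpha>"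
    by (simp add: reflection_def k_def)
  then have "reflection \<alpha> (reflection \<alpha> v) = reflection \<alpha> v - k *\<^sub>R reflection \<alpha> \<alpha>"
    by (simp only: linear_diff[OF reflection_linear] linear_scale[OF reflection_linear])
  also have "\<dots> = v"
    unfolding v reflection_self by simp
  finally show ?thesis .
qed

lemma reflection_comp_self [simp]: "reflection \<alpha> \<circ> reflection \<alpha> = id"
  by (simp add: fun_eq_iff)

lemma reflection_uminus: "reflection (- \<alpha>) = reflection \<alpha>"
  by (simp add: reflection_def fun_eq_iff)

lemma bij_reflection: "bij (reflection \<alpha>)"
  by (rule o_bij[of "reflection \<alpha>"]) simp_all

lemma orthogonal_reflection: "orthogonal_transformation (reflection \<alpha>)"
  by (simp add: orthogonal_transformation_def reflection_linear inner_reflection)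

text \<open>An isometry preserves the inner products in the reflection formula. This is the
  conjugation rule for reflections with the inverse cleared, and every later conjugation goes
  through it.\<close>

lemma orthogonal_comp_reflection:
  assumes "orthogonal_transformation w"
  shows "w \<circ> reflection \<alpha> = reflection (w \<alpha>) \<circ> w"
proof -
  have "linear w" "\<And>x y. w x \<bullet> w y = x \<bullet> y"
    using assms by (auto simp: orthogonal_transformation_def)
  then show ?thesis
    by (simp add: fun_eq_iff reflection_def linear_diff linear_scale)
qed

section \<open>Words in reflections and the group they generate\<close>

lemma weyl_word_Nil [simp]: "weyl_word R [] = id"
  by (simp add: weyl_word_def word_prod_def weyl_group_def BijGroup_def fun_eq_iff)

lemma Bij_UNIV: "Bij UNIV = {f. bij f}"
  by (auto simp: Bij_def extensional_def)

text \<open>The product of \<open>BijGroup\<close> is composition only on bijections, so each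
  passage from the group product to \<open>\<circ>\<close> carries these two premises.\<close>

lemma weyl_mult: "bij f \<Longrightarrow> bij g \<Longrightarrow> f \<otimes>\<^bsub>weyl_group R\<^esub> g = f \<circ> g"
  by (simp add: weyl_group_def BijGroup_def Bij_UNIV compose_def fun_eq_iff)

lemma weyl_word_Cons_mult: "weyl_word R (i # ws) = reflection i \<otimes>\<^bsub>weyl_group R\<^esub> weyl_word R ws"
  by (simp add: weyl_word_def word_prod_def)

lemma bij_weyl_word: "bij (weyl_word R ws)"
proof (induction ws)
  case Nil
  show ?case unfolding weyl_word_Nil by (rule bij_id)
next
  case (Cons i ws)
  show ?case
    unfolding weyl_word_Cons_mult weyl_mult[OF bij_reflection Cons.IH]
    by (rule bij_comp[OF Cons.IH bij_reflection])
qed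

lemma weyl_word_Cons [simp]: "weyl_word R (i # ws) = reflection i \<circ> weyl_word R ws"
  by (simp only: weyl_word_Cons_mult weyl_mult[OF bij_reflection bij_weyl_word])

lemma weyl_word_append: "weyl_word R (us @ vs) = weyl_word R us \<circ> weyl_word R vs"
  by (induction us) (simp_all only: append.simps weyl_word_Nil weyl_word_Cons o_assoc id_o)

lemma orthogonal_weyl_word: "orthogonal_transformation (weyl_word R ws)"
proof (induction ws)
  case Nil
  show ?case by (simp add: orthogonal_transformation_id id_def)
next
  case (Cons i ws)
  show ?case
    unfolding weyl_word_Cons
    by (rule orthogonal_transformation_compose[OF orthogonal_reflection Cons.IH])
qed

lemma weyl_word_rev_comp: "weyl_word R (rev ws) \<circ> weyl_word R ws = id"
proof (induction ws)
  case (Cons i ws)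
  have "weyl_word R (rev (i # ws)) (weyl_word R (i # ws) v) = weyl_word R (rev ws) (weyl_word R ws v)" for v
    by (simp add: weyl_word_append)
  with Cons show ?case by (simp add: fun_eq_iff)
qed simp

lemma inv_weyl_word: "inv_into UNIV (weyl_word R ws) = weyl_word R (rev ws)"
proof (rule inv_unique_comp)
  show "weyl_word R (rev ws) \<circ> weyl_word R ws = id"
    by (rule weyl_word_rev_comp)
  show "weyl_word R ws \<circ> weyl_word R (rev ws) = id"
    using weyl_word_rev_comp[of R "rev ws"] by simp
qed

lemma group_weyl_group: "group (weyl_group R)"
  unfolding weyl_group_def by (intro group.group_subgroup_generated group_BijGroup)

lemma weyl_word_in_carrier: "ws \<in> lists R \<Longrightarrow> weyl_word R ws \<in> carrier (weyl_group R)"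
proof (induction ws)
  case Nil
  have "\<one>\<^bsub>weyl_group R\<^esub> \<in> carrier (weyl_group R)"
    by (intro monoid.one_closed group.is_monoid group_weyl_group)
  then show ?case by (simp add: weyl_word_def word_prod_def)
next
  case (Cons i ws)
  have "reflection i \<in> carrier (weyl_group R)"
    using Cons by (auto simp: weyl_group_def carrier_subgroup_generated BijGroup_def Bij_UNIV
        bij_reflection intro!: generate.incl)
  then have "reflection i \<otimes>\<^bsub>weyl_group R\<^esub> weyl_word R ws \<in> carrier (weyl_group R)"
    using Cons by (intro monoid.m_closed group.is_monoid group_weyl_group) auto
  then show ?case by (simp add: weyl_word_def word_prod_def)
qed

lemma carrier_weyl_group: "carrier (weyl_group R) = weyl_word R ` lists R"
proof
  show "weyl_word R ` lists R \<subseteq> carrier (weyl_group R)"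
    using weyl_word_in_carrier by blast
  have "w \<in> weyl_word R ` lists R"
    if "w \<in> generate (BijGroup UNIV) (carrier (BijGroup UNIV) \<inter> reflection ` R)" for w
    using that
  proof induction
    case one
    have "\<one>\<^bsub>BijGroup UNIV\<^esub> = weyl_word R []"
      unfolding weyl_word_Nil by (simp add: BijGroup_def fun_eq_iff)
    then show ?case by blast
  next
    case (incl h)
    then obtain \<alpha> where "\<alpha> \<in> R" "h = reflection \<alpha>" by blast
    then have "h = weyl_word R [\<alpha>]" "[\<alpha>] \<in> lists R" by simp_all
    then show ?case by blast
  next
    case (inv h)
    then obtain \<alpha> where \<alpha>: "\<alpha> \<in> R" "h = reflection \<alpha>" by blast
    have "inv\<^bsub>BijGroup UNIV\<^esub> h = h"
      using \<alpha> by (intro group.inv_equality group_BijGroup)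
        (auto simp: BijGroup_def Bij_UNIV bij_reflection compose_def)
    then have "inv\<^bsub>BijGroup UNIV\<^esub> h = weyl_word R [\<alpha>]" "[\<alpha>] \<in> lists R"
      using \<alpha> by simp_all
    then show ?case by blast
  next
    case (eng h1 h2)
    then obtain us vs where uv: "us \<in> lists R" "vs \<in> lists R"
      "h1 = weyl_word R us" "h2 = weyl_word R vs" by blast
    have "h1 \<otimes>\<^bsub>weyl_group R\<^esub> h2 = weyl_word R (us @ vs)"
      unfolding uv weyl_word_append by (rule weyl_mult[OF bij_weyl_word bij_weyl_word])
    then have "h1 \<otimes>\<^bsub>BijGroup UNIV\<^esub> h2 = weyl_word R (us @ vs)"
      by (simp add: weyl_group_def)
    then show ?case using uv by (metis append_in_lists_conv image_eqI)
  qed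
  then show "carrier (weyl_group R) \<subseteq> weyl_word R ` lists R"
    by (auto simp: weyl_group_def carrier_subgroup_generated)
qed

section \<open>Coordinates with respect to the simple roots\<close>

locale root_basis =
  fixes R \<Delta> :: "'v::euclidean_space set"
  assumes root_system: "root_system R" and simple_roots: "simple_roots R \<Delta>"
begin

abbreviation "W \<equiv> carrier (weyl_group R)"
abbreviation "pos \<equiv> positive_roots R \<Delta>"
abbreviation "word \<equiv> weyl_word R"
abbreviation "len \<equiv> weyl_length R \<Delta>"

lemma finite_R: "finite R" and zero_notin_R: "0 \<notin> R"
  and reflection_R: "\<alpha> \<in> R \<Longrightarrow> \<beta> \<in> R \<Longrightarrow> reflection \<alpha> \<beta> \<in> R"
  and R_multiple: "\<alpha> \<in> R \<Longrightarrow> c *\<^sub>R \<alpha> \<in> R \<Longrightarrow> c = 1 \<or> c = - 1"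
  using root_system by (auto simp: root_system_def)

lemma simple_subset: "\<Delta> \<subseteq> R" and independent_simple: "independent \<Delta>"
  and pos_or_neg: "\<beta> \<in> R \<Longrightarrow> \<beta> \<in> pos \<or> - \<beta> \<in> pos"
  using simple_roots by (auto simp: simple_roots_def)

lemma finite_simple: "finite \<Delta>"
  using finite_R simple_subset finite_subset by blast

lemma simple_in_R: "i \<in> \<Delta> \<Longrightarrow> i \<in> R"
  using simple_subset by blast

lemma pos_subset: "pos \<subseteq> R"
  by (auto simp: positive_roots_def)

lemma finite_pos: "finite pos"
  using finite_R pos_subset finite_subset by blast

lemma uminus_R: "\<alpha> \<in> R \<Longrightarrow> - \<alpha> \<in> R"
  using reflection_R[of \<alpha> \<alpha>] by (simp add: reflection_self)

lemma simple_pos: "i \<in> \<Delta> \<Longrightarrow> i \<in> pos"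
proof -
  assume i: "i \<in> \<Delta>"
  have "i = (\<Sum>\<alpha>\<in>\<Delta>. of_nat (if \<alpha> = i then 1 else 0) *\<^sub>R \<alpha>)"
    using i finite_simple by (simp add: if_distrib[of of_nat] if_distrib[of "\<lambda>c. c *\<^sub>R _"] sum.delta cong: if_cong)
  moreover have "i \<in> R" by (rule simple_in_R[OF i])
  ultimately show ?thesis
    unfolding positive_roots_def by (intro CollectI conjI exI)
qed

text \<open>\<open>\<Delta>\<close> need not span the space, so a coordinate functional is any
  linear extension from this independent set. Its values on the span, in particular on roots, do not
  depend on the choice.\<close>

definition crd :: "'v \<Rightarrow> 'v \<Rightarrow> real" where
  "crd \<gamma> = (SOME g. linear g \<and> (\<forall>\<alpha>\<in>\<Delta>. g \<alpha> = (if \<alpha> = \<gamma> then 1 else 0)))"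

lemma linear_crd: "linear (crd \<gamma>)"
  and crd_simple: "\<alpha> \<in> \<Delta> \<Longrightarrow> crd \<gamma> \<alpha> = (if \<alpha> = \<gamma> then 1 else 0)"
proof -
  have "\<exists>g. linear g \<and> (\<forall>\<alpha>\<in>\<Delta>. g \<alpha> = (if \<alpha> = \<gamma> then 1 else (0::real)))"
    using linear_independent_extend[OF independent_simple] .
  from someI_ex[OF this] show "linear (crd \<gamma>)"
    "\<alpha> \<in> \<Delta> \<Longrightarrow> crd \<gamma> \<alpha> = (if \<alpha> = \<gamma> then 1 else 0)"
    unfolding crd_def by auto
qed

lemma crd_sum: "\<gamma> \<in> \<Delta> \<Longrightarrow> crd \<gamma> (\<Sum>\<alpha>\<in>\<Delta>. c \<alpha> *\<^sub>R \<alpha>) = c \<gamma>"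
proof -
  assume "\<gamma> \<in> \<Delta>"
  have "crd \<gamma> (\<Sum>\<alpha>\<in>\<Delta>. c \<alpha> *\<^sub>R \<alpha>) = (\<Sum>\<alpha>\<in>\<Delta>. c \<alpha> * (if \<alpha> = \<gamma> then 1 else 0))"
    by (simp add: linear_sum[OF linear_crd] linear_scale[OF linear_crd] crd_simple)
  also have "\<dots> = (\<Sum>\<alpha>\<in>\<Delta>. if \<alpha> = \<gamma> then c \<alpha> else 0)"
    by (rule sum.cong) auto
  also have "\<dots> = c \<gamma>"
    using \<open>\<gamma> \<in> \<Delta>\<close> finite_simple by (simp add: sum.delta)
  finally show ?thesis .
qed

lemma pos_crd:
  assumes "\<beta> \<in> pos"
  obtains c :: "'v \<Rightarrow> nat" where "\<beta> = (\<Sum>\<alpha>\<in>\<Delta>. of_nat (c \<alpha>) *\<^sub>R \<alpha>)"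
    and "\<And>\<gamma>. \<gamma> \<in> \<Delta> \<Longrightarrow> crd \<gamma> \<beta> = of_nat (c \<gamma>)"
proof -
  obtain c :: "'v \<Rightarrow> nat" where c: "\<beta> = (\<Sum>\<alpha>\<in>\<Delta>. of_nat (c \<alpha>) *\<^sub>R \<alpha>)"
    using assms by (auto simp: positive_roots_def)
  then have "crd \<gamma> \<beta> = of_nat (c \<gamma>)" if "\<gamma> \<in> \<Delta>" for \<gamma>
    using that by (simp add: crd_sum)
  with c that show ?thesis by blast
qed

lemma crd_nonneg: "\<beta> \<in> pos \<Longrightarrow> \<gamma> \<in> \<Delta> \<Longrightarrow> 0 \<le> crd \<gamma> \<beta>"
  by (elim pos_crd) simp

lemma pos_expand: "\<beta> \<in> pos \<Longrightarrow> \<beta> = (\<Sum>\<alpha>\<in>\<Delta>. crd \<alpha> \<beta> *\<^sub>R \<alpha>)"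
  by (elim pos_crd) simp

lemma not_pos_neg: assumes "\<beta> \<in> pos" shows "- \<beta> \<notin> pos"
proof
  assume "- \<beta> \<in> pos"
  then have "crd \<gamma> \<beta> = 0" if "\<gamma> \<in> \<Delta>" for \<gamma>
    using crd_nonneg[OF assms that] crd_nonneg[of "- \<beta>" \<gamma>] that
    by (simp add: linear_neg[OF linear_crd])
  then have "\<beta> = 0" using pos_expand[OF assms] by simp
  then show False using assms pos_subset zero_notin_R by blast
qed

text \<open>The system is reduced: a positive root supported on \<open>i\<close> alone is a
  nonnegative multiple of \<open>i\<close> and hence equal to it.\<close>

lemma pos_not_multiple:
  assumes "\<beta> \<in> pos" "i \<in> \<Delta>" "\<beta> \<noteq> i"
  shows "\<exists>\<gamma>\<in>\<Delta>. \<gamma> \<noteq> i \<and> 0 < crd \<gamma> \<beta>"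
proof (rule ccontr)
  assume "\<not> ?thesis"
  then have z: "crd \<gamma> \<beta> = 0" if "\<gamma> \<in> \<Delta>" "\<gamma> \<noteq> i" for \<gamma>
    using crd_nonneg[OF assms(1) that(1)] that by force
  have "\<beta> = (\<Sum>\<alpha>\<in>\<Delta>. if \<alpha> = i then crd i \<beta> *\<^sub>R i else 0)"
    by (subst pos_expand[OF assms(1)]) (auto intro!: sum.cong simp: z)
  then have "\<beta> = crd i \<beta> *\<^sub>R i"
    using assms(2) finite_simple by (simp add: sum.delta)
  then have "crd i \<beta> = 1 \<or> crd i \<beta> = - 1"
    using R_multiple[of i "crd i \<beta>"] assms pos_subset simple_in_R by auto
  then have "crd i \<beta> = 1"
    using crd_nonneg[OF assms(1,2)] by auto
  with \<open>\<beta> = crd i \<beta> *\<^sub>R i\<close> assms(3) show False by simp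
qed

lemma crd_reflection:
  "i \<in> \<Delta> \<Longrightarrow> \<gamma> \<noteq> i \<Longrightarrow> crd \<gamma> (reflection i \<beta>) = crd \<gamma> \<beta>"
  by (simp add: reflection_def linear_diff[OF linear_crd] linear_scale[OF linear_crd] crd_simple)

text \<open>Reflecting in \<open>i\<close> changes only the coordinate at \<open>i\<close>. A
  positive root other than \<open>i\<close> has a further positive coordinate, which survives and
  rules out a negative image.\<close>

lemma reflection_pos:
  assumes "\<beta> \<in> pos" "i \<in> \<Delta>" "\<beta> \<noteq> i"
  shows "reflection i \<beta> \<in> pos"
proof -
  obtain \<gamma> where \<gamma>: "\<gamma> \<in> \<Delta>" "\<gamma> \<noteq> i" "0 < crd \<gamma> \<beta>"
    using pos_not_multiple[OF assms] by blast
  have "- reflection i \<beta> \<notin> pos"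
    using crd_nonneg[of "- reflection i \<beta>" \<gamma>] \<gamma> assms(2)
    by (auto simp: linear_neg[OF linear_crd] crd_reflection)
  then show ?thesis
    using pos_or_neg[of "reflection i \<beta>"] reflection_R assms pos_subset simple_in_R by blast
qed

lemma reflection_pos_iff:
  assumes "i \<in> \<Delta>" "\<beta> \<in> R" "\<beta> \<noteq> i" "\<beta> \<noteq> - i"
  shows "reflection i \<beta> \<in> pos \<longleftrightarrow> \<beta> \<in> pos"
proof
  assume "\<beta> \<in> pos"
  then show "reflection i \<beta> \<in> pos" using assms by (intro reflection_pos)
next
  assume p: "reflection i \<beta> \<in> pos"
  have "reflection i \<beta> \<noteq> i"
    using assms(4) reflection_involution[of i \<beta>] reflection_self[of i] by metis
  from reflection_pos[OF p assms(1) this] show "\<beta> \<in> pos" by simp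
qed

text \<open>Induction on the height. Some simple root \<open>i\<close> has positive inner product
  with \<beta>; the reflected root is positive of smaller height, and conjugating its word by
  \<open>i\<close> gives a word for \<beta>.\<close>

lemma reflection_simple_word:
  assumes "\<beta> \<in> pos" shows "reflection \<beta> \<in> word ` lists \<Delta>"
  using assms
proof (induction "nat \<lfloor>\<Sum>\<gamma>\<in>\<Delta>. crd \<gamma> \<beta>\<rfloor>" arbitrary: \<beta> rule: less_induct)
  case less
  \<comment> \<open>Heights are natural numbers, so the floor in the induction measure keeps strict
    inequalities.\<close>
  have ht_nat: "\<exists>n::nat. (\<Sum>\<gamma>\<in>\<Delta>. crd \<gamma> \<beta>) = real n" if "\<beta> \<in> pos" for \<beta>
  proof -
    from that obtain c :: "'v \<Rightarrow> nat" where "\<And>\<gamma>. \<gamma> \<in> \<Delta> \<Longrightarrow> crd \<gamma> \<beta> = of_nat (c \<gamma>)"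
      by (rule pos_crd) blast
    then have "(\<Sum>\<gamma>\<in>\<Delta>. crd \<gamma> \<beta>) = real (\<Sum>\<gamma>\<in>\<Delta>. c \<gamma>)" by simp
    then show ?thesis by blast
  qed
  show ?case
  proof (cases "\<beta> \<in> \<Delta>")
    case True
    then have "reflection \<beta> = word [\<beta>]" "[\<beta>] \<in> lists \<Delta>" by auto
    then show ?thesis by blast
  next
    case False
    \<comment> \<open>Expanding one factor in simple roots forces some summand to be positive; this
      yields the simple root to reflect in.\<close>
    have "0 < \<beta> \<bullet> \<beta>" using less.prems zero_notin_R pos_subset by auto
    also have "\<beta> \<bullet> \<beta> = (\<Sum>\<alpha>\<in>\<Delta>. crd \<alpha> \<beta> *\<^sub>R \<alpha>) \<bullet> \<beta>"
      using pos_expand[OF less.prems] by simp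
    also have "\<dots> = (\<Sum>\<alpha>\<in>\<Delta>. crd \<alpha> \<beta> * (\<alpha> \<bullet> \<beta>))"
      by (simp add: inner_sum_left)
    finally have s: "0 < (\<Sum>\<alpha>\<in>\<Delta>. crd \<alpha> \<beta> * (\<alpha> \<bullet> \<beta>))" .
    have "\<exists>i\<in>\<Delta>. 0 < crd i \<beta> * (i \<bullet> \<beta>)"
    proof (rule ccontr)
      assume "\<not> ?thesis"
      then have "(\<Sum>\<alpha>\<in>\<Delta>. crd \<alpha> \<beta> * (\<alpha> \<bullet> \<beta>)) \<le> 0"
        by (intro sum_nonpos) (simp add: not_less)
      with s show False by simp
    qed
    then obtain i where i: "i \<in> \<Delta>" "0 < crd i \<beta> * (i \<bullet> \<beta>)" by blast
    then have ip: "0 < i \<bullet> \<beta>"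
      using crd_nonneg[OF less.prems i(1)] by (simp add: zero_less_mult_iff)
    have "i \<noteq> \<beta>" using False i by auto
    then have p: "reflection i \<beta> \<in> pos" using reflection_pos less.prems i by auto
    have "0 < i \<bullet> i" using i simple_in_R zero_notin_R by auto
    then have q: "0 < 2 * (\<beta> \<bullet> i) / (i \<bullet> i)" using ip by (simp add: inner_commute)
    have ci: "crd i (reflection i \<beta>) = crd i \<beta> - 2 * (\<beta> \<bullet> i) / (i \<bullet> i)"
      using i by (simp add: reflection_def linear_diff[OF linear_crd] linear_scale[OF linear_crd] crd_simple)
    have lt: "crd i (reflection i \<beta>) < crd i \<beta>"
      using ci q by linarith
    have "(\<Sum>\<gamma>\<in>\<Delta>. crd \<gamma> (reflection i \<beta>)) < (\<Sum>\<gamma>\<in>\<Delta>. crd \<gamma> \<beta>)"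
    proof (rule sum_strict_mono_ex1)
      show "\<forall>\<gamma>\<in>\<Delta>. crd \<gamma> (reflection i \<beta>) \<le> crd \<gamma> \<beta>"
      proof
        fix \<gamma> assume "\<gamma> \<in> \<Delta>"
        show "crd \<gamma> (reflection i \<beta>) \<le> crd \<gamma> \<beta>"
          using crd_reflection[OF i(1), of \<gamma> \<beta>] lt by (cases "\<gamma> = i") auto
      qed
      show "\<exists>\<gamma>\<in>\<Delta>. crd \<gamma> (reflection i \<beta>) < crd \<gamma> \<beta>"
        using i(1) lt by blast
    qed (rule finite_simple)
    then have "nat \<lfloor>\<Sum>\<gamma>\<in>\<Delta>. crd \<gamma> (reflection i \<beta>)\<rfloor> < nat \<lfloor>\<Sum>\<gamma>\<in>\<Delta>. crd \<gamma> \<beta>\<rfloor>"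
      using ht_nat[OF p] ht_nat[OF less.prems] by auto
    from less.hyps[OF this p] obtain ws where ws: "ws \<in> lists \<Delta>"
      "reflection (reflection i \<beta>) = word ws" by blast
    have "reflection i \<circ> reflection \<beta> = word ws \<circ> reflection i"
      using orthogonal_comp_reflection[OF orthogonal_reflection[of i], of \<beta>] ws by simp
    then have "reflection i \<circ> (reflection i \<circ> reflection \<beta>) = reflection i \<circ> (word ws \<circ> reflection i)"
      by simp
    then have "reflection \<beta> = word (i # ws @ [i])"
      by (simp add: o_assoc weyl_word_append)
    moreover have "i # ws @ [i] \<in> lists \<Delta>" using ws i by simp
    ultimately show ?thesis by blast
  qed
qed

text \<open>The group is generated by all reflections by definition. Each of them is now a word in
  simple ones, so lengths make sense on the whole group.\<close>

lemma W_eq: "W = word ` lists \<Delta>"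
proof
  show "word ` lists \<Delta> \<subseteq> W"
    using simple_subset lists_mono[of \<Delta> R] by (auto simp: carrier_weyl_group)
  have "word ws \<in> word ` lists \<Delta>" if "ws \<in> lists R" for ws
    using that
  proof (induction ws)
    case Nil
    then show ?case by (metis lists.Nil image_eqI)
  next
    case (Cons \<beta> ws)
    then obtain us where us: "us \<in> lists \<Delta>" "word ws = word us" by auto
    have "reflection \<beta> \<in> word ` lists \<Delta>"
      using Cons.hyps pos_or_neg[of \<beta>] reflection_simple_word[of \<beta>] reflection_simple_word[of "- \<beta>"]
      by (auto simp: reflection_uminus)
    then obtain vs where "vs \<in> lists \<Delta>" "reflection \<beta> = word vs" by auto
    with us have "word (\<beta> # ws) = word (vs @ us)" "vs @ us \<in> lists \<Delta>"
      by (simp_all add: weyl_word_append)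
    then show ?case by blast
  qed
  then show "W \<subseteq> word ` lists \<Delta>"
    by (auto simp: carrier_weyl_group)
qed

end

section \<open>Descents, the exchange condition and Matsumoto's theorem\<close>

lemma inv_reflection: "inv_into UNIV (reflection \<alpha>) = reflection \<alpha>"
  by (rule inv_unique_comp) simp_all

lemma in_image_reflection_iff: "\<beta> \<in> reflection \<alpha> ` A \<longleftrightarrow> reflection \<alpha> \<beta> \<in> A"
proof
  assume "reflection \<alpha> \<beta> \<in> A"
  then have "reflection \<alpha> (reflection \<alpha> \<beta>) \<in> reflection \<alpha> ` A" by (rule imageI)
  then show "\<beta> \<in> reflection \<alpha> ` A" by simp
qed auto

lemma rev_in_lists_iff [simp]: "rev ws \<in> lists A \<longleftrightarrow> ws \<in> lists A"
  by (simp add: in_lists_conv_set)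

context root_basis
begin

section \<open>The action of the group on roots\<close>

abbreviation "iw w \<equiv> inv_into UNIV w"

lemma W_wordE:
  assumes "w \<in> W" obtains ws where "ws \<in> lists \<Delta>" "w = word ws"
  using assms unfolding W_eq by blast

lemma word_W: "ws \<in> lists \<Delta> \<Longrightarrow> word ws \<in> W"
  unfolding W_eq by blast

lemma W_comp: "u \<in> W \<Longrightarrow> w \<in> W \<Longrightarrow> u \<circ> w \<in> W"
  by (elim W_wordE) (metis weyl_word_append append_in_lists_conv word_W)

lemma W_inv: "w \<in> W \<Longrightarrow> iw w \<in> W"
  by (elim W_wordE) (simp add: inv_weyl_word word_W)

lemma id_W: "id \<in> W"
  using word_W[of "[]"] by simp

lemma reflection_W: "i \<in> \<Delta> \<Longrightarrow> reflection i \<in> W"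
  using word_W[of "[i]"] by simp

lemma W_bij: "w \<in> W \<Longrightarrow> bij w"
  by (elim W_wordE) (simp only: bij_weyl_word)

lemma W_orthogonal: "w \<in> W \<Longrightarrow> orthogonal_transformation w"
  by (elim W_wordE) (simp only: orthogonal_weyl_word)

lemma W_linear: "w \<in> W \<Longrightarrow> linear w"
  using W_orthogonal by (auto simp: orthogonal_transformation_def)

lemma W_uminus: "w \<in> W \<Longrightarrow> w (- v) = - w v"
  by (rule linear_neg[OF W_linear])

lemma W_norm: "w \<in> W \<Longrightarrow> norm (w v) = norm v"
  using W_orthogonal by (auto simp: orthogonal_transformation)

lemma short_root_W: "w \<in> W \<Longrightarrow> short_root R (w v) = short_root R v"
  by (simp add: short_root_def W_norm)

lemma W_R: assumes "w \<in> W" "\<beta> \<in> R" shows "w \<beta> \<in> R"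
proof -
  have "word ws \<beta> \<in> R" if "ws \<in> lists \<Delta>" for ws
    using that by (induction ws) (simp_all add: assms(2) reflection_R simple_in_R)
  with assms(1) show ?thesis by (elim W_wordE) simp
qed

lemma iw_app: "w \<in> W \<Longrightarrow> iw w (w v) = v" and app_iw: "w \<in> W \<Longrightarrow> w (iw w v) = v"
  using W_bij by (auto simp: bij_is_inj bij_is_surj surj_f_inv_f)

lemma iw_comp: "u \<in> W \<Longrightarrow> w \<in> W \<Longrightarrow> iw (u \<circ> w) = iw w \<circ> iw u"
  using W_bij by (simp add: o_inv_distrib)

lemma iw_iw: "w \<in> W \<Longrightarrow> iw (iw w) = w"
  using W_bij by (simp add: inv_inv_eq)

lemma iw_reflection_comp: "i \<in> \<Delta> \<Longrightarrow> w \<in> W \<Longrightarrow> iw (reflection i \<circ> w) v = iw w (reflection i v)"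
  by (simp add: iw_comp reflection_W inv_reflection)

lemma pos_neg_iff: "\<beta> \<in> R \<Longrightarrow> - \<beta> \<in> pos \<longleftrightarrow> \<beta> \<notin> pos"
  using pos_or_neg not_pos_neg by blast

lemma pos_R: "\<beta> \<in> pos \<Longrightarrow> \<beta> \<in> R"
  using pos_subset by blast

lemma pos_nonneg:
  assumes "\<beta> \<in> R" "\<And>\<gamma>. \<gamma> \<in> \<Delta> \<Longrightarrow> 0 \<le> crd \<gamma> \<beta>" shows "\<beta> \<in> pos"
proof (rule ccontr)
  assume "\<beta> \<notin> pos"
  then have n: "- \<beta> \<in> pos" using pos_neg_iff assms(1) by blast
  have "crd \<gamma> (- \<beta>) = 0" if "\<gamma> \<in> \<Delta>" for \<gamma>
    using crd_nonneg[OF n that] assms(2)[OF that] by (simp add: linear_neg[OF linear_crd])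
  then have "- \<beta> = 0" by (subst pos_expand[OF n]) simp
  then show False using assms(1) zero_notin_R by simp
qed

text \<open>\<open>iw w i \<notin> pos\<close> is the form in which \<open>i\<close> is a left
  descent of \<open>w\<close> throughout. Multiplying by the reflection replaces the tested root by
  its negative.\<close>

lemma descent_flip:
  "i \<in> \<Delta> \<Longrightarrow> w \<in> W \<Longrightarrow> iw (reflection i \<circ> w) i \<in> pos \<longleftrightarrow> iw w i \<notin> pos"
  by (simp add: iw_reflection_comp reflection_self W_uminus W_inv pos_neg_iff W_R simple_in_R del: o_apply)

text \<open>Words in a subset \<open>\<Gamma>\<close> are allowed for the sake of the dihedral subgroups.\<close>

lemma exchange:
  assumes "\<Gamma> \<subseteq> \<Delta>" "ws \<in> lists \<Gamma>" "\<beta> \<in> pos" "iw (word ws) \<beta> \<notin> pos"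
  shows "\<exists>us\<in>lists \<Gamma>. length ws = Suc (length us) \<and> word us = reflection \<beta> \<circ> word ws"
  using assms(2-)
proof (induction ws arbitrary: \<beta>)
  case Nil
  then show ?case by (simp add: id_def[symmetric])
next
  case (Cons j ws)
  have j: "j \<in> \<Delta>" and wsW: "word ws \<in> W"
    using Cons assms(1) by (auto intro!: word_W)
  show ?case
  proof (cases "\<beta> = j")
    case True
    show ?thesis
    proof (intro bexI conjI)
      show "length (j # ws) = Suc (length ws)" by simp
      show "word ws = reflection \<beta> \<circ> word (j # ws)" by (simp add: True o_assoc)
      show "ws \<in> lists \<Gamma>" by (rule Cons.hyps)
    qed
  next
    case False
    \<comment> \<open>Since \<beta> differs from \<open>j\<close>, its reflection stays positive,
      and the letter to be deleted is found in the tail.\<close>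
    have p: "reflection j \<beta> \<in> pos"
      using reflection_pos Cons.prems j False by blast
    have "iw (word ws) (reflection j \<beta>) \<notin> pos"
      using Cons.prems(2) by (simp only: weyl_word_Cons iw_reflection_comp[OF j wsW] not_False_eq_True)
    then obtain us where us: "us \<in> lists \<Gamma>" "length ws = Suc (length us)"
      "word us = reflection (reflection j \<beta>) \<circ> word ws"
      using Cons.IH[OF p] by blast
    have "reflection j \<circ> reflection (reflection j \<beta>) = reflection \<beta> \<circ> reflection j"
      using orthogonal_comp_reflection[OF orthogonal_reflection[of j], of "reflection j \<beta>"] by simp
    then have "word (j # us) = reflection \<beta> \<circ> word (j # ws)"
      by (simp add: us o_assoc)
    moreover have "length (j # ws) = Suc (length (j # us))" "j # us \<in> lists \<Gamma>"
      using us Cons.hyps by simp_all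
    ultimately show ?thesis by blast
  qed
qed

section \<open>Length and left descents\<close>

lemma len_le: "ws \<in> lists \<Delta> \<Longrightarrow> len (word ws) \<le> length ws"
  unfolding weyl_length_def by (rule Least_le) blast

lemma reduced_exists:
  assumes "w \<in> W" obtains ws where "reduced_expression R \<Delta> w ws"
proof -
  obtain ws where "ws \<in> lists \<Delta>" "word ws = w" using assms by (elim W_wordE) blast
  then have "\<exists>n. \<exists>ws\<in>lists \<Delta>. length ws = n \<and> word ws = w" by blast
  from LeastI_ex[OF this] obtain us where "us \<in> lists \<Delta>" "length us = len w" "word us = w"
    unfolding weyl_length_def by blast
  then show ?thesis by (intro that) (simp add: reduced_expression_def)
qed

lemma len_word_comp:
  assumes "us \<in> lists \<Delta>" "w \<in> W" shows "len (word us \<circ> w) \<le> length us + len w"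
proof -
  obtain ws where ws: "ws \<in> lists \<Delta>" "word ws = w" "length ws = len w"
    using reduced_exists[OF assms(2)] by (auto simp: reduced_expression_def)
  have "len (word (us @ ws)) \<le> length (us @ ws)"
    using assms ws by (intro len_le) simp
  then show ?thesis by (simp add: weyl_word_append ws)
qed

lemma reflection_comp_comp: "reflection i \<circ> (reflection i \<circ> w) = w"
  by (simp add: o_assoc)

text \<open>Exchange deletes a letter from a shortest word, so the length drops; a single letter
  cannot change it by more than one.\<close>

lemma len_descent:
  assumes "w \<in> W" "i \<in> \<Delta>" "iw w i \<notin> pos" shows "len w = Suc (len (reflection i \<circ> w))"
proof -
  obtain ws where ws: "ws \<in> lists \<Delta>" "word ws = w" "length ws = len w"
    using reduced_exists[OF assms(1)] by (auto simp: reduced_expression_def)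
  obtain us where "us \<in> lists \<Delta>" "length ws = Suc (length us)" "word us = reflection i \<circ> w"
    using exchange[of \<Delta> ws i] ws assms simple_pos by auto
  then have "len (reflection i \<circ> w) < len w"
    using len_le[of us] ws by simp
  moreover have "len w \<le> Suc (len (reflection i \<circ> w))"
    using len_word_comp[of "[i]" "reflection i \<circ> w"] assms
    by (simp add: W_comp reflection_W reflection_comp_comp)
  ultimately show ?thesis by simp
qed

lemma len_ascent:
  assumes "w \<in> W" "i \<in> \<Delta>" "iw w i \<in> pos" shows "len (reflection i \<circ> w) = Suc (len w)"
  using len_descent[of "reflection i \<circ> w" i] descent_flip[of i w] assms
  by (simp add: W_comp reflection_W reflection_comp_comp)

lemma reduced_ConsD:
  assumes "reduced_expression R \<Delta> w (i # us)"
  shows "reduced_expression R \<Delta> (reflection i \<circ> w) us" and "iw w i \<notin> pos"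
    and "i \<in> \<Delta>" and "w \<in> W"
proof -
  have us: "us \<in> lists \<Delta>" "word us = reflection i \<circ> w" "Suc (length us) = len w"
    using assms by (auto simp: reduced_expression_def reflection_comp_comp)
  show i: "i \<in> \<Delta>" using assms by (simp add: reduced_expression_def)
  show w: "w \<in> W" using assms word_W[of "i # us"] by (simp add: reduced_expression_def)
  have "len (reflection i \<circ> w) < len w"
    using len_le[OF us(1)] us by simp
  then show d: "iw w i \<notin> pos" using len_ascent[OF w i] by auto
  show "reduced_expression R \<Delta> (reflection i \<circ> w) us"
    using us len_descent[OF w i d] by (simp add: reduced_expression_def)
qed

lemma reduced_ConsI:
  assumes "reduced_expression R \<Delta> w us" "w \<in> W" "i \<in> \<Delta>" "iw w i \<in> pos"
  shows "reduced_expression R \<Delta> (reflection i \<circ> w) (i # us)"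
  using assms len_ascent[of w i] by (simp add: reduced_expression_def)

lemma reduced_Nil: "reduced_expression R \<Delta> id []"
  using len_le[of "[]"] by (simp add: reduced_expression_def)

text \<open>The first letter of a nonempty reduced word would be a descent.\<close>

lemma no_descent_id:
  assumes "w \<in> W" "\<And>i. i \<in> \<Delta> \<Longrightarrow> iw w i \<in> pos" shows "w = id"
proof -
  obtain ws where ws: "reduced_expression R \<Delta> w ws" using reduced_exists[OF assms(1)] .
  show ?thesis
  proof (cases ws)
    case Nil
    then show ?thesis using ws by (simp add: reduced_expression_def)
  next
    case (Cons i us)
    then show ?thesis using reduced_ConsD ws assms by blast
  qed
qed

section \<open>Cosets of dihedral subgroups\<close>

lemma crd_word_outside:
  assumes "i \<in> \<Delta>" "j \<in> \<Delta>" "vs \<in> lists {i, j}" "\<gamma> \<notin> {i, j}"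
  shows "crd \<gamma> (word vs v) = crd \<gamma> v"
  using assms(3) by (induction vs) (use assms in \<open>auto simp: crd_reflection\<close>)

text \<open>If \<open>u\<close> had a left descent x in the dihedral subgroup, the negated preimage
  of x under \<open>u\<close> would be a nonnegative combination of \<open>i\<close> and
  \<open>j\<close>. The inverse of \<open>w\<close> keeps it positive, so x would be a descent of
  \<open>u \<circ> w\<close> as well.\<close>

lemma dihedral_coset_unique:
  assumes ij: "i \<in> \<Delta>" "j \<in> \<Delta>" and w: "w \<in> W" "iw w i \<in> pos" "iw w j \<in> pos"
    and u: "u \<in> word ` lists {i, j}" and uw: "iw (u \<circ> w) i \<in> pos" "iw (u \<circ> w) j \<in> pos"
  shows "u = id"
proof -
  \<comment> \<open>A word shortest among those in \<open>i\<close> and \<open>j\<close> is taken,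
    so that exchange inside the dihedral subgroup makes its first letter a descent.\<close>
  define P where "P = (\<lambda>vs. vs \<in> lists {i, j} \<and> word vs = u)"
  obtain v0 where "P v0" using u by (auto simp: P_def)
  define vs where "vs = arg_min length P"
  have vs: "vs \<in> lists {i, j}" "word vs = u"
    and min: "\<And>us. P us \<Longrightarrow> length vs \<le> length us"
    using arg_min_nat_lemma[of P v0 length] \<open>P v0\<close> by (auto simp: vs_def P_def)
  have sub: "{i, j} \<subseteq> \<Delta>" using ij by simp
  have uW: "u \<in> W" using vs word_W[of vs] lists_mono[OF sub] by blast
  show ?thesis
  proof (cases vs)
    case Nil
    then show ?thesis using vs by simp
  next
    case (Cons x us)
    have x: "x \<in> {i, j}" "x \<in> \<Delta>" and us: "us \<in> lists {i, j}" and u_eq: "u = reflection x \<circ> word us"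
      using vs Cons ij by auto
    have usW: "word us \<in> W" using us word_W lists_mono[OF sub] by blast
    have neg: "iw u x \<notin> pos"
    proof
      assume "iw u x \<in> pos"
      then have "iw (word us) x \<notin> pos"
        using descent_flip[OF x(2) usW] by (simp add: u_eq)
      from exchange[OF sub us simple_pos[OF x(2)] this] obtain us' where
        "us' \<in> lists {i, j}" "length us = Suc (length us')" "word us' = reflection x \<circ> word us"
        by blast
      then show False using min[of us'] Cons by (simp add: P_def u_eq)
    qed
    define \<beta> where "\<beta> = - iw u x"
    have \<beta>: "\<beta> \<in> pos"
      using neg pos_neg_iff[of "iw u x"] W_R[OF W_inv[OF uW]] simple_in_R[OF x(2)]
      by (simp add: \<beta>_def)
    have out: "crd \<gamma> \<beta> = 0" if "\<gamma> \<in> \<Delta>" "\<gamma> \<notin> {i, j}" for \<gamma>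
    proof -
      have "iw u = word (rev vs)" using vs inv_weyl_word by blast
      then have "crd \<gamma> (iw u x) = crd \<gamma> x"
        using crd_word_outside[OF ij, of "rev vs" \<gamma>] vs(1) that by simp
      also have "\<dots> = 0" using x that by (auto simp: crd_simple)
      finally show ?thesis by (simp add: \<beta>_def linear_neg[OF linear_crd])
    qed
    have "iw w \<beta> \<in> pos"
    proof (rule pos_nonneg)
      show "iw w \<beta> \<in> R" using W_R[OF W_inv[OF w(1)] pos_R[OF \<beta>]] .
      fix \<gamma> assume \<gamma>: "\<gamma> \<in> \<Delta>"
      have "crd \<gamma> (iw w \<beta>) = crd \<gamma> (iw w (\<Sum>\<alpha>\<in>\<Delta>. crd \<alpha> \<beta> *\<^sub>R \<alpha>))"
        using pos_expand[OF \<beta>] by simp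
      also have "\<dots> = (\<Sum>\<alpha>\<in>\<Delta>. crd \<alpha> \<beta> * crd \<gamma> (iw w \<alpha>))"
        by (simp add: linear_sum[OF W_linear[OF W_inv[OF w(1)]]] linear_sum[OF linear_crd]
          linear_scale[OF W_linear[OF W_inv[OF w(1)]]] linear_scale[OF linear_crd])
      also have "\<dots> \<ge> 0"
      proof (rule sum_nonneg)
        fix \<alpha> assume "\<alpha> \<in> \<Delta>"
        show "0 \<le> crd \<alpha> \<beta> * crd \<gamma> (iw w \<alpha>)"
        proof (cases "\<alpha> \<in> {i, j}")
          case True
          then have "iw w \<alpha> \<in> pos" using w by auto
          then show ?thesis
            using crd_nonneg \<beta> \<gamma> \<open>\<alpha> \<in> \<Delta>\<close> by simp
        next
          case False
          then show ?thesis using out \<open>\<alpha> \<in> \<Delta>\<close> by simp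
        qed
      qed
      finally show "0 \<le> crd \<gamma> (iw w \<beta>)" .
    qed
    then have "- iw (u \<circ> w) x \<in> pos"
      by (simp add: iw_comp[OF uW w(1)] \<beta>_def W_uminus[OF W_inv[OF w(1)]])
    moreover have "iw (u \<circ> w) x \<in> pos" using uw x by auto
    ultimately show ?thesis using not_pos_neg by blast
  qed
qed

text \<open>Descents are removed in turn, starting with \<open>i\<close>. The implication between
  the two descents ensures that when \<open>i\<close> is none, neither is \<open>j\<close>. After
  one step it holds with the letters exchanged, because the letter just removed is no descent any
  more.\<close>

lemma strip_alternating:
  assumes "w \<in> W" "i \<in> \<Delta>" "j \<in> \<Delta>" "iw w j \<notin> pos \<Longrightarrow> iw w i \<notin> pos"
  shows "\<exists>k w'. w' \<in> W \<and> w = word (alternating_word i j k) \<circ> w' \<and> len w = k + len w'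
    \<and> iw w' i \<in> pos \<and> iw w' j \<in> pos"
  using assms
proof (induction "len w" arbitrary: w i j rule: less_induct)
  case less
  show ?case
  proof (cases "iw w i \<in> pos")
    case True
    then have "w = word (alternating_word i j 0) \<circ> w" "len w = 0 + len w" "iw w j \<in> pos"
      using less.prems by auto
    then show ?thesis using True less.prems(1) by blast
  next
    case False
    let ?v = "reflection i \<circ> w"
    have l: "len w = Suc (len ?v)" using len_descent less.prems False by blast
    have v: "?v \<in> W" using less.prems by (simp add: W_comp reflection_W)
    have "iw ?v i \<in> pos" using descent_flip less.prems False by blast
    then obtain k w' where k: "w' \<in> W" "?v = word (alternating_word j i k) \<circ> w'" "len ?v = k + len w'"
      "iw w' j \<in> pos" "iw w' i \<in> pos"
      using less.hyps[of ?v j i] l v less.prems by auto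
    have "w = reflection i \<circ> ?v" by (simp add: reflection_comp_comp)
    also have "\<dots> = word (alternating_word i j (Suc k)) \<circ> w'"
      unfolding k(2) by (simp add: o_assoc)
    finally have "w = word (alternating_word i j (Suc k)) \<circ> w'" .
    moreover have "len w = Suc k + len w'" using l k by simp
    ultimately show ?thesis using k by blast
  qed
qed

section \<open>Alternating words and the order of a product of two reflections\<close>

definition dih :: "'v \<Rightarrow> 'v \<Rightarrow> nat" where
  "dih i j = group.ord (weyl_group R) (reflection i \<otimes>\<^bsub>weyl_group R\<^esub> reflection j)"

lemma alternating_word_lists: "i \<in> A \<Longrightarrow> j \<in> A \<Longrightarrow> alternating_word i j n \<in> lists A"
  by (induction i j n rule: alternating_word.induct) auto

lemma length_alternating_word [simp]: "length (alternating_word i j n) = n"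
  by (induction i j n rule: alternating_word.induct) auto

lemma alternating_word_even_snoc:
  "alternating_word i j (2 * n) @ [i] = alternating_word i j (Suc (2 * n))"
  by (induction n) simp_all

lemma alternating_word_append_rev:
  "alternating_word i j n @ rev (alternating_word j i n) = alternating_word i j (2 * n)"
proof (induction n arbitrary: i j)
  case (Suc n)
  have "alternating_word i j (Suc n) @ rev (alternating_word j i (Suc n))
      = i # (alternating_word j i n @ rev (alternating_word i j n)) @ [j]" by simp
  also have "\<dots> = i # alternating_word j i (2 * n) @ [j]" using Suc by simp
  also have "\<dots> = alternating_word i j (2 * Suc n)"
    by (simp add: alternating_word_even_snoc)
  finally show ?case .
qed simp

text \<open>The tail starts with \<open>i\<close> or \<open>j\<close> according to the parity of
  \<open>m\<close>, so only its length and its alphabet are recorded.\<close>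

lemma alternating_word_add:
  "\<exists>z\<in>lists {i, j}. alternating_word i j (m + n) = alternating_word i j m @ z \<and> length z = n"
proof (induction m arbitrary: i j)
  case 0
  show ?case
    by (rule bexI[OF _ alternating_word_lists[of i "{i, j}" j n]]) simp_all
next
  case (Suc m)
  from Suc[of j i] obtain z where "z \<in> lists {j, i}" "alternating_word j i (m + n) = alternating_word j i m @ z"
    "length z = n" by blast
  moreover have "z \<in> lists {i, j}" using \<open>z \<in> lists {j, i}\<close> by (simp only: insert_commute)
  ultimately show ?case by (intro bexI[of _ z]) simp_all
qed

lemma word_alternating_pow:
  "word (alternating_word i j (2 * n)) = (reflection i \<otimes>\<^bsub>weyl_group R\<^esub> reflection j) [^]\<^bsub>weyl_group R\<^esub> n"
proof (induction n)
  case 0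
  have "word [] = \<one>\<^bsub>weyl_group R\<^esub>" by (simp add: weyl_word_def word_prod_def)
  then show ?case by (simp add: nat_pow_def)
next
  case (Suc n)
  have e: "alternating_word i j (2 * Suc n) = alternating_word i j (2 * n) @ [i, j]"
    by (induction n) (simp_all add: numeral_2_eq_2)
  have "word (alternating_word i j (2 * Suc n)) = word (alternating_word i j (2 * n)) \<circ> word [i, j]"
    unfolding e weyl_word_append ..
  also have "\<dots> = word (alternating_word i j (2 * n)) \<otimes>\<^bsub>weyl_group R\<^esub> word [i, j]"
    by (rule weyl_mult[OF bij_weyl_word bij_weyl_word, symmetric])
  also have "word [i, j] = reflection i \<otimes>\<^bsub>weyl_group R\<^esub> reflection j"
    using weyl_mult[OF bij_reflection bij_reflection, of R i j] by simp
  finally show ?case by (simp only: Suc nat_pow_Suc)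
qed

text \<open>Reversing a word inverts its product. Multiplying by the inverse of the second word
  therefore turns the equality into triviality of the n-th power of a product of two
  reflections.\<close>

lemma alternating_eq_iff:
  assumes "i \<in> \<Delta>" "j \<in> \<Delta>"
  shows "word (alternating_word i j n) = word (alternating_word j i n) \<longleftrightarrow> dih i j dvd n"
proof -
  let ?a = "word (alternating_word i j n)" and ?b = "word (alternating_word j i n)"
  have inv: "iw ?b = word (rev (alternating_word j i n))" by (rule inv_weyl_word)
  have l: "alternating_word i j n \<in> lists \<Delta>" "alternating_word j i n \<in> lists \<Delta>"
    using assms by (simp_all only: alternating_word_lists)
  have "?a = ?b \<longleftrightarrow> ?a \<circ> iw ?b = id"
  proof
    assume "?a \<circ> iw ?b = id"
    then have "?a (iw ?b (?b v)) = ?b v" for v by (metis comp_apply id_apply)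
    then show "?a = ?b" unfolding iw_app[OF word_W[OF l(2)]] by (rule ext)
  next
    assume e: "?a = ?b"
    show "?a \<circ> iw ?b = id"
      unfolding e by (rule ext) (simp only: comp_apply id_apply app_iw[OF word_W[OF l(2)]])
  qed
  also have "?a \<circ> iw ?b = word (alternating_word i j (2 * n))"
    unfolding inv weyl_word_append[symmetric] alternating_word_append_rev ..
  also have "(\<dots> = id) = ((reflection i \<otimes>\<^bsub>weyl_group R\<^esub> reflection j) [^]\<^bsub>weyl_group R\<^esub> n = \<one>\<^bsub>weyl_group R\<^esub>)"
    by (simp add: word_alternating_pow weyl_group_def BijGroup_def fun_eq_iff)
  also have "\<dots> \<longleftrightarrow> dih i j dvd n"
    unfolding dih_def
  proof (rule group.pow_eq_id[OF group_weyl_group])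
    show "reflection i \<otimes>\<^bsub>weyl_group R\<^esub> reflection j \<in> W"
      using weyl_mult[OF bij_reflection bij_reflection, of R i j] assms by (simp add: W_comp reflection_W)
  qed
  finally show ?thesis .
qed

text \<open>Stripping may start with either letter. Both ways end in the same coset representative,
  hence after the same number k of steps, and the two alternating words of length k agree. So the
  order divides k, and a larger k would contradict additivity of lengths.\<close>

lemma dihedral_decomposition:
  assumes w: "w \<in> W" and ij: "i \<in> \<Delta>" "j \<in> \<Delta>" and d: "iw w i \<notin> pos" "iw w j \<notin> pos"
  obtains w' where "w' \<in> W" "w = word (alternating_word i j (dih i j)) \<circ> w'"
    "w = word (alternating_word j i (dih i j)) \<circ> w'" "len w = dih i j + len w'" "0 < dih i j"
proof -
  have sub: "{i, j} \<subseteq> \<Delta>" "{j, i} \<subseteq> \<Delta>" using ij by simp_all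
  obtain k w' where k: "w' \<in> W" "w = word (alternating_word i j k) \<circ> w'" "len w = k + len w'"
    "iw w' i \<in> pos" "iw w' j \<in> pos" using strip_alternating[OF w ij] d by blast
  obtain l w'' where l: "w'' \<in> W" "w = word (alternating_word j i l) \<circ> w''" "len w = l + len w''"
    "iw w'' j \<in> pos" "iw w'' i \<in> pos" using strip_alternating[OF w ij(2,1)] d by blast
  define u where "u = word (rev (alternating_word j i l) @ alternating_word i j k)"
  have "u \<in> word ` lists {i, j}"
    unfolding u_def by (intro imageI) (simp add: alternating_word_lists)
  moreover have "w'' = u \<circ> w'"
  proof -
    have "u \<circ> w' = word (rev (alternating_word j i l)) \<circ> w"
      unfolding u_def weyl_word_append k(2) by (simp only: o_assoc)
    also have "\<dots> = w''"
      unfolding l(2) by (simp only: o_assoc weyl_word_rev_comp id_o)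
    finally show ?thesis ..
  qed
  ultimately have "u = id"
    using dihedral_coset_unique[OF ij k(1,4,5)] l by blast
  then have ww: "w'' = w'" using \<open>w'' = u \<circ> w'\<close> by simp
  then have kl: "l = k" using k l by simp
  have "word (alternating_word i j k) v = word (alternating_word j i k) v" for v
  proof -
    have "word (alternating_word i j k) (w' (iw w' v)) = word (alternating_word j i k) (w' (iw w' v))"
      using k(2) l(2) ww kl by (metis comp_apply)
    then show ?thesis by (simp add: app_iw k(1))
  qed
  then have eq: "word (alternating_word i j k) = word (alternating_word j i k)" by blast
  then have dvd: "dih i j dvd k" using alternating_eq_iff ij by blast
  \<comment> \<open>Divisibility alone would allow k = 0 and order 0; both are excluded because
    \<open>i\<close> is a descent of \<open>w\<close> but not of \<open>w'\<close>.\<close>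
  have "k \<noteq> 0"
  proof
    assume "k = 0"
    then have "w = w'" using k(2) by simp
    then show False using k(4) d(1) by blast
  qed
  then have m: "0 < dih i j" "dih i j \<le> k"
    using dvd by (auto intro!: Nat.gr0I dvd_imp_le)
  \<comment> \<open>With order m + 1, a braid move on the letters after the first creates a repeated
    \<open>i\<close>. Cancelling it shortens m + 2 letters to m.\<close>
  have "\<not> dih i j < k"
  proof
    assume lt: "dih i j < k"
    obtain m where m: "dih i j = Suc m" using m by (cases "dih i j") auto
    obtain n where n: "k = Suc (Suc m) + n" using lt m less_iff_Suc_add by auto
    obtain z where z: "z \<in> lists {i, j}" "alternating_word i j k = alternating_word i j (Suc (Suc m)) @ z"
      "length z = n" using alternating_word_add[of i j "Suc (Suc m)" n, folded n] by blast
    have "word (alternating_word j i (Suc m)) = word (alternating_word i j (Suc m))"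
      using alternating_eq_iff[OF ij, of "Suc m"] m by simp
    then have "word (alternating_word i j (Suc (Suc m))) = reflection i \<circ> word (alternating_word i j (Suc m))"
      by simp
    also have "\<dots> = word (alternating_word j i m)"
      by (simp add: reflection_comp_comp)
    finally have "w = word (alternating_word j i m @ z) \<circ> w'"
      unfolding k(2) z(2) weyl_word_append by simp
    moreover have "alternating_word j i m @ z \<in> lists \<Delta>"
      using z(1) lists_mono[OF sub(1)] ij by (simp add: alternating_word_lists subset_iff)
    ultimately have "len w \<le> (m + n) + len w'"
      using len_word_comp[of "alternating_word j i m @ z" w'] k(1) z(3) by simp
    then show False using k(3) n by simp
  qed
  then have "dih i j = k" using m by simp
  with that k l ww kl m show ?thesis by blast
qed

text \<open>If the words start with distinct letters, both letters are descents of \<open>w\<close>,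
  so \<open>w\<close> has reduced words beginning with either of the two alternating words. A braid
  move connects these, and induction on tails connects each to the given word with the same first
  letter. \<open>E\<close> is abstract so that it can become congruence of monomials.\<close>

theorem matsumoto:
  assumes refl: "\<And>a. E a a" and trans: "\<And>a b c. E a b \<Longrightarrow> E b c \<Longrightarrow> E a c"
    and cong: "\<And>i a b. i \<in> \<Delta> \<Longrightarrow> a \<in> lists \<Delta> \<Longrightarrow> b \<in> lists \<Delta> \<Longrightarrow> E a b \<Longrightarrow> E (i # a) (i # b)"
    and braid: "\<And>i j z. i \<in> \<Delta> \<Longrightarrow> j \<in> \<Delta> \<Longrightarrow> i \<noteq> j \<Longrightarrow> z \<in> lists \<Delta> \<Longrightarrow>
      E (alternating_word i j (dih i j) @ z) (alternating_word j i (dih i j) @ z)"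
    and us: "reduced_expression R \<Delta> w us" and vs: "reduced_expression R \<Delta> w vs"
  shows "E us vs"
  using us vs
proof (induction us arbitrary: w vs rule: length_induct)
  case (1 us)
  have lists: "a \<in> lists \<Delta>" if "reduced_expression R \<Delta> w a" for a w
    using that by (simp only: reduced_expression_def)
  have lens: "length a = length b" if "reduced_expression R \<Delta> w a" "reduced_expression R \<Delta> w b" for w a b
    using that by (simp add: reduced_expression_def)
  show ?case
  proof (cases us)
    case Nil
    then show ?thesis using lens[OF 1(2,3)] refl by simp
  next
    case (Cons s u)
    then obtain t v where tv: "vs = t # v" using lens[OF 1(2,3)] by (cases vs) auto
    have s: "reduced_expression R \<Delta> (reflection s \<circ> w) u" "iw w s \<notin> pos" "s \<in> \<Delta>" "w \<in> W"
      using reduced_ConsD[of w s u] 1(2) Cons by auto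
    have t: "reduced_expression R \<Delta> (reflection t \<circ> w) v" "iw w t \<notin> pos" "t \<in> \<Delta>"
      using reduced_ConsD[of w t v] 1(3) tv by auto
    have IH: "E (x # a) (x # b)" if "reduced_expression R \<Delta> w (x # a)" "reduced_expression R \<Delta> w (x # b)" for x a b
    proof -
      have "length a < length us" using lens[OF 1(2) that(1)] by simp
      moreover have "reduced_expression R \<Delta> (reflection x \<circ> w) a" "reduced_expression R \<Delta> (reflection x \<circ> w) b"
        using reduced_ConsD that by blast+
      ultimately show ?thesis using 1(1) that cong reduced_ConsD(3)[OF that(1)] lists by blast
    qed
    show ?thesis
    proof (cases "s = t")
      case True
      then show ?thesis using IH 1 Cons tv by blast
    next
      case False
      obtain w' where w': "w' \<in> W" "w = word (alternating_word s t (dih s t)) \<circ> w'"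
        "w = word (alternating_word t s (dih s t)) \<circ> w'" "len w = dih s t + len w'" "0 < dih s t"
        using dihedral_decomposition s t by blast
      obtain m where m: "dih s t = Suc m" using w'(5) by (cases "dih s t") auto
      obtain z where z: "reduced_expression R \<Delta> w' z" using reduced_exists w' by blast
      have al: "alternating_word s t n \<in> lists \<Delta>" "alternating_word t s n \<in> lists \<Delta>" for n
        using s(3) t(3) by (simp_all add: alternating_word_lists)
      have r: "reduced_expression R \<Delta> w (alternating_word s t (dih s t) @ z)"
        "reduced_expression R \<Delta> w (alternating_word t s (dih s t) @ z)"
        using z w' al unfolding reduced_expression_def weyl_word_append by simp_all
      have "E us (alternating_word s t (dih s t) @ z)"
        using IH[of s u "alternating_word t s m @ z"] 1(2) r(1) Cons m by simp
      moreover have "E (alternating_word t s (dih s t) @ z) vs"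
        using IH[of t "alternating_word s t m @ z" v] 1(3) r(2) tv m by simp
      ultimately show ?thesis
        using braid[OF s(3) t(3) False lists[OF z]] trans by blast
    qed
  qed
qed

section \<open>The longest element\<close>

text \<open>For a word \<open>s\<^sub>1 \<dots> s\<^sub>n\<close>, the list of the roots \<open>s\<^sub>1 \<dots> s\<^sub>k\<^sub>-\<^sub>1 \<alpha>\<^sub>k\<close>, paired with the palindromic words
  \<open>s\<^sub>1 \<dots> s\<^sub>k \<dots> s\<^sub>1\<close> of their reflections.\<close>

fun inversions :: "'v list \<Rightarrow> ('v \<times> 'v list) list" where
  "inversions [] = []"
| "inversions (j # us) = (j, [j]) # map (\<lambda>(\<beta>, p). (reflection j \<beta>, j # p @ [j])) (inversions us)"

lemma length_inversions: "length (inversions ws) = length ws"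
  by (induction ws rule: inversions.induct) simp_all

lemma inversions_word:
  assumes "ws \<in> lists \<Delta>" "(\<beta>, p) \<in> set (inversions ws)"
  shows "p \<in> lists \<Delta> \<and> word p = reflection \<beta>"
  using assms
proof (induction ws arbitrary: \<beta> p rule: inversions.induct)
  case (2 j us)
  show ?case
  proof (cases "(\<beta>, p) = (j, [j])")
    case True
    then show ?thesis using 2 by simp
  next
    case False
    then obtain \<gamma> q where q: "(\<gamma>, q) \<in> set (inversions us)" "\<beta> = reflection j \<gamma>" "p = j # q @ [j]"
      using 2 by auto
    then have "q \<in> lists \<Delta>" "word q = reflection \<gamma>" using 2 by auto
    moreover have "reflection j \<circ> (reflection \<gamma> \<circ> reflection j) = reflection (reflection j \<gamma>)"
      using orthogonal_comp_reflection[OF orthogonal_reflection[of j], of \<gamma>]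
      by (simp add: o_assoc) (simp add: o_assoc[symmetric])
    ultimately show ?thesis using q 2 by (simp add: weyl_word_append)
  qed
qed simp

text \<open>In a reduced word the first letter \<open>j\<close> is an inversion. The remaining
  inversions are those of the shorter element moved by the reflection in \<open>j\<close>, which
  permutes the positive roots other than \<open>j\<close>.\<close>

lemma inversions_reduced:
  assumes "reduced_expression R \<Delta> w ws"
  shows "distinct (map fst (inversions ws)) \<and>
    set (map fst (inversions ws)) = {\<beta> \<in> pos. iw w \<beta> \<notin> pos}"
  using assms
proof (induction ws arbitrary: w rule: inversions.induct)
  case 1
  then have "w = id" by (simp add: reduced_expression_def)
  then show ?case by auto
next
  case (2 j us)
  let ?u = "reflection j \<circ> w"
  let ?f = "map fst (inversions us)"
  have j: "reduced_expression R \<Delta> ?u us" "iw w j \<notin> pos" "j \<in> \<Delta>" "w \<in> W"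
    using reduced_ConsD[OF 2(2)] by auto
  have IH: "distinct ?f" "set ?f = {\<beta> \<in> pos. iw ?u \<beta> \<notin> pos}"
    by (rule conjunct1[OF 2(1)[OF j(1)]], rule conjunct2[OF 2(1)[OF j(1)]])
  have u: "iw ?u \<beta> = iw w (reflection j \<beta>)" for \<beta>
    using iw_reflection_comp j by blast
  have f: "map fst (inversions (j # us)) = j # map (reflection j) ?f"
    by (simp add: case_prod_beta comp_def)
  have ju: "iw ?u j \<in> pos" using descent_flip j by blast
  have nj: "- j \<notin> pos" "j \<in> pos" using not_pos_neg simple_pos j by auto
  have inj: "inj (reflection j)" by (rule bij_is_inj[OF bij_reflection])
  have mem: "\<beta> \<in> reflection j ` set ?f \<longleftrightarrow> reflection j \<beta> \<in> set ?f" for \<beta>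
    by (rule in_image_reflection_iff)
  have "j \<notin> reflection j ` set ?f"
    unfolding mem unfolding IH(2) by (simp add: reflection_self nj)
  moreover have "distinct (map (reflection j) ?f)"
    unfolding distinct_map[of "reflection j" ?f] using IH(1) inj_on_subset[OF inj] by blast
  moreover have "insert j (reflection j ` set ?f) = {\<beta> \<in> pos. iw w \<beta> \<notin> pos}"
  proof (rule Set.set_eqI)
    fix \<beta>
    show "\<beta> \<in> insert j (reflection j ` set ?f) \<longleftrightarrow> \<beta> \<in> {\<beta> \<in> pos. iw w \<beta> \<notin> pos}"
    proof (cases "\<beta> = j")
      case True
      then show ?thesis using j nj by simp
    next
      case False
      have "reflection j \<beta> \<noteq> j" if "\<beta> \<in> pos"
        using that nj by (metis reflection_involution reflection_self)
      then have "reflection j \<beta> \<in> pos \<and> reflection j \<beta> \<noteq> j \<longleftrightarrow> \<beta> \<in> pos"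
        using reflection_pos[OF _ j(3) False] reflection_pos[OF _ j(3), of "reflection j \<beta>"]
        unfolding reflection_involution by blast
      moreover have "iw ?u (reflection j \<beta>) = iw w \<beta>"
        unfolding u reflection_involution ..
      moreover have "iw ?u (reflection j \<beta>) \<in> pos" if "reflection j \<beta> = j"
        using ju that by simp
      ultimately show ?thesis
        using False unfolding insert_iff mem unfolding IH(2) mem_Collect_eq by metis
    qed
  qed
  ultimately show ?case unfolding f distinct.simps list.set set_map by blast
qed

text \<open>The inversions of a reduced word are distinct positive roots. The bound makes the group
  finite and provides an element of maximal length.\<close>

lemma len_le_card: "w \<in> W \<Longrightarrow> len w \<le> card pos"
proof -
  assume "w \<in> W"
  then obtain ws where ws: "reduced_expression R \<Delta> w ws" using reduced_exists by blast
  then have "len w = length (map fst (inversions ws))"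
    by (simp add: reduced_expression_def length_inversions)
  also have "\<dots> = card (set (map fst (inversions ws)))"
    by (rule distinct_card[symmetric, OF conjunct1[OF inversions_reduced[OF ws]]])
  also have "\<dots> \<le> card pos"
    using inversions_reduced[OF ws] finite_pos by (intro card_mono) auto
  finally show ?thesis .
qed

lemma finite_W: "finite W"
proof (rule finite_subset)
  show "W \<subseteq> word ` {ws. set ws \<subseteq> \<Delta> \<and> length ws \<le> card pos}"
  proof
    fix w assume w: "w \<in> W"
    then obtain ws where "reduced_expression R \<Delta> w ws" using reduced_exists by blast
    then show "w \<in> word ` {ws. set ws \<subseteq> \<Delta> \<and> length ws \<le> card pos}"
      using len_le_card[OF w] by (intro image_eqI[of _ _ ws]) (auto simp: reduced_expression_def)
  qed
qed (simp add: finite_lists_length_le finite_simple)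

text \<open>The sign condition that identifies the longest element; it passes to inverses and
  determines the element, which makes it handier than maximality of the length.\<close>

definition inverts :: "('v \<Rightarrow> 'v) \<Rightarrow> bool" where
  "inverts w \<longleftrightarrow> w \<in> W \<and> (\<forall>\<beta>\<in>pos. iw w \<beta> \<notin> pos)"

text \<open>By linearity: the negated images of the simple roots are positive, and a positive root
  combines them with nonnegative coefficients.\<close>

lemma invertsI: assumes "w \<in> W" "\<And>i. i \<in> \<Delta> \<Longrightarrow> iw w i \<notin> pos" shows "inverts w"
  unfolding inverts_def
proof (intro conjI ballI notI assms(1))
  fix \<beta> assume \<beta>: "\<beta> \<in> pos" "iw w \<beta> \<in> pos"
  have lin: "linear (iw w)" by (rule W_linear[OF W_inv[OF assms(1)]])
  have n: "- iw w i \<in> pos" if "i \<in> \<Delta>" for i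
    using assms(2)[OF that] pos_neg_iff W_R[OF W_inv[OF assms(1)] simple_in_R[OF that]] by blast
  have "- iw w \<beta> \<in> pos"
  proof (rule pos_nonneg)
    show "- iw w \<beta> \<in> R" using \<beta> pos_R uminus_R by blast
    fix \<gamma> assume \<gamma>: "\<gamma> \<in> \<Delta>"
    have "- iw w \<beta> = - iw w (\<Sum>\<alpha>\<in>\<Delta>. crd \<alpha> \<beta> *\<^sub>R \<alpha>)"
      using pos_expand[OF \<beta>(1)] by simp
    also have "\<dots> = (\<Sum>\<alpha>\<in>\<Delta>. crd \<alpha> \<beta> *\<^sub>R (- iw w \<alpha>))"
      by (simp add: linear_sum[OF lin] linear_scale[OF lin] sum_negf)
    finally have "crd \<gamma> (- iw w \<beta>) = (\<Sum>\<alpha>\<in>\<Delta>. crd \<alpha> \<beta> * crd \<gamma> (- iw w \<alpha>))"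
      by (simp add: linear_sum[OF linear_crd] linear_scale[OF linear_crd] del: scaleR_minus_right)
    also have "\<dots> \<ge> 0"
      using crd_nonneg \<beta>(1) \<gamma> n by (intro sum_nonneg mult_nonneg_nonneg) auto
    finally show "0 \<le> crd \<gamma> (- iw w \<beta>)" .
  qed
  with \<beta> not_pos_neg show False by blast
qed

lemma inverts_iw: assumes "inverts w" shows "inverts (iw w)"
  unfolding inverts_def
proof (intro conjI ballI notI)
  have w: "w \<in> W" using assms by (simp add: inverts_def)
  then show "iw w \<in> W" by (rule W_inv)
  fix \<beta> assume "\<beta> \<in> pos" "iw (iw w) \<beta> \<in> pos"
  then have "w \<beta> \<in> pos" by (simp add: iw_iw w)
  then have "iw w (w \<beta>) \<notin> pos" using assms by (simp add: inverts_def)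
  then show False using \<open>\<beta> \<in> pos\<close> by (simp add: iw_app w)
qed

text \<open>Both elements reverse all signs, so the product of one with the inverse of the other
  restores them and has no descent.\<close>

lemma inverts_unique: assumes "inverts u" "inverts w" shows "u = w"
proof -
  have u: "u \<in> W" and w: "w \<in> W" using assms by (auto simp: inverts_def)
  have "u \<circ> iw w = id"
  proof (rule no_descent_id)
    show "u \<circ> iw w \<in> W" using u w by (simp add: W_comp W_inv)
    fix i assume i: "i \<in> \<Delta>"
    have "iw u i \<notin> pos" using assms(1) simple_pos i by (auto simp: inverts_def)
    then have "- iw u i \<in> pos"
      using pos_neg_iff W_R[OF W_inv[OF u] simple_in_R[OF i]] by blast
    then have "iw (iw w) (- iw u i) \<notin> pos"
      using inverts_iw[OF assms(2)] by (auto simp: inverts_def)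
    moreover have "w (- iw u i) \<in> R"
      using W_R[OF w] pos_R \<open>- iw u i \<in> pos\<close> by blast
    ultimately have "w (iw u i) \<in> pos"
      using pos_neg_iff[of "w (- iw u i)"] by (simp add: iw_iw w W_uminus)
    then show "iw (u \<circ> iw w) i \<in> pos"
      by (simp add: iw_comp u W_inv w iw_iw)
  qed
  then have "u (iw w (w v)) = w v" for v by (metis comp_apply id_apply)
  then show ?thesis by (simp add: iw_app w fun_eq_iff)
qed

text \<open>At an ascent the length could still grow, so an element of maximal length has every
  simple root as a descent. Uniqueness under the sign condition then justifies the definite
  description.\<close>

lemma inverts_longest: "inverts (longest_element R \<Delta>)"
proof -
  define P where "P = (\<lambda>w. w \<in> W \<and> (\<forall>u\<in>W. len u \<le> len w))"
  have inv: "inverts w" if "P w" for w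
  proof (rule invertsI)
    show w: "w \<in> W" using that by (simp add: P_def)
    fix i assume i: "i \<in> \<Delta>"
    have "len (reflection i \<circ> w) \<le> len w"
      using that W_comp[OF reflection_W[OF i] w] by (auto simp: P_def)
    then show "iw w i \<notin> pos" using len_ascent[OF w i] by auto
  qed
  obtain w where "P w"
  proof -
    have "\<exists>w. w \<in> W \<and> (\<forall>u. u \<in> W \<longrightarrow> len u \<le> len w)"
      by (rule ex_has_greatest_nat[of "\<lambda>w. w \<in> W" id len "Suc (card pos)"])
        (simp_all add: id_W len_le_card less_Suc_eq_le)
    then show ?thesis using that by (auto simp: P_def)
  qed
  then have "P (THE w. P w)"
    using inv inverts_unique by (intro theI[of P w]) blast+
  then show ?thesis
    using inv by (simp add: longest_element_def P_def)
qed

lemma longest_W: "longest_element R \<Delta> \<in> W"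
  using inverts_longest by (simp add: inverts_def)

text \<open>The inverse satisfies the same sign condition, so the longest element equals its
  inverse.\<close>

lemma reduced_longest_rev:
  assumes "reduced_expression R \<Delta> (longest_element R \<Delta>) ws"
  shows "reduced_expression R \<Delta> (longest_element R \<Delta>) (rev ws)"
proof -
  have "word (rev ws) = iw (longest_element R \<Delta>)"
    using assms inv_weyl_word by (metis reduced_expression_def)
  also have "\<dots> = longest_element R \<Delta>"
    using inverts_unique inverts_iw inverts_longest by blast
  finally show ?thesis using assms by (simp add: reduced_expression_def)
qed

lemma inversions_longest:
  assumes "reduced_expression R \<Delta> (longest_element R \<Delta>) ws"
  shows "distinct (map fst (inversions ws))" "set (map fst (inversions ws)) = pos"
  using inversions_reduced[OF assms] inverts_longest by (auto simp: inverts_def)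

end

section \<open>The regular representation\<close>

context root_basis
begin

definition colour :: "'a::comm_ring_1 \<Rightarrow> 'a \<Rightarrow> 'v \<Rightarrow> 'a" where
  "colour P Q \<alpha> = (if short_root R \<alpha> then P else Q)"

text \<open>Functions on \<open>W\<close> are represented by functions vanishing outside of \<open>W\<close>. The operators are
  left multiplication by \<open>T\<^sub>i\<close> and right multiplication by \<open>T\<^sub>j\<close> on coefficient functions with respect to
  the prospective basis \<open>T\<^sub>w\<close>.\<close>

definition left_op :: "'a::comm_ring_1 \<Rightarrow> 'a \<Rightarrow> 'v \<Rightarrow> (('v \<Rightarrow> 'v) \<Rightarrow> 'a) \<Rightarrow> ('v \<Rightarrow> 'v) \<Rightarrow> 'a" where
  "left_op P Q i f w = (if w \<in> W then
     f (reflection i \<circ> w) + (if iw w i \<in> pos then 0 else colour P Q i) * f w else 0)"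

definition right_op :: "'a::comm_ring_1 \<Rightarrow> 'a \<Rightarrow> 'v \<Rightarrow> (('v \<Rightarrow> 'v) \<Rightarrow> 'a) \<Rightarrow> ('v \<Rightarrow> 'v) \<Rightarrow> 'a" where
  "right_op P Q j f w = (if w \<in> W then
     f (w \<circ> reflection j) + (if w j \<in> pos then 0 else colour P Q j) * f w else 0)"

definition delta :: "('v \<Rightarrow> 'v) \<Rightarrow> ('v \<Rightarrow> 'v) \<Rightarrow> 'a::comm_ring_1" where
  "delta u w = (if w = u then 1 else 0)"

definition W_supported :: "(('v \<Rightarrow> 'v) \<Rightarrow> 'a::comm_ring_1) \<Rightarrow> bool" where
  "W_supported f \<longleftrightarrow> (\<forall>w. w \<notin> W \<longrightarrow> f w = 0)"

lemma W_supported_delta: "u \<in> W \<Longrightarrow> W_supported (delta u)"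
  by (auto simp: W_supported_def delta_def)

lemma W_supported_foldr: "W_supported f \<Longrightarrow> W_supported (foldr (left_op P Q) ws f)"
  by (induction ws) (simp_all add: W_supported_def left_op_def)

lemma colour_W: "w \<in> W \<Longrightarrow> colour P Q (w \<alpha>) = colour P Q \<alpha>"
  by (simp add: colour_def short_root_W)

lemma colour_uminus: "colour P Q (- \<alpha>) = colour P Q \<alpha>"
  by (simp add: colour_def short_root_def)

lemma descent_change:
  assumes "w \<in> W" "i \<in> \<Delta>" "j \<in> \<Delta>" "w j \<noteq> i" "w j \<noteq> - i"
  shows "reflection i (w j) \<in> pos \<longleftrightarrow> w j \<in> pos"
  using reflection_pos_iff[OF assms(2) W_R[OF assms(1) simple_in_R[OF assms(3)]] assms(4,5)] .

text \<open>The two sides interfere only if \<open>w\<close> sends \<open>j\<close> to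
  \<open>i\<close> or to its negative. Then \<open>reflection i \<circ> w\<close> and
  \<open>w \<circ> reflection j\<close> coincide, and the parameters agree because the two roots
  have equal length. Otherwise multiplication on one side leaves the descent on the other side
  unchanged.\<close>

lemma left_right_commute:
  assumes "i \<in> \<Delta>" "j \<in> \<Delta>"
  shows "left_op P Q i (right_op P Q j f) = right_op P Q j (left_op P Q i f)"
proof
  fix w
  show "left_op P Q i (right_op P Q j f) w = right_op P Q j (left_op P Q i f) w"
  proof (cases "w \<in> W")
    case False
    then show ?thesis by (simp add: left_op_def right_op_def)
  next
    case w: True
    have sw: "reflection i \<circ> w \<in> W" and wt: "w \<circ> reflection j \<in> W"
      using w assms by (simp_all add: W_comp reflection_W)
    have iwt: "iw (w \<circ> reflection j) i = reflection j (iw w i)"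
      using w assms by (simp add: iw_comp reflection_W inv_reflection)
    \<comment> \<open>Primes mark a coefficient after multiplication on the opposite side;
      commutation reduces to one identity between the mixed terms.\<close>
    define A where "A = (if w j \<in> pos then 0 else colour P Q j)"
    define A' where "A' = (if reflection i (w j) \<in> pos then 0 else colour P Q j)"
    define B where "B = (if iw w i \<in> pos then 0 else colour P Q i)"
    define B' where "B' = (if reflection j (iw w i) \<in> pos then 0 else colour P Q i)"
    let ?x = "f (reflection i \<circ> w)" and ?y = "f (w \<circ> reflection j)" and ?z = "f (reflection i \<circ> w \<circ> reflection j)"
    have l: "left_op P Q i (right_op P Q j f) w = ?z + A' * ?x + B * (?y + A * f w)"
      using w sw by (simp add: left_op_def right_op_def A_def A'_def B_def)
    have r: "right_op P Q j (left_op P Q i f) w = ?z + B' * ?y + A * (?x + B * f w)"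
      using w wt iwt by (simp add: left_op_def right_op_def A_def B_def B'_def o_assoc)
    have eq: "A' * ?x + B * ?y = B' * ?y + A * ?x"
    proof (cases "w j = i \<or> w j = - i")
      case False
      have "A' = A"
        using descent_change[of w i j] w assms False by (simp add: A_def A'_def)
      moreover have "iw w i \<noteq> j" "iw w i \<noteq> - j"
        using False app_iw[OF w, of i] W_uminus[OF w, of j] by auto
      then have "B' = B"
        using descent_change[of "iw w" j i] w assms by (simp add: B_def B'_def W_inv)
      ultimately show ?thesis by (simp add: add.commute)
    next
      case True
      have wr: "w \<circ> reflection j = reflection (w j) \<circ> w"
        by (rule orthogonal_comp_reflection[OF W_orthogonal[OF w]])
      then have xy: "?x = ?y"
        using True by (auto simp: reflection_uminus)
      have c: "colour P Q j = colour P Q i"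
        using True colour_W[OF w, of P Q j] by (auto simp: colour_uminus)
      have p: "i \<in> pos" "- i \<notin> pos" "j \<in> pos" "- j \<notin> pos"
        using assms simple_pos not_pos_neg by blast+
      have r: "reflection i (- i) = i" "reflection j (- j) = j"
        by (simp_all add: reflection_self linear_neg[OF reflection_linear])
      have "iw w i = j \<or> iw w i = - j"
        using True iw_app[OF w, of j] W_uminus[OF W_inv[OF w], of "w j"] by auto
      then have ij: "w j = i \<and> iw w i = j \<or> w j = - i \<and> iw w i = - j"
        using True iw_app[OF w, of j] W_uminus[OF W_inv[OF w], of "w j"] by auto
      have "A' + B = B' + A"
        using ij p r c by (auto simp: A_def A'_def B_def B'_def reflection_self)
      then show ?thesis unfolding xy distrib_right[symmetric] by simp
    qed
    show ?thesis
      unfolding l r using eq by (simp add: algebra_simps)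
  qed
qed

lemma left_foldr_right_commute:
  assumes "vs \<in> lists \<Delta>" "i \<in> \<Delta>"
  shows "left_op P Q i (foldr (right_op P Q) vs f) = foldr (right_op P Q) vs (left_op P Q i f)"
  using assms(1) by (induction vs) (simp_all add: left_right_commute assms(2))

lemma foldr_left_right_commute:
  assumes "vs \<in> lists \<Delta>" "us \<in> lists \<Delta>"
  shows "foldr (left_op P Q) us (foldr (right_op P Q) vs f) = foldr (right_op P Q) vs (foldr (left_op P Q) us f)"
  using assms(2) by (induction us) (simp_all add: left_foldr_right_commute assms(1))

text \<open>The usual rule: T_i T_u is T at s_i u, plus c_i T_u at a descent. The operator is
  written on coefficients, where \<open>w\<close> receives a contribution from
  \<open>reflection i \<circ> w\<close>.\<close>

lemma left_op_delta:
  assumes "u \<in> W" "i \<in> \<Delta>"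
  shows "left_op P Q i (delta u) w = delta (reflection i \<circ> u) w
    + (if iw u i \<in> pos then 0 else colour P Q i) * delta u w"
proof (cases "w \<in> W")
  case True
  have "reflection i \<circ> w = u \<longleftrightarrow> w = reflection i \<circ> u"
    using reflection_comp_comp by metis
  then show ?thesis using True by (auto simp: left_op_def delta_def)
next
  case False
  then have "w \<noteq> u" "w \<noteq> reflection i \<circ> u"
    using assms W_comp reflection_W by auto
  then show ?thesis using False by (simp add: left_op_def delta_def)
qed

lemma right_op_delta:
  assumes "u \<in> W" "j \<in> \<Delta>"
  shows "right_op P Q j (delta u) w = delta (u \<circ> reflection j) w
    + (if u j \<in> pos then 0 else colour P Q j) * delta u w"
proof (cases "w \<in> W")
  case True
  have "w \<circ> reflection j = u \<longleftrightarrow> w = u \<circ> reflection j"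
    by (metis comp_assoc comp_id reflection_comp_self)
  then show ?thesis using True by (auto simp: right_op_def delta_def)
next
  case False
  then have "w \<noteq> u" "w \<noteq> u \<circ> reflection j"
    using assms W_comp reflection_W by auto
  then show ?thesis using False by (simp add: right_op_def delta_def)
qed

text \<open>Each letter of a reduced word is an ascent for the part to its right, so the correction
  term never appears.\<close>

lemma left_reduced:
  assumes "reduced_expression R \<Delta> w ws"
  shows "foldr (left_op P Q) ws (delta id) = delta w"
  using assms
proof (induction ws arbitrary: w)
  case Nil
  then show ?case by (simp add: reduced_expression_def)
next
  case (Cons i us)
  note d = reduced_ConsD[OF Cons.prems]
  have u: "reflection i \<circ> w \<in> W" using d by (simp only: W_comp reflection_W)
  have p: "iw (reflection i \<circ> w) i \<in> pos" using descent_flip d by blast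
  have "foldr (left_op P Q) (i # us) (delta id) = left_op P Q i (foldr (left_op P Q) us (delta id))"
    by simp
  also have "\<dots> = left_op P Q i (delta (reflection i \<circ> w))"
    unfolding Cons.IH[OF d(1)] ..
  also have "\<dots> = delta w"
    by (rule ext) (simp only: left_op_delta[OF u d(3)] p if_True reflection_comp_comp
        mult_zero_left add_0_right)
  finally show ?case .
qed

text \<open>Under \<open>foldr\<close> the right factors accumulate in the opposite order, whence
  the inverse.\<close>

lemma right_reduced:
  assumes "reduced_expression R \<Delta> w ws"
  shows "foldr (right_op P Q) ws (delta id) = delta (iw w)"
  using assms
proof (induction ws arbitrary: w)
  case Nil
  then have "w = id" by (simp add: reduced_expression_def)
  then show ?case by simp
next
  case (Cons i us)
  note d = reduced_ConsD[OF Cons.prems]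
  have u: "reflection i \<circ> w \<in> W" using d by (simp only: W_comp reflection_W)
  have p: "iw (reflection i \<circ> w) i \<in> pos" using descent_flip d by blast
  have e: "iw (reflection i \<circ> w) \<circ> reflection i = iw w"
    by (rule ext) (simp only: comp_apply iw_reflection_comp[OF d(3,4)] reflection_involution)
  have "foldr (right_op P Q) (i # us) (delta id) = right_op P Q i (foldr (right_op P Q) us (delta id))"
    by simp
  also have "\<dots> = right_op P Q i (delta (iw (reflection i \<circ> w)))"
    unfolding Cons.IH[OF d(1)] ..
  also have "\<dots> = delta (iw w)"
    by (rule ext) (simp only: right_op_delta[OF W_inv[OF u] d(3)] p if_True e
        mult_zero_left add_0_right)
  finally show ?case .
qed

text \<open>The longest element has both letters as descents and hence factors through the
  alternating word with additive lengths. A shorter expression of that word would shorten the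
  longest element.\<close>

lemma reduced_alternating:
  assumes "i \<in> \<Delta>" "j \<in> \<Delta>"
  shows "reduced_expression R \<Delta> (word (alternating_word i j (dih i j))) (alternating_word i j (dih i j))"
proof -
  let ?a = "alternating_word i j (dih i j)" and ?w = "longest_element R \<Delta>"
  have a: "?a \<in> lists \<Delta>" using assms by (simp add: alternating_word_lists)
  have d: "iw ?w i \<notin> pos" "iw ?w j \<notin> pos"
    using inverts_longest assms simple_pos by (auto simp: inverts_def)
  obtain w' where w': "w' \<in> W" "?w = word ?a \<circ> w'" "len ?w = dih i j + len w'"
    using dihedral_decomposition[OF longest_W assms d] by metis
  obtain us where us: "us \<in> lists \<Delta>" "word us = word ?a" "length us = len (word ?a)"
    using reduced_exists[OF word_W[OF a]] by (metis reduced_expression_def)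
  have "len ?w \<le> length us + len w'"
    using len_word_comp[OF us(1) w'(1)] us(2) w'(2) by simp
  then have "dih i j \<le> len (word ?a)" using w'(3) us(3) by simp
  moreover have "len (word ?a) \<le> dih i j" using len_le[OF a] by simp
  ultimately show ?thesis using a by (simp add: reduced_expression_def)
qed

lemma dih_commute: assumes "i \<in> \<Delta>" "j \<in> \<Delta>" shows "dih j i = dih i j"
proof -
  have "dih i j dvd dih j i" "dih j i dvd dih i j"
    using alternating_eq_iff[OF assms] alternating_eq_iff[OF assms(2,1)] by (metis dvd_refl)+
  then show ?thesis by (rule dvd_antisym[rotated])
qed

lemma left_op_sum:
  "left_op P Q i (\<lambda>w. \<Sum>k\<in>K. a k * f k w) = (\<lambda>w. \<Sum>k\<in>K. a k * left_op P Q i (f k) w)"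
  by (rule ext) (simp add: left_op_def sum.distrib sum_distrib_left distrib_left mult.left_commute)

lemma foldr_left_op_sum:
  "foldr (left_op P Q) ws (\<lambda>w. \<Sum>k\<in>K. a k * f k w) = (\<lambda>w. \<Sum>k\<in>K. a k * foldr (left_op P Q) ws (f k) w)"
  by (induction ws) (simp_all add: left_op_sum)

lemma W_supported_expand:
  assumes "W_supported f" shows "f = (\<lambda>w. \<Sum>u\<in>W. f u * delta u w)"
proof
  fix w
  have "(\<Sum>u\<in>W. f u * delta u w) = (\<Sum>u\<in>W. if w = u then f u else 0)"
    by (rule sum.cong) (simp_all add: delta_def)
  also have "\<dots> = f w"
    using assms finite_W by (simp add: W_supported_def)
  finally show "f w = (\<Sum>u\<in>W. f u * delta u w)" ..
qed

text \<open>The braid relation holds on \<open>\<delta>\<^sub>i\<^sub>d\<close>, which generates all functions on \<open>W\<close> under the right operators.\<close>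

lemma left_op_braid:
  assumes ij: "i \<in> \<Delta>" "j \<in> \<Delta>" and f: "W_supported f"
  shows "foldr (left_op P Q) (alternating_word i j (dih i j)) f
    = foldr (left_op P Q) (alternating_word j i (dih i j)) f"
proof -
  let ?a = "alternating_word i j (dih i j)" and ?b = "alternating_word j i (dih i j)"
  have l: "?a \<in> lists \<Delta>" "?b \<in> lists \<Delta>" using ij by (simp_all add: alternating_word_lists)
  have "word ?a = word ?b" using alternating_eq_iff[OF ij] by simp
  moreover have "reduced_expression R \<Delta> (word ?b) ?b"
    using reduced_alternating[OF ij(2,1)] dih_commute[OF ij] by simp
  ultimately have base: "foldr (left_op P Q) ?a (delta id) = foldr (left_op P Q) ?b (delta id)"
    by (simp only: left_reduced[OF reduced_alternating[OF ij]] left_reduced)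
  have d: "foldr (left_op P Q) ?a (delta u) = foldr (left_op P Q) ?b (delta u)" if u: "u \<in> W" for u
  proof -
    \<comment> \<open>A reduced word of the inverse is chosen because right operators build
      inverses; it carries \<delta> at the identity to \<delta> at \<open>u\<close>, and the braid
      relation with it.\<close>
    obtain vs where vs: "reduced_expression R \<Delta> (iw u) vs"
      using reduced_exists[OF W_inv[OF u]] .
    then have vl: "vs \<in> lists \<Delta>" by (simp add: reduced_expression_def)
    have "foldr (right_op P Q) vs (delta id) = delta u"
      using right_reduced[OF vs] iw_iw[OF u] by simp
    then show ?thesis
      using foldr_left_right_commute[OF vl l(1)] foldr_left_right_commute[OF vl l(2)] base by metis
  qed
  have "foldr (left_op P Q) ?a (\<lambda>w. \<Sum>u\<in>W. f u * delta u w)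
      = foldr (left_op P Q) ?b (\<lambda>w. \<Sum>u\<in>W. f u * delta u w)"
    unfolding foldr_left_op_sum by (intro ext sum.cong refl) (simp add: d)
  then show ?thesis using W_supported_expand[OF f] by simp
qed

text \<open>Exactly one of \<open>w\<close> and \<open>reflection i \<circ> w\<close> has
  \<open>i\<close> as a descent, so the two correction coefficients add up to the parameter.\<close>

lemma left_op_quadratic:
  assumes "i \<in> \<Delta>" "W_supported f"
  shows "left_op P Q i (left_op P Q i f) w = colour P Q i * left_op P Q i f w + f w"
proof (cases "w \<in> W")
  case True
  then have s: "reflection i \<circ> w \<in> W" using assms by (simp add: W_comp reflection_W)
  have "iw (reflection i \<circ> w) i \<in> pos \<longleftrightarrow> iw w i \<notin> pos" using descent_flip assms True by blast
  then show ?thesis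
    using True s by (simp add: left_op_def reflection_comp_comp algebra_simps)
next
  case False
  then show ?thesis using assms by (simp add: left_op_def W_supported_def)
qed

end

section \<open>The free algebra\<close>

abbreviation fmon :: "'k \<Rightarrow> 'a::zero \<Rightarrow> 'k \<Rightarrow>\<^sub>0 'a" where
  "fmon \<equiv> Poly_Mapping.single"

text \<open>The product of the free algebra, the action on functions and the evaluations of Laurent
  polynomials are all of this shape, so additivity is proved once.\<close>

definition psum :: "('k \<Rightarrow> 'a::zero \<Rightarrow> 'b::comm_monoid_add) \<Rightarrow> ('k \<Rightarrow>\<^sub>0 'a) \<Rightarrow> 'b" where
  "psum h x = (\<Sum>k\<in>Poly_Mapping.keys x. h k (Poly_Mapping.lookup x k))"

lemma psum_zero [simp]: "psum h 0 = 0"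
  by (simp add: psum_def)

lemma psum_single: "(\<And>k. h k 0 = 0) \<Longrightarrow> psum h (fmon k a) = h k a"
  by (simp add: psum_def)

lemma psum_add:
  assumes "\<And>k. h k 0 = 0" "\<And>k a b. h k (a + b) = h k a + h k b"
  shows "psum h (x + y) = psum h x + psum h y"
  unfolding psum_def by (rule setsum_keys_plus_distrib) (simp_all add: assms)

lemma psum_distrib: "psum (\<lambda>k a. h k a + g k a) x = psum h x + psum g x"
  by (simp add: psum_def sum.distrib)

lemma poly_mapping_expand: "x = (\<Sum>k\<in>Poly_Mapping.keys x. fmon k (Poly_Mapping.lookup x k))"
proof (rule poly_mapping_eqI)
  fix k
  have "Poly_Mapping.lookup (\<Sum>l\<in>Poly_Mapping.keys x. fmon l (Poly_Mapping.lookup x l)) k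
      = (\<Sum>l\<in>Poly_Mapping.keys x. if l = k then Poly_Mapping.lookup x l else 0)"
    unfolding lookup_sum lookup_single when_def ..
  also have "\<dots> = Poly_Mapping.lookup x k"
    by (simp add: in_keys_iff)
  finally show "Poly_Mapping.lookup x k
      = Poly_Mapping.lookup (\<Sum>l\<in>Poly_Mapping.keys x. fmon l (Poly_Mapping.lookup x l)) k" ..
qed

text \<open>Additive identities need checking on monomials only; \<open>A\<close> keeps track of the
  admissible words.\<close>

lemma poly_mapping_induct [consumes 1, case_names zero single add]:
  fixes x :: "'k \<Rightarrow>\<^sub>0 'a::comm_monoid_add"
  assumes "Poly_Mapping.keys x \<subseteq> A" and zero: "P 0" and single: "\<And>k a. k \<in> A \<Longrightarrow> P (fmon k a)"
    and add: "\<And>x y. Poly_Mapping.keys x \<subseteq> A \<Longrightarrow> Poly_Mapping.keys y \<subseteq> A \<Longrightarrow> P x \<Longrightarrow> P y \<Longrightarrow> P (x + y)"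
  shows "P x"
proof -
  have "Poly_Mapping.keys (\<Sum>k\<in>K. fmon k (f k)) \<subseteq> A \<and> P (\<Sum>k\<in>K. fmon k (f k))"
    if "finite K" "K \<subseteq> A" for K and f :: "'k \<Rightarrow> 'a"
    using that
  proof (induction K)
    case (insert k K)
    have "Poly_Mapping.keys (fmon k (f k)) \<subseteq> A" using insert by auto
    then show ?case
      using insert keys_add[of "fmon k (f k)" "\<Sum>k\<in>K. fmon k (f k)"]
        add[of "fmon k (f k)" "\<Sum>k\<in>K. fmon k (f k)"] single[of k "f k"] by auto
  qed (simp add: zero)
  from this[OF finite_keys assms(1)] show ?thesis
    using poly_mapping_expand[of x] by metis
qed

lemmas poly_mapping_induct_UNIV =
  poly_mapping_induct[OF subset_UNIV, simplified, case_names zero single add]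

section \<open>Multiplication by concatenation of words\<close>

definition fmul :: "('i list \<Rightarrow>\<^sub>0 'a::comm_ring_1) \<Rightarrow> ('i list \<Rightarrow>\<^sub>0 'a) \<Rightarrow> ('i list \<Rightarrow>\<^sub>0 'a)" where
  "fmul x y = psum (\<lambda>u a. psum (\<lambda>v b. fmon (u @ v) (a * b)) y) x"

lemma psum_const_zero: "psum (\<lambda>k a. 0) x = 0"
  by (simp add: psum_def)

lemma fmul_add_left: "fmul (x + y) z = fmul x z + fmul y z"
  unfolding fmul_def
  by (rule psum_add) (simp_all add: psum_const_zero single_add distrib_right psum_distrib)

lemma fmul_add_right: "fmul x (y + z) = fmul x y + fmul x z"
proof -
  have "psum (\<lambda>v b. fmon (u @ v) (a * b)) (y + z)
      = psum (\<lambda>v b. fmon (u @ v) (a * b)) y + psum (\<lambda>v b. fmon (u @ v) (a * b)) z" for u a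
    by (rule psum_add) (simp_all add: single_add distrib_left)
  then show ?thesis unfolding fmul_def by (simp add: psum_distrib)
qed

lemma fmul_mon: "fmul (fmon u a) (fmon v b) = fmon (u @ v) (a * b)"
  by (simp add: fmul_def psum_single psum_const_zero)

lemma fmul_zero [simp]: "fmul 0 x = 0" "fmul x 0 = 0"
  by (simp_all add: fmul_def psum_const_zero)

lemma fmul_assoc: "fmul (fmul x y) z = fmul x (fmul y z)"
proof (induction x rule: poly_mapping_induct_UNIV)
  case x: (single u a)
  show ?case
  proof (induction y rule: poly_mapping_induct_UNIV)
    case y: (single v b)
    show ?case
      by (induction z rule: poly_mapping_induct_UNIV)
        (simp_all add: fmul_mon fmul_add_right mult.assoc)
  qed (simp_all add: fmul_add_left fmul_add_right)
qed (simp_all add: fmul_add_left)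

lemma fmul_one: "fmul (fmon [] 1) x = x" "fmul x (fmon [] 1) = x"
  by (induction x rule: poly_mapping_induct_UNIV)
    (simp_all add: fmul_add_left fmul_add_right fmul_mon)

lemma fmul_uminus: "fmul (- x) y = - fmul x y" "fmul x (- y) = - fmul x y"
  using fmul_add_left[of "- x" x y] fmul_add_right[of x "- y" y]
  by (simp_all add: eq_neg_iff_add_eq_0)

lemma fmul_diff: "fmul (x - y) z = fmul x z - fmul y z" "fmul x (y - z) = fmul x y - fmul x z"
  using fmul_add_left[of x "- y" z] fmul_add_right[of x y "- z"] by (simp_all add: fmul_uminus)

lemma fmul_sum_right: "fmul x (\<Sum>k\<in>K. f k) = (\<Sum>k\<in>K. fmul x (f k))"
  by (induction K rule: infinite_finite_induct) (simp_all add: fmul_add_right)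

lemma keys_fmul:
  assumes "Poly_Mapping.keys x \<subseteq> lists A" "Poly_Mapping.keys y \<subseteq> lists A"
  shows "Poly_Mapping.keys (fmul x y) \<subseteq> lists A"
  using assms(1)
proof (induction x rule: poly_mapping_induct)
  case x: (single u a)
  show ?case
    using assms(2)
  proof (induction y rule: poly_mapping_induct)
    case (single v b)
    then show ?case using x by (simp add: fmul_mon)
  next
    case (add y z)
    then show ?case using keys_add[of "fmul (fmon u a) y" "fmul (fmon u a) z"]
      unfolding fmul_add_right by blast
  qed simp
next
  case (add x z)
  then show ?case using keys_add[of "fmul x y" "fmul z y"] unfolding fmul_add_left by blast
qed simp

lemma free_algebra_eq: "free_algebra \<Delta> =
    \<lparr>carrier = {x. Poly_Mapping.keys x \<subseteq> lists \<Delta>}, mult = fmul, one = fmon [] 1, zero = 0, add = (+)\<rparr>"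
  by (simp add: free_algebra_def fmul_def psum_def fun_eq_iff)

lemma carrier_free_algebra: "x \<in> carrier (free_algebra \<Delta>) \<longleftrightarrow> Poly_Mapping.keys x \<subseteq> lists \<Delta>"
  and mult_free_algebra: "mult (free_algebra \<Delta>) = fmul"
  and add_free_algebra: "add (free_algebra \<Delta>) = (+)"
  and zero_free_algebra: "zero (free_algebra \<Delta>) = 0"
  and one_free_algebra: "one (free_algebra \<Delta>) = fmon [] 1"
  by (simp_all add: free_algebra_eq)

lemmas free_algebra_simps = carrier_free_algebra mult_free_algebra add_free_algebra
  zero_free_algebra one_free_algebra

lemma keys_uminus [simp]: "Poly_Mapping.keys (- x) = Poly_Mapping.keys (x :: 'k \<Rightarrow>\<^sub>0 'a::ab_group_add)"
  by (auto simp: in_keys_iff)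

lemma ring_free_algebra: "ring (free_algebra \<Delta> :: ('i list \<Rightarrow>\<^sub>0 'a::comm_ring_1) ring)"
proof (rule ringI)
  let ?F = "free_algebra \<Delta> :: ('i list \<Rightarrow>\<^sub>0 'a::comm_ring_1) ring"
  show "abelian_group ?F"
  proof (rule abelian_groupI)
    show "\<exists>y\<in>carrier ?F. y \<oplus>\<^bsub>?F\<^esub> x = \<zero>\<^bsub>?F\<^esub>" if "x \<in> carrier ?F" for x
      using that by (intro bexI[of _ "- x"]) (simp_all add: free_algebra_simps)
    show "x \<oplus>\<^bsub>?F\<^esub> y \<in> carrier ?F" if "x \<in> carrier ?F" "y \<in> carrier ?F" for x y
      using that keys_add[of x y] unfolding free_algebra_simps by blast
  qed (simp_all add: free_algebra_simps ac_simps)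
  show "monoid ?F"
    by (rule monoidI) (simp_all add: free_algebra_simps fmul_assoc fmul_one keys_fmul)
qed (simp_all add: free_algebra_simps fmul_add_left fmul_add_right)

lemma free_algebra_uminus:
  assumes "x \<in> carrier (free_algebra \<Delta>)" shows "\<ominus>\<^bsub>free_algebra \<Delta>\<^esub> x = - x"
proof -
  interpret ring "free_algebra \<Delta>" by (rule ring_free_algebra)
  show ?thesis
    using assms by (intro minus_equality) (simp_all add: free_algebra_simps)
qed

lemma ideal_free_algebraI:
  assumes sub: "K \<subseteq> carrier (free_algebra \<Delta>)" and zero: "0 \<in> K"
    and add: "\<And>x y. x \<in> K \<Longrightarrow> y \<in> K \<Longrightarrow> x + y \<in> K" and neg: "\<And>x. x \<in> K \<Longrightarrow> - x \<in> K"
    and left: "\<And>a x. x \<in> K \<Longrightarrow> a \<in> carrier (free_algebra \<Delta>) \<Longrightarrow> fmul a x \<in> K"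
    and right: "\<And>a x. x \<in> K \<Longrightarrow> a \<in> carrier (free_algebra \<Delta>) \<Longrightarrow> fmul x a \<in> K"
  shows "ideal K (free_algebra \<Delta>)"
proof (rule idealI)
  show "subgroup K (add_monoid (free_algebra \<Delta>))"
  proof
    fix x assume x: "x \<in> K"
    then show "inv\<^bsub>add_monoid (free_algebra \<Delta>)\<^esub> x \<in> K"
      using neg[OF x] free_algebra_uminus[of x \<Delta>] sub by (auto simp: a_inv_def)
  qed (use sub zero add in \<open>auto simp: free_algebra_simps\<close>)
qed (simp_all add: ring_free_algebra free_algebra_simps[symmetric] left right mult_free_algebra)

section \<open>The Hecke algebra and its standard basis\<close>

context root_basis
begin

abbreviation "F \<equiv> carrier (free_algebra \<Delta> :: ('v list \<Rightarrow>\<^sub>0 'a::comm_ring_1) ring)"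

lemma fmon_F: "ws \<in> lists \<Delta> \<Longrightarrow> fmon ws a \<in> F"
  by (simp add: carrier_free_algebra)

lemma add_F: "x \<in> F \<Longrightarrow> y \<in> F \<Longrightarrow> x + y \<in> F"
  using keys_add[of x y] unfolding carrier_free_algebra by blast

lemma uminus_F: "x \<in> F \<Longrightarrow> - x \<in> F"
  by (simp add: carrier_free_algebra)

lemma diff_F: "x \<in> F \<Longrightarrow> y \<in> F \<Longrightarrow> x - y \<in> F"
  using add_F[of x "- y"] uminus_F[of y] by simp

lemma zero_F: "0 \<in> F"
  by (simp add: carrier_free_algebra)

lemma fmul_F: "x \<in> F \<Longrightarrow> y \<in> F \<Longrightarrow> fmul x y \<in> F"
  by (simp add: carrier_free_algebra keys_fmul)

lemma sum_F: "(\<And>k. k \<in> K \<Longrightarrow> f k \<in> F) \<Longrightarrow> (\<Sum>k\<in>K. f k) \<in> F"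
  by (induction K rule: infinite_finite_induct) (simp_all add: zero_F add_F)

section \<open>The ideal of the Hecke relations and congruence modulo it\<close>

lemma hecke_relations_eq: "hecke_relations R \<Delta> P Q =
    {fmon (alternating_word i j (dih i j)) 1 - fmon (alternating_word j i (dih i j)) 1
      | i j. i \<in> \<Delta> \<and> j \<in> \<Delta> \<and> i \<noteq> j}
    \<union> {fmon [i, i] 1 - (fmon [i] (colour P Q i) + fmon [] 1) | i. i \<in> \<Delta>}"
  unfolding hecke_relations_def colour_def dih_def by blast

lemma hecke_relations_F: "hecke_relations R \<Delta> P Q \<subseteq> F"
proof -
  have "fmon (alternating_word i j n) 1 \<in> F" if "i \<in> \<Delta>" "j \<in> \<Delta>" for i j n
    using that by (intro fmon_F alternating_word_lists)
  moreover have "fmon [i, i] a \<in> F" "fmon [i] a \<in> F" "fmon [] a \<in> F" if "i \<in> \<Delta>" for i a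
    using that by (simp_all add: fmon_F)
  ultimately show ?thesis
    unfolding hecke_relations_eq by (auto intro!: diff_F add_F)
qed

lemma ideal_hecke_ideal: "ideal (hecke_ideal R \<Delta> P Q) (free_algebra \<Delta>)"
  unfolding hecke_ideal_def
  by (rule ring.genideal_ideal[OF ring_free_algebra hecke_relations_F])

lemma hecke_ideal_minimal:
  "ideal K (free_algebra \<Delta>) \<Longrightarrow> hecke_relations R \<Delta> P Q \<subseteq> K \<Longrightarrow> hecke_ideal R \<Delta> P Q \<subseteq> K"
  unfolding hecke_ideal_def by (rule ring.genideal_minimal[OF ring_free_algebra])

lemma hecke_ideal_F: "x \<in> hecke_ideal R \<Delta> P Q \<Longrightarrow> x \<in> F"
  using ideal.Icarr[OF ideal_hecke_ideal] .

lemma hecke_ideal_relations: "hecke_relations R \<Delta> P Q \<subseteq> hecke_ideal R \<Delta> P Q"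
  unfolding hecke_ideal_def by (rule ring.genideal_self[OF ring_free_algebra hecke_relations_F])

lemma hecke_ideal_closed:
  shows hecke_ideal_zero: "0 \<in> hecke_ideal R \<Delta> P Q"
    and hecke_ideal_add: "x \<in> hecke_ideal R \<Delta> P Q \<Longrightarrow> y \<in> hecke_ideal R \<Delta> P Q \<Longrightarrow> x + y \<in> hecke_ideal R \<Delta> P Q"
    and hecke_ideal_uminus: "x \<in> hecke_ideal R \<Delta> P Q \<Longrightarrow> - x \<in> hecke_ideal R \<Delta> P Q"
    and hecke_ideal_left: "x \<in> hecke_ideal R \<Delta> P Q \<Longrightarrow> a \<in> F \<Longrightarrow> fmul a x \<in> hecke_ideal R \<Delta> P Q"
    and hecke_ideal_right: "x \<in> hecke_ideal R \<Delta> P Q \<Longrightarrow> a \<in> F \<Longrightarrow> fmul x a \<in> hecke_ideal R \<Delta> P Q"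
proof -
  interpret ideal "hecke_ideal R \<Delta> P Q" "free_algebra \<Delta>" by (rule ideal_hecke_ideal)
  show "0 \<in> hecke_ideal R \<Delta> P Q"
    using additive_subgroup.zero_closed[OF is_additive_subgroup] by (simp add: zero_free_algebra)
  show "x \<in> hecke_ideal R \<Delta> P Q \<Longrightarrow> y \<in> hecke_ideal R \<Delta> P Q \<Longrightarrow> x + y \<in> hecke_ideal R \<Delta> P Q"
    using additive_subgroup.a_closed[OF is_additive_subgroup, of x y] by (simp add: add_free_algebra)
  show "x \<in> hecke_ideal R \<Delta> P Q \<Longrightarrow> - x \<in> hecke_ideal R \<Delta> P Q"
    using subgroup.m_inv_closed[OF a_subgroup, of x] free_algebra_uminus[of x \<Delta>] hecke_ideal_F[of x P Q]
    by (simp add: a_inv_def)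
  show "x \<in> hecke_ideal R \<Delta> P Q \<Longrightarrow> a \<in> F \<Longrightarrow> fmul a x \<in> hecke_ideal R \<Delta> P Q"
    using I_l_closed[of x a] by (simp add: mult_free_algebra)
  show "x \<in> hecke_ideal R \<Delta> P Q \<Longrightarrow> a \<in> F \<Longrightarrow> fmul x a \<in> hecke_ideal R \<Delta> P Q"
    using I_r_closed[of x a] by (simp add: mult_free_algebra)
qed

definition fcong :: "'a::comm_ring_1 \<Rightarrow> 'a \<Rightarrow> ('v list \<Rightarrow>\<^sub>0 'a) \<Rightarrow> ('v list \<Rightarrow>\<^sub>0 'a) \<Rightarrow> bool" where
  "fcong P Q x y \<longleftrightarrow> x - y \<in> hecke_ideal R \<Delta> P Q"

lemma fcong_refl: "fcong P Q x x"
  by (simp add: fcong_def hecke_ideal_zero)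

lemma fcong_sym: "fcong P Q x y \<Longrightarrow> fcong P Q y x"
  unfolding fcong_def using hecke_ideal_uminus[of "x - y" P Q] by simp

lemma fcong_trans [trans]: "fcong P Q x y \<Longrightarrow> fcong P Q y z \<Longrightarrow> fcong P Q x z"
  unfolding fcong_def using hecke_ideal_add[of "x - y" P Q "y - z"] by simp

lemma fcong_add: "fcong P Q x y \<Longrightarrow> fcong P Q x' y' \<Longrightarrow> fcong P Q (x + x') (y + y')"
  unfolding fcong_def using hecke_ideal_add[of "x - y" P Q "x' - y'"] by (simp add: algebra_simps)

lemma fcong_left: "fcong P Q x y \<Longrightarrow> a \<in> F \<Longrightarrow> fcong P Q (fmul a x) (fmul a y)"
  unfolding fcong_def using hecke_ideal_left[of "x - y" P Q a] by (simp add: fmul_diff)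

lemma fcong_right: "fcong P Q x y \<Longrightarrow> a \<in> F \<Longrightarrow> fcong P Q (fmul x a) (fmul y a)"
  unfolding fcong_def using hecke_ideal_right[of "x - y" P Q a] by (simp add: fmul_diff)

lemma fcong_sum: "(\<And>k. k \<in> K \<Longrightarrow> fcong P Q (f k) (g k)) \<Longrightarrow> fcong P Q (\<Sum>k\<in>K. f k) (\<Sum>k\<in>K. g k)"
  by (induction K rule: infinite_finite_induct) (simp_all add: fcong_refl fcong_add)

lemma fcong_braid:
  "i \<in> \<Delta> \<Longrightarrow> j \<in> \<Delta> \<Longrightarrow> i \<noteq> j \<Longrightarrow>
    fcong P Q (fmon (alternating_word i j (dih i j)) 1) (fmon (alternating_word j i (dih i j)) 1)"
  unfolding fcong_def using hecke_ideal_relations[of P Q] unfolding hecke_relations_eq by blast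

lemma fcong_quadratic: "i \<in> \<Delta> \<Longrightarrow> fcong P Q (fmon [i, i] 1) (fmon [i] (colour P Q i) + fmon [] 1)"
  unfolding fcong_def using hecke_ideal_relations[of P Q] unfolding hecke_relations_eq by blast

text \<open>Matsumoto's theorem for congruence of monomials: multiplying by a generator on the left
  extends words, multiplying by a tail on the right gives the braid moves.\<close>

lemma fcong_reduced:
  assumes "reduced_expression R \<Delta> w us" "reduced_expression R \<Delta> w vs"
  shows "fcong P Q (fmon us 1) (fmon vs 1)"
proof (rule matsumoto[where E = "\<lambda>us vs. fcong P Q (fmon us 1) (fmon vs 1)", OF _ _ _ _ assms])
  show "fcong P Q (fmon a 1) (fmon a 1)" for a by (rule fcong_refl)
  show "fcong P Q (fmon a 1) (fmon b 1) \<Longrightarrow> fcong P Q (fmon b 1) (fmon c 1) \<Longrightarrow> fcong P Q (fmon a 1) (fmon c 1)"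
    for a b c by (rule fcong_trans)
  show "fcong P Q (fmon (i # a) 1) (fmon (i # b) 1)"
    if "i \<in> \<Delta>" "a \<in> lists \<Delta>" "b \<in> lists \<Delta>" "fcong P Q (fmon a 1) (fmon b 1)" for i a b
    using fcong_left[OF that(4), of "fmon [i] 1"] that(1) by (simp add: fmul_mon fmon_F)
  show "fcong P Q (fmon (alternating_word i j (dih i j) @ z) 1) (fmon (alternating_word j i (dih i j) @ z) 1)"
    if "i \<in> \<Delta>" "j \<in> \<Delta>" "i \<noteq> j" "z \<in> lists \<Delta>" for i j z
    using fcong_right[OF fcong_braid[OF that(1-3)], of "fmon z 1" P Q] that(4) by (simp add: fmul_mon fmon_F)
qed

text \<open>The prospective left regular module, first over the free algebra, where no relation has
  to be respected.\<close>

definition act :: "'a::comm_ring_1 \<Rightarrow> 'a \<Rightarrow> ('v list \<Rightarrow>\<^sub>0 'a) \<Rightarrow> (('v \<Rightarrow> 'v) \<Rightarrow> 'a) \<Rightarrow> ('v \<Rightarrow> 'v) \<Rightarrow> 'a" where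
  "act P Q x f w = psum (\<lambda>ws a. a * foldr (left_op P Q) ws f w) x"

lemma act_add: "act P Q (x + y) f w = act P Q x f w + act P Q y f w"
  unfolding act_def by (rule psum_add) (simp_all add: distrib_right)

lemma act_zero: "act P Q 0 f w = 0"
  by (simp add: act_def)

lemma act_mon: "act P Q (fmon ws a) f w = a * foldr (left_op P Q) ws f w"
  by (simp add: act_def psum_single)

lemma act_uminus: "act P Q (- x) f w = - act P Q x f w"
  using act_add[of P Q "- x" x f w] by (simp add: act_zero eq_neg_iff_add_eq_0)

lemma act_diff: "act P Q (x - y) f w = act P Q x f w - act P Q y f w"
  using act_add[of P Q x "- y" f w] by (simp add: act_uminus)

lemma foldr_left_op_linear:
  "foldr (left_op P Q) ws (\<lambda>w. f w + g w) = (\<lambda>w. foldr (left_op P Q) ws f w + foldr (left_op P Q) ws g w)"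
  "foldr (left_op P Q) ws (\<lambda>w. b * f w) = (\<lambda>w. b * foldr (left_op P Q) ws f w)"
proof -
  have "left_op P Q i (\<lambda>w. f w + g w) = (\<lambda>w. left_op P Q i f w + left_op P Q i g w)" for i f g
    by (rule ext) (simp add: left_op_def distrib_left)
  then show "foldr (left_op P Q) ws (\<lambda>w. f w + g w) = (\<lambda>w. foldr (left_op P Q) ws f w + foldr (left_op P Q) ws g w)"
    by (induction ws) simp_all
  have "left_op P Q i (\<lambda>w. b * f w) = (\<lambda>w. b * left_op P Q i f w)" for i b f
    by (rule ext) (simp add: left_op_def distrib_left mult.left_commute)
  then show "foldr (left_op P Q) ws (\<lambda>w. b * f w) = (\<lambda>w. b * foldr (left_op P Q) ws f w)"
    by (induction ws) simp_all
qed

lemma act_fmul: "act P Q (fmul x y) f w = act P Q x (act P Q y f) w"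
proof (induction x rule: poly_mapping_induct_UNIV)
  case x: (single u a)
  show ?case
  proof (induction y arbitrary: w rule: poly_mapping_induct_UNIV)
    case zero
    have z: "act P Q 0 f = (\<lambda>w. 0 * f w)"
      by (rule ext) (simp add: act_zero)
    show ?case
      unfolding act_mon z foldr_left_op_linear fmul_zero act_zero by simp
  next
    case (single v b)
    have "act P Q (fmon v b) f = (\<lambda>w. b * foldr (left_op P Q) v f w)"
      by (rule ext) (rule act_mon)
    then show ?case by (simp add: act_mon fmul_mon foldr_left_op_linear mult.assoc)
  next
    case (add y z)
    have "act P Q (y + z) f = (\<lambda>w. act P Q y f w + act P Q z f w)"
      by (rule ext) (rule act_add)
    with add show ?case
      by (simp add: fmul_add_right act_add act_mon foldr_left_op_linear distrib_left)
  qed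
qed (simp_all add: act_zero act_add fmul_add_left)

lemma W_supported_act: "W_supported f \<Longrightarrow> W_supported (act P Q x f)"
  using W_supported_foldr[of f P Q] by (simp add: W_supported_def act_def psum_const_zero)

text \<open>The elements annihilating all functions supported on \<open>W\<close> form a two-sided
  ideal containing the relations. Closure under right multiplication uses that the action preserves
  the support condition.\<close>

lemma act_hecke_ideal:
  fixes P Q :: "'a::comm_ring_1"
  assumes "x \<in> hecke_ideal R \<Delta> P Q" "W_supported f" shows "act P Q x f w = 0"
proof -
  let ?K = "{x \<in> F. \<forall>f w. W_supported f \<longrightarrow> act P Q x f w = 0}"
  have "ideal ?K (free_algebra \<Delta>)"
  proof (rule ideal_free_algebraI)
    fix a x :: "'v list \<Rightarrow>\<^sub>0 'a" assume x: "x \<in> ?K" and a: "a \<in> F"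
    then have x0: "W_supported f \<Longrightarrow> act P Q x f w = 0" for f w by simp
    have "act P Q (fmul a x) f w = 0" if f: "W_supported f" for f w
    proof -
      have "act P Q x f = act P Q 0 f" using x0[OF f] by (intro ext) (simp add: act_zero)
      then have "act P Q (fmul a x) f w = act P Q (fmul a 0) f w"
        by (simp only: act_fmul)
      then show ?thesis by (simp add: act_zero)
    qed
    moreover have "fmul a x \<in> F" using x a fmul_F by blast
    ultimately show "fmul a x \<in> ?K" by blast
    have "act P Q (fmul x a) f w = 0" if "W_supported f" for f w
      using x0[OF W_supported_act[OF that], of P Q a w] by (simp only: act_fmul)
    moreover have "fmul x a \<in> F" using x a fmul_F by blast
    ultimately show "fmul x a \<in> ?K" by blast
  qed (auto simp: zero_F add_F uminus_F act_zero act_add act_uminus)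
  moreover have "hecke_relations R \<Delta> P Q \<subseteq> ?K"
  proof
    fix x assume x: "x \<in> hecke_relations R \<Delta> P Q"
    then consider i j where "i \<in> \<Delta>" "j \<in> \<Delta>"
        "x = fmon (alternating_word i j (dih i j)) 1 - fmon (alternating_word j i (dih i j)) 1"
      | i where "i \<in> \<Delta>" "x = fmon [i, i] 1 - (fmon [i] (colour P Q i) + fmon [] 1)"
      unfolding hecke_relations_eq by blast
    then have "act P Q x f w = 0" if f: "W_supported f" for f w
    proof cases
      case 1
      then show ?thesis using left_op_braid[OF 1(1,2) f, of P Q] by (simp add: act_diff act_mon)
    next
      case 2
      then show ?thesis using left_op_quadratic[OF 2(1) f, of P Q] by (simp add: act_diff act_add act_mon)
    qed
    then show "x \<in> ?K" using x hecke_relations_F by blast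
  qed
  ultimately have "x \<in> ?K" using hecke_ideal_minimal assms(1) by blast
  then show ?thesis using assms(2) by blast
qed

text \<open>The same choice as in \<open>hecke_T\<close>, so that T_w unfolds to the monomial of
  \<open>rword w\<close>.\<close>

definition rword :: "('v \<Rightarrow> 'v) \<Rightarrow> 'v list" where
  "rword w = (SOME ws. reduced_expression R \<Delta> w ws)"

lemma reduced_rword: "w \<in> W \<Longrightarrow> reduced_expression R \<Delta> w (rword w)"
  unfolding rword_def using reduced_exists by (metis someI)

lemma rword_lists: "w \<in> W \<Longrightarrow> rword w \<in> lists \<Delta>"
  using reduced_rword by (simp add: reduced_expression_def)

lemma rword_id: "rword id = []"
  using reduced_rword[OF id_W] reduced_Nil by (simp add: reduced_expression_def)

definition standard_form :: "(('v \<Rightarrow> 'v) \<Rightarrow> 'a::comm_ring_1) \<Rightarrow> 'v list \<Rightarrow>\<^sub>0 'a" where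
  "standard_form f = (\<Sum>w\<in>W. fmon (rword w) (f w))"

lemma fcong_scale: "fcong P Q x y \<Longrightarrow> fcong P Q (fmul (fmon [] a) x) (fmul (fmon [] a) y)"
  by (rule fcong_left) (simp_all add: fmon_F)

text \<open>At an ascent the extended word is reduced. At a descent \<open>w\<close> has a reduced
  word beginning with \<open>i\<close>, and the quadratic relation applies to the doubled
  letter.\<close>

lemma gen_mult_standard:
  assumes w: "w \<in> W" and i: "i \<in> \<Delta>"
  shows "fcong P Q (fmon (i # rword w) a)
    (fmon (rword (reflection i \<circ> w)) a + fmon (rword w) ((if iw w i \<in> pos then 0 else colour P Q i) * a))"
proof -
  let ?v = "reflection i \<circ> w"
  have v: "?v \<in> W" using w i by (simp only: W_comp reflection_W)
  show ?thesis
  proof (cases "iw w i \<in> pos")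
    case True
    have "fcong P Q (fmon (i # rword w) 1) (fmon (rword ?v) 1)"
      by (rule fcong_reduced[OF reduced_ConsI[OF reduced_rword[OF w] w i True] reduced_rword[OF v]])
    from fcong_scale[OF this, of a] show ?thesis using True by (simp add: fmul_mon)
  next
    case False
    have p: "iw ?v i \<in> pos" using descent_flip[OF i w] False by blast
    have "reduced_expression R \<Delta> w (i # rword ?v)"
      using reduced_ConsI[OF reduced_rword[OF v] v i p] unfolding reflection_comp_comp .
    then have c: "fcong P Q (fmon (rword w) 1) (fmon (i # rword ?v) 1)"
      by (rule fcong_reduced[OF reduced_rword[OF w]])
    have "fcong P Q (fmon (i # rword w) 1) (fmon ([i, i] @ rword ?v) 1)"
      using fcong_left[OF c, of "fmon [i] 1"] i by (simp add: fmul_mon fmon_F)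
    also have "fcong P Q (fmon ([i, i] @ rword ?v) 1)
        (fmon (i # rword ?v) (colour P Q i) + fmon (rword ?v) 1)"
      using fcong_right[OF fcong_quadratic[OF i], of "fmon (rword ?v) 1" P Q] rword_lists[OF v]
      by (simp add: fmul_mon fmul_add_left fmon_F)
    also have "fcong P Q (fmon (i # rword ?v) (colour P Q i) + fmon (rword ?v) 1)
        (fmon (rword w) (colour P Q i) + fmon (rword ?v) 1)"
      using fcong_scale[OF fcong_sym[OF c], of "colour P Q i"]
      by (intro fcong_add fcong_refl) (simp add: fmul_mon)
    finally have t: "fcong P Q (fmon (i # rword w) 1) (fmon (rword w) (colour P Q i) + fmon (rword ?v) 1)" .
    show ?thesis
      using fcong_scale[OF t, of a] False
      by (simp add: fmul_mon fmul_add_right add.commute mult.commute)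
  qed
qed

text \<open>Reindexing the sum by \<open>reflection i \<circ> w\<close> turns products of basis
  elements into coefficients, which is where the formula of \<open>left_op\<close> comes
  from.\<close>

lemma gen_mult_standard_form:
  assumes i: "i \<in> \<Delta>"
  shows "fcong P Q (fmul (fmon [i] 1) (standard_form f)) (standard_form (left_op P Q i f))"
proof -
  let ?c = "\<lambda>w. if iw w i \<in> pos then 0 else colour P Q i"
  have "fmul (fmon [i] 1) (standard_form f) = (\<Sum>w\<in>W. fmon (i # rword w) (f w))"
    unfolding standard_form_def fmul_sum_right by (simp add: fmul_mon)
  moreover have "fcong P Q (\<Sum>w\<in>W. fmon (i # rword w) (f w))
      (\<Sum>w\<in>W. fmon (rword (reflection i \<circ> w)) (f w) + fmon (rword w) (?c w * f w))"
    by (intro fcong_sum gen_mult_standard i)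
  moreover have "(\<Sum>w\<in>W. fmon (rword (reflection i \<circ> w)) (f w)) = (\<Sum>w\<in>W. fmon (rword w) (f (reflection i \<circ> w)))"
    by (rule sum.reindex_bij_witness[of _ "\<lambda>w. reflection i \<circ> w" "\<lambda>w. reflection i \<circ> w"])
      (simp_all only: reflection_comp_comp W_comp reflection_W[OF i])
  moreover have "standard_form (left_op P Q i f)
      = (\<Sum>w\<in>W. fmon (rword w) (f (reflection i \<circ> w)) + fmon (rword w) (?c w * f w))"
    unfolding standard_form_def by (rule sum.cong) (simp_all add: left_op_def single_add)
  ultimately show ?thesis by (simp only: sum.distrib)
qed

text \<open>This is the spanning half: acting on \<delta> at the identity computes the coefficients
  of the normal form letter by letter.\<close>

lemma fcong_standard_form:
  fixes P Q :: "'a::comm_ring_1"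
  assumes "x \<in> F" shows "fcong P Q x (standard_form (act P Q x (delta id)))"
proof -
  have word: "fcong P Q (fmon ws 1) (standard_form (foldr (left_op P Q) ws (delta id)))"
    if "ws \<in> lists \<Delta>" for ws
    using that
  proof (induction ws)
    case Nil
    have "standard_form (delta id :: _ \<Rightarrow> 'a) = (\<Sum>w\<in>W. if w = id then fmon (rword w) 1 else 0)"
      unfolding standard_form_def by (rule sum.cong) (simp_all add: delta_def)
    also have "\<dots> = fmon [] 1" using id_W finite_W by (simp add: rword_id)
    finally have e: "standard_form (delta id :: _ \<Rightarrow> 'a) = fmon [] 1" .
    have "foldr (left_op P Q) [] g = g" for g by simp
    then show ?case unfolding e by (simp only: e fcong_refl)
  next
    case (Cons i us)
    have "fcong P Q (fmon (i # us) 1) (fmul (fmon [i] 1) (standard_form (foldr (left_op P Q) us (delta id))))"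
      using fcong_left[OF Cons.IH, of "fmon [i] 1"] Cons.hyps by (simp add: fmul_mon fmon_F del: id_apply)
    also have "fcong P Q \<dots> (standard_form (foldr (left_op P Q) (i # us) (delta id)))"
      using gen_mult_standard_form[OF Cons.hyps(1)] by (simp del: id_apply)
    finally show ?case .
  qed
  from assms have "Poly_Mapping.keys x \<subseteq> lists \<Delta>" by (simp add: carrier_free_algebra)
  then show ?thesis
  proof (induction x rule: poly_mapping_induct)
    case zero
    show ?case by (simp add: standard_form_def act_zero fcong_refl del: id_apply)
  next
    case (single ws a)
    have "fmul (fmon [] a) (standard_form (foldr (left_op P Q) ws (delta id)))
        = standard_form (act P Q (fmon ws a) (delta id))"
      unfolding standard_form_def fmul_sum_right by (simp add: fmul_mon act_mon del: id_apply)
    then show ?case using fcong_scale[OF word[OF single], of a] by (simp add: fmul_mon del: id_apply)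
  next
    case (add x y)
    have "standard_form (act P Q (x + y) (delta id))
        = standard_form (act P Q x (delta id)) + standard_form (act P Q y (delta id))"
      by (simp add: standard_form_def act_add single_add sum.distrib del: id_apply)
    then show ?case using fcong_add[OF add.IH] by (simp del: id_apply)
  qed
qed

text \<open>Independence gives one direction and spanning the other. The function obtained from
  \<delta> at the identity is the coordinate vector in the basis T_w, so congruence becomes equality
  of scalars over any coefficient ring.\<close>

theorem fcong_iff:
  assumes "x \<in> F" "y \<in> F"
  shows "fcong P Q x y \<longleftrightarrow> (\<forall>w. act P Q x (delta id) w = act P Q y (delta id) w)"
proof
  assume "fcong P Q x y"
  then have "act P Q (x - y) (delta id) w = 0" for w
    unfolding fcong_def by (rule act_hecke_ideal[OF _ W_supported_delta[OF id_W]])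
  then show "\<forall>w. act P Q x (delta id) w = act P Q y (delta id) w"
    by (simp add: act_diff del: id_apply)
next
  assume "\<forall>w. act P Q x (delta id) w = act P Q y (delta id) w"
  then have "act P Q x (delta id) = act P Q y (delta id)" by blast
  then have "fcong P Q x (standard_form (act P Q y (delta id)))"
    using fcong_standard_form[OF assms(1), of P Q] by (simp del: id_apply)
  then show "fcong P Q x y"
    by (rule fcong_trans[OF _ fcong_sym[OF fcong_standard_form[OF assms(2)]]])
qed

end

section \<open>Extension of scalars\<close>

definition ring_map :: "('a::comm_ring_1 \<Rightarrow> 'b::comm_ring_1) \<Rightarrow> bool" where
  "ring_map \<phi> \<longleftrightarrow> \<phi> 1 = 1 \<and> (\<forall>a b. \<phi> (a + b) = \<phi> a + \<phi> b) \<and> (\<forall>a b. \<phi> (a * b) = \<phi> a * \<phi> b)"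

lemma ring_map_one: "ring_map \<phi> \<Longrightarrow> \<phi> 1 = 1"
  and ring_map_add: "ring_map \<phi> \<Longrightarrow> \<phi> (a + b) = \<phi> a + \<phi> b"
  and ring_map_mult: "ring_map \<phi> \<Longrightarrow> \<phi> (a * b) = \<phi> a * \<phi> b"
  by (simp_all add: ring_map_def)

lemma ring_map_zero: "ring_map \<phi> \<Longrightarrow> \<phi> 0 = 0"
  using ring_map_add[of \<phi> 0 0] by simp

lemma ring_map_uminus: "ring_map \<phi> \<Longrightarrow> \<phi> (- a) = - \<phi> a"
  using ring_map_add[of \<phi> "- a" a] by (simp add: ring_map_zero eq_neg_iff_add_eq_0)

lemma ring_map_diff: "ring_map \<phi> \<Longrightarrow> \<phi> (a - b) = \<phi> a - \<phi> b"
  using ring_map_add[of \<phi> a "- b"] by (simp add: ring_map_uminus)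

abbreviation "pmap \<equiv> Poly_Mapping.map"

lemma lookup_pmap: "\<phi> 0 = 0 \<Longrightarrow> Poly_Mapping.lookup (pmap \<phi> x) k = \<phi> (Poly_Mapping.lookup x k)"
  by (simp add: Poly_Mapping.map.rep_eq when_def)

lemma keys_pmap: "Poly_Mapping.keys (pmap \<phi> x) \<subseteq> Poly_Mapping.keys x"
  by (auto simp: in_keys_iff Poly_Mapping.map.rep_eq when_def)

lemma pmap_zero [simp]: "pmap \<phi> 0 = 0"
  by (rule poly_mapping_eqI) (simp add: Poly_Mapping.map.rep_eq)

context
  fixes \<phi> :: "'a::comm_ring_1 \<Rightarrow> 'b::comm_ring_1" assumes \<phi>: "ring_map \<phi>"
begin

lemma pmap_add: "pmap \<phi> (x + y) = pmap \<phi> x + pmap \<phi> y"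
  by (rule poly_mapping_eqI) (simp add: lookup_pmap lookup_add ring_map_zero[OF \<phi>] ring_map_add[OF \<phi>])

lemma pmap_uminus: "pmap \<phi> (- x) = - pmap \<phi> x"
  by (rule poly_mapping_eqI) (simp add: lookup_pmap ring_map_zero[OF \<phi>] ring_map_uminus[OF \<phi>])

lemma pmap_diff: "pmap \<phi> (x - y) = pmap \<phi> x - pmap \<phi> y"
  using pmap_add[of x "- y"] by (simp add: pmap_uminus)

lemma pmap_fmon: "pmap \<phi> (fmon k a) = fmon k (\<phi> a)"
  by (rule map_single) (simp add: ring_map_zero[OF \<phi>])

lemma pmap_sum: "pmap \<phi> (\<Sum>k\<in>K. f k) = (\<Sum>k\<in>K. pmap \<phi> (f k))"
  by (induction K rule: infinite_finite_induct) (simp_all add: pmap_add)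

lemma pmap_fmul: "pmap \<phi> (fmul x y) = fmul (pmap \<phi> x) (pmap \<phi> y)"
proof (induction x rule: poly_mapping_induct_UNIV)
  case x: (single u a)
  show ?case
    by (induction y rule: poly_mapping_induct_UNIV)
      (simp_all add: pmap_fmon fmul_mon pmap_add fmul_add_right ring_map_mult[OF \<phi>])
qed (simp_all add: pmap_add fmul_add_left)

end

context root_basis
begin

lemma pmap_F: "x \<in> F \<Longrightarrow> pmap \<phi> x \<in> F"
  using keys_pmap[of \<phi> x] by (auto simp only: carrier_free_algebra)

lemma colour_map: "ring_map \<phi> \<Longrightarrow> \<phi> (colour P Q \<alpha>) = colour (\<phi> P) (\<phi> Q) \<alpha>"
  by (simp add: colour_def)

section \<open>Cosets, products and basis elements in the quotient\<close>

lemma hecke_class_eq: "hecke_class R \<Delta> P Q x = {z. fcong P Q z x}"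
proof (rule Set.set_eqI)
  fix z
  have "z \<in> hecke_class R \<Delta> P Q x \<longleftrightarrow> (\<exists>i\<in>hecke_ideal R \<Delta> P Q. z = i + x)"
    by (simp add: hecke_class_def a_r_coset_def' add_free_algebra)
  also have "\<dots> \<longleftrightarrow> z - x \<in> hecke_ideal R \<Delta> P Q"
    by (metis add_diff_cancel diff_add_cancel)
  finally show "z \<in> hecke_class R \<Delta> P Q x \<longleftrightarrow> z \<in> {z. fcong P Q z x}"
    by (simp add: fcong_def)
qed

lemma hecke_class_eq_iff: "hecke_class R \<Delta> P Q x = hecke_class R \<Delta> P Q y \<longleftrightarrow> fcong P Q x y"
  unfolding hecke_class_eq using fcong_refl fcong_sym fcong_trans by blast

lemma hecke_class_hom: "hecke_class R \<Delta> P Q \<in> ring_hom (free_algebra \<Delta>) (hecke_algebra R \<Delta> P Q)"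
  using ideal.rcos_ring_hom[OF ideal_hecke_ideal, of P Q]
  by (simp add: hecke_class_def[abs_def] hecke_algebra_def)

lemma ring_hecke_algebra: "ring (hecke_algebra R \<Delta> P Q)"
  unfolding hecke_algebra_def by (rule ideal.quotient_is_ring[OF ideal_hecke_ideal])

lemma carrier_hecke_algebra: "carrier (hecke_algebra R \<Delta> P Q) = hecke_class R \<Delta> P Q ` F"
  by (auto simp: hecke_algebra_def FactRing_def A_RCOSETS_def' hecke_class_def)

lemma hecke_class_mult: "x \<in> F \<Longrightarrow> y \<in> F \<Longrightarrow>
    hecke_class R \<Delta> P Q x \<otimes>\<^bsub>hecke_algebra R \<Delta> P Q\<^esub> hecke_class R \<Delta> P Q y = hecke_class R \<Delta> P Q (fmul x y)"
  using ring_hom_mult[OF hecke_class_hom, of x y P Q] by (simp add: mult_free_algebra)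

lemma hecke_class_one: "\<one>\<^bsub>hecke_algebra R \<Delta> P Q\<^esub> = hecke_class R \<Delta> P Q (fmon [] 1)"
  using ring_hom_one[OF hecke_class_hom, of P Q] by (simp add: one_free_algebra)

lemma hecke_class_minus:
  assumes "x \<in> F" "y \<in> F"
  shows "hecke_class R \<Delta> P Q x \<ominus>\<^bsub>hecke_algebra R \<Delta> P Q\<^esub> hecke_class R \<Delta> P Q y = hecke_class R \<Delta> P Q (x - y)"
proof -
  let ?H = "hecke_algebra R \<Delta> P Q"
  interpret H: ring ?H by (rule ring_hecke_algebra)
  have add: "hecke_class R \<Delta> P Q a \<oplus>\<^bsub>?H\<^esub> hecke_class R \<Delta> P Q b = hecke_class R \<Delta> P Q (a + b)"
    if "a \<in> F" "b \<in> F" for a b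
    using ring_hom_add[OF hecke_class_hom that, of P Q] by (simp add: add_free_algebra)
  have zero: "hecke_class R \<Delta> P Q 0 = \<zero>\<^bsub>?H\<^esub>"
    by (simp add: hecke_class_eq fcong_def hecke_algebra_def FactRing_def)
  have "\<ominus>\<^bsub>?H\<^esub> hecke_class R \<Delta> P Q y = hecke_class R \<Delta> P Q (- y)"
    using assms uminus_F[OF assms(2)]
    by (intro H.minus_equality) (simp_all add: add zero carrier_hecke_algebra)
  then show ?thesis
    using add[OF assms(1) uminus_F[OF assms(2)]] by (simp add: a_minus_def)
qed

lemma word_prod_hecke_gen:
  fixes P Q :: "'a::comm_ring_1"
  shows "ws \<in> lists \<Delta> \<Longrightarrow> word_prod (hecke_algebra R \<Delta> P Q) (hecke_gen R \<Delta> P Q) ws = hecke_class R \<Delta> P Q (fmon ws 1)"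
proof (induction ws rule: lists.induct)
  case Nil
  show ?case by (simp add: word_prod_def hecke_class_one)
next
  case (Cons i ws)
  have "fmon [i] (1::'a) \<in> F" "fmon ws (1::'a) \<in> F" using Cons.hyps by (simp_all add: fmon_F)
  then have "hecke_gen R \<Delta> P Q i \<otimes>\<^bsub>hecke_algebra R \<Delta> P Q\<^esub> hecke_class R \<Delta> P Q (fmon ws 1)
      = hecke_class R \<Delta> P Q (fmon (i # ws) 1)"
    unfolding hecke_gen_def by (subst hecke_class_mult) (simp_all add: fmul_mon)
  then show ?case using Cons.IH by (simp add: word_prod_def)
qed

lemma hecke_T_eq: "w \<in> W \<Longrightarrow> hecke_T R \<Delta> P Q w = hecke_class R \<Delta> P Q (fmon (rword w) 1)"
  unfolding hecke_T_def rword_def[symmetric] by (rule word_prod_hecke_gen[OF rword_lists])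

text \<open>The preimage of the target ideal is an ideal, and it contains the relations because the
  ring map carries relations to relations.\<close>

lemma pmap_hecke_ideal:
  fixes \<phi> :: "'a::comm_ring_1 \<Rightarrow> 'b::comm_ring_1"
  assumes \<phi>: "ring_map \<phi>" and x: "x \<in> hecke_ideal R \<Delta> P Q"
  shows "pmap \<phi> x \<in> hecke_ideal R \<Delta> (\<phi> P) (\<phi> Q)"
proof -
  let ?K = "{x \<in> F. pmap \<phi> x \<in> hecke_ideal R \<Delta> (\<phi> P) (\<phi> Q)}"
  have "ideal ?K (free_algebra \<Delta>)"
    by (rule ideal_free_algebraI)
      (auto simp: pmap_add[OF \<phi>] pmap_uminus[OF \<phi>] pmap_fmul[OF \<phi>] zero_F add_F uminus_F fmul_F pmap_F
        hecke_ideal_closed)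
  moreover have "hecke_relations R \<Delta> P Q \<subseteq> ?K"
  proof
    fix r assume r: "r \<in> hecke_relations R \<Delta> P Q"
    then have "pmap \<phi> r \<in> hecke_relations R \<Delta> (\<phi> P) (\<phi> Q)"
      unfolding hecke_relations_eq
      by (auto simp: pmap_diff[OF \<phi>] pmap_add[OF \<phi>] pmap_fmon[OF \<phi>] ring_map_one[OF \<phi>] colour_map[OF \<phi>])
    then show "r \<in> ?K" using r hecke_relations_F hecke_ideal_relations by blast
  qed
  ultimately show ?thesis using hecke_ideal_minimal x by blast
qed

text \<open>Representatives of one class have congruent images, so \<open>the_elem\<close> is
  applied to a singleton.\<close>

lemma base_change_class:
  assumes "ring_map \<phi>"
  shows "base_change R \<Delta> P Q \<phi> (hecke_class R \<Delta> P Q x) = hecke_class R \<Delta> (\<phi> P) (\<phi> Q) (pmap \<phi> x)"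
  unfolding base_change_def
proof (rule the_elem_image_unique)
  show "hecke_class R \<Delta> P Q x \<noteq> {}"
    unfolding hecke_class_eq using fcong_refl by blast
  fix z assume "z \<in> hecke_class R \<Delta> P Q x"
  then have "z - x \<in> hecke_ideal R \<Delta> P Q" by (simp add: hecke_class_eq fcong_def)
  then show "hecke_class R \<Delta> (\<phi> P) (\<phi> Q) (pmap \<phi> z) = hecke_class R \<Delta> (\<phi> P) (\<phi> Q) (pmap \<phi> x)"
    unfolding hecke_class_eq_iff fcong_def using pmap_hecke_ideal[OF assms]
    by (simp add: pmap_diff[OF assms, symmetric])
qed

lemma foldr_left_op_map:
  assumes \<phi>: "ring_map \<phi>"
  shows "foldr (left_op (\<phi> P) (\<phi> Q)) ws (delta id) w = \<phi> (foldr (left_op P Q) ws (delta id) w)"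
proof (induction ws arbitrary: w)
  case Nil
  have "delta id w = \<phi> (delta id w)"
    unfolding delta_def using ring_map_one[OF \<phi>] ring_map_zero[OF \<phi>] by auto
  then show ?case unfolding foldr.simps id_apply .
next
  case (Cons i ws)
  then have IH: "foldr (left_op (\<phi> P) (\<phi> Q)) ws (delta id) = (\<lambda>w. \<phi> (foldr (left_op P Q) ws (delta id) w))"
    by blast
  have "left_op (\<phi> P) (\<phi> Q) i (\<lambda>w. \<phi> (f w)) w = \<phi> (left_op P Q i f w)" for f
    by (simp add: left_op_def ring_map_add[OF \<phi>] ring_map_mult[OF \<phi>] ring_map_zero[OF \<phi>] colour_map[OF \<phi>])
  then show ?case using IH by (simp del: id_apply)
qed

lemma act_map:
  assumes \<phi>: "ring_map \<phi>"
  shows "act (\<phi> P) (\<phi> Q) (pmap \<phi> x) (delta id) w = \<phi> (act P Q x (delta id) w)"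
  by (induction x rule: poly_mapping_induct_UNIV)
    (simp_all add: act_zero act_mon act_add pmap_fmon[OF \<phi>] pmap_add[OF \<phi>] ring_map_zero[OF \<phi>]
      ring_map_mult[OF \<phi>] ring_map_add[OF \<phi>] foldr_left_op_map[OF \<phi>] del: id_apply)

text \<open>Coordinates in the basis T_w are compared: over the larger ring they are the images of
  the original ones under an injective map.\<close>

lemma fcong_reflect:
  assumes "ring_map \<iota>" "inj \<iota>" "x \<in> F" "y \<in> F"
    and "fcong (\<iota> P) (\<iota> Q) (pmap \<iota> x) (pmap \<iota> y)"
  shows "fcong P Q x y"
proof -
  have "\<forall>w. act (\<iota> P) (\<iota> Q) (pmap \<iota> x) (delta id) w = act (\<iota> P) (\<iota> Q) (pmap \<iota> y) (delta id) w"
    using fcong_iff[OF pmap_F[OF assms(3)] pmap_F[OF assms(4)]] assms(5) by blast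
  then show ?thesis
    unfolding act_map[OF assms(1)] fcong_iff[OF assms(3,4)] using injD[OF assms(2)] by blast
qed

text \<open>Faithfulness of the base change makes the preimage unique, so the definite description
  returns the class of any lift at hand.\<close>

lemma specialize_class:
  assumes \<iota>: "ring_map \<iota>" "inj \<iota>" and \<phi>: "ring_map \<phi>" and x: "x \<in> F"
  shows "specialize R \<Delta> P Q \<iota> \<phi> (hecke_class R \<Delta> (\<iota> P) (\<iota> Q) (pmap \<iota> x))
    = hecke_class R \<Delta> (\<phi> P) (\<phi> Q) (pmap \<phi> x)"
proof -
  have "(THE y. y \<in> carrier (hecke_algebra R \<Delta> P Q)
      \<and> base_change R \<Delta> P Q \<iota> y = hecke_class R \<Delta> (\<iota> P) (\<iota> Q) (pmap \<iota> x)) = hecke_class R \<Delta> P Q x"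
  proof (rule the_equality)
    show "hecke_class R \<Delta> P Q x \<in> carrier (hecke_algebra R \<Delta> P Q)
        \<and> base_change R \<Delta> P Q \<iota> (hecke_class R \<Delta> P Q x) = hecke_class R \<Delta> (\<iota> P) (\<iota> Q) (pmap \<iota> x)"
      using x base_change_class[OF \<iota>(1)] by (simp add: carrier_hecke_algebra)
  next
    fix y assume y: "y \<in> carrier (hecke_algebra R \<Delta> P Q)
        \<and> base_change R \<Delta> P Q \<iota> y = hecke_class R \<Delta> (\<iota> P) (\<iota> Q) (pmap \<iota> x)"
    then obtain z where z: "z \<in> F" "y = hecke_class R \<Delta> P Q z"
      unfolding carrier_hecke_algebra by blast
    then have "fcong (\<iota> P) (\<iota> Q) (pmap \<iota> z) (pmap \<iota> x)"
      using y base_change_class[OF \<iota>(1), of P Q z] by (simp add: hecke_class_eq_iff)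
    then show "y = hecke_class R \<Delta> P Q x"
      unfolding z(2) hecke_class_eq_iff by (rule fcong_reflect[OF \<iota> z(1) x])
  qed
  then show ?thesis
    unfolding specialize_def using base_change_class[OF \<phi>, of P Q x] by simp
qed

section \<open>Passage to the integral group ring\<close>

definition to_group_ring :: "('v list \<Rightarrow>\<^sub>0 int) \<Rightarrow> ('v \<Rightarrow> 'v) \<Rightarrow>\<^sub>0 int" where
  "to_group_ring = psum (\<lambda>ws a. fmon (word ws) a)"

lemma to_group_ring_add: "to_group_ring (x + y) = to_group_ring x + to_group_ring y"
  unfolding to_group_ring_def by (rule psum_add) (simp_all add: single_add)

lemma to_group_ring_fmon: "to_group_ring (fmon ws a) = fmon (word ws) a"
  unfolding to_group_ring_def by (rule psum_single) simp

lemma to_group_ring_zero: "to_group_ring 0 = 0"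
  by (simp add: to_group_ring_def)

lemma to_group_ring_sum: "to_group_ring (\<Sum>k\<in>K. f k) = (\<Sum>k\<in>K. to_group_ring (f k))"
  by (induction K rule: infinite_finite_induct) (simp_all add: to_group_ring_zero to_group_ring_add)

text \<open>With both parameters zero the correction vanishes and each operator is a
  translation.\<close>

lemma left_op_group_ring:
  "ws \<in> lists \<Delta> \<Longrightarrow> foldr (left_op (0::'a::comm_ring_1) 0) ws (delta id) = delta (word ws)"
proof (induction ws rule: lists.induct)
  case Nil
  show ?case by simp
next
  case (Cons i ws)
  have z: "colour (0::'a) 0 i = 0" by (simp add: colour_def)
  have "foldr (left_op (0::'a) 0) (i # ws) (delta id) = left_op (0::'a) 0 i (foldr (left_op (0::'a) 0) ws (delta id))"
    by simp
  also have "\<dots> = left_op (0::'a) 0 i (delta (word ws))"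
    unfolding Cons.IH ..
  also have "\<dots> = delta (reflection i \<circ> word ws)"
    by (rule ext) (simp only: left_op_delta[OF word_W[OF Cons.hyps(2)] Cons.hyps(1)] z if_cancel
        mult_zero_left add_0_right)
  finally show ?case unfolding weyl_word_Cons .
qed

text \<open>The coefficients are the coordinates at zero parameters, and from these the map inherits
  independence of the representative.\<close>

lemma lookup_to_group_ring:
  assumes "x \<in> F" shows "Poly_Mapping.lookup (to_group_ring x) w = act 0 0 x (delta id) w"
proof -
  from assms have "Poly_Mapping.keys x \<subseteq> lists \<Delta>" by (simp add: carrier_free_algebra)
  then show ?thesis
  proof (induction x rule: poly_mapping_induct)
    case zero
    show ?case by (simp add: to_group_ring_zero act_zero del: id_apply)
  next
    case (single ws a)
    show ?case
      unfolding to_group_ring_fmon act_mon left_op_group_ring[OF single] lookup_single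
      unfolding delta_def by (auto simp: when_def)
  next
    case (add x y)
    then show ?case by (simp only: to_group_ring_add lookup_add act_add)
  qed
qed

lemma hecke_to_group_ring_class: "hecke_to_group_ring R (hecke_class R \<Delta> 0 0 x) = to_group_ring x"
  unfolding hecke_to_group_ring_def
proof (rule the_elem_image_unique)
  show "hecke_class R \<Delta> 0 0 x \<noteq> {}"
    unfolding hecke_class_eq using fcong_refl by blast
  fix z assume "z \<in> hecke_class R \<Delta> 0 0 x"
  then have zx: "z - x \<in> hecke_ideal R \<Delta> 0 0" by (simp add: hecke_class_eq fcong_def)
  have "to_group_ring (z - x) = 0"
  proof (rule poly_mapping_eqI)
    fix w
    show "Poly_Mapping.lookup (to_group_ring (z - x)) w = Poly_Mapping.lookup 0 w"
      unfolding lookup_to_group_ring[OF hecke_ideal_F[OF zx]] lookup_zero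
      by (rule act_hecke_ideal[OF zx W_supported_delta[OF id_W]])
  qed
  then have "to_group_ring z = to_group_ring x"
    using to_group_ring_add[of "z - x" x] by simp
  then show "(\<Sum>ws\<in>Poly_Mapping.keys z. fmon (word ws) (Poly_Mapping.lookup z ws)) = to_group_ring x"
    by (simp add: to_group_ring_def psum_def)
qed

section \<open>The square of the longest standard basis element\<close>

text \<open>Multiplying by T_j on both sides turns 1 into c_j T_j + 1 and lengthens every palindrome
  at both ends. Reflection in \<open>j\<close> preserves root lengths, so each parameter can be read
  off the new root.\<close>

lemma fcong_palindrome:
  assumes "ws \<in> lists \<Delta>"
  shows "fcong P Q (fmon (ws @ rev ws) 1)
    (fmon [] 1 + (\<Sum>(\<beta>, p)\<leftarrow>inversions ws. fmon p (colour P Q \<beta>)))"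
  using assms
proof (induction ws)
  case Nil
  show ?case by (simp add: fcong_refl)
next
  case (Cons j us)
  let ?j = "fmon [j] 1" and ?S = "\<lambda>xs. \<Sum>(\<beta>, p)\<leftarrow>xs. fmon p (colour P Q \<beta>)"
  have j: "?j \<in> F" and jl: "j \<in> \<Delta>" using Cons.hyps by (simp_all add: fmon_F)
  have conj: "fmul (fmul ?j (?S xs)) ?j = ?S (map (\<lambda>(\<beta>, p). (reflection j \<beta>, j # p @ [j])) xs)" for xs
  proof (induction xs)
    case (Cons x xs)
    obtain \<beta> p where x: "x = (\<beta>, p)" by (cases x)
    have c: "colour P Q (reflection j \<beta>) = colour P Q \<beta>" by (rule colour_W[OF reflection_W[OF jl]])
    have "fmul (fmul ?j (?S (x # xs))) ?j
        = fmon (j # p @ [j]) (colour P Q \<beta>) + fmul (fmul ?j (?S xs)) ?j"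
      by (simp add: x fmul_add_left fmul_add_right fmul_mon)
    then show ?case unfolding Cons.IH by (simp add: x c)
  qed simp
  have "fcong P Q (fmul (fmul ?j (fmon (us @ rev us) 1)) ?j) (fmul (fmul ?j (fmon [] 1 + ?S (inversions us))) ?j)"
    by (intro fcong_left fcong_right Cons.IH j)
  also have "fmul (fmul ?j (fmon (us @ rev us) 1)) ?j = fmon ((j # us) @ rev (j # us)) 1"
    by (simp add: fmul_mon)
  also have "fmul (fmul ?j (fmon [] 1 + ?S (inversions us))) ?j
      = fmon [j, j] 1 + ?S (map (\<lambda>(\<beta>, p). (reflection j \<beta>, j # p @ [j])) (inversions us))"
    unfolding fmul_add_left fmul_add_right conj by (simp add: fmul_mon)
  also have "fcong P Q \<dots> (fmon [j] (colour P Q j) + fmon [] 1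
      + ?S (map (\<lambda>(\<beta>, p). (reflection j \<beta>, j # p @ [j])) (inversions us)))"
    by (intro fcong_add fcong_quadratic fcong_refl jl)
  also have "\<dots> = fmon [] 1 + ?S (inversions (j # us))"
    by (simp add: ac_simps)
  finally show ?case .
qed

text \<open>A lift of the quotient \<open>(T\<^sup>2 - 1) / d\<close>, for \<open>T\<close> the basis element of the longest element, when the
  parameter is \<open>d\<close> for the roots in \<open>S\<close> and \<open>0\<close> for the others.\<close>

definition quotient_lift :: "'v set \<Rightarrow> 'v list \<Rightarrow>\<^sub>0 'a::comm_ring_1" where
  "quotient_lift S = (\<Sum>x\<in>set (inversions (rword (longest_element R \<Delta>))).
     fmon (snd x) (if fst x \<in> S then 1 else 0))"

lemma quotient_lift_F: "quotient_lift S \<in> F"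
  unfolding quotient_lift_def
proof (rule sum_F)
  fix x assume "x \<in> set (inversions (rword (longest_element R \<Delta>)))"
  then have "snd x \<in> lists \<Delta>"
    using inversions_word[OF rword_lists[OF longest_W], of "fst x" "snd x"] by simp
  then show "fmon (snd x) (if fst x \<in> S then 1 else 0) \<in> F" by (rule fmon_F)
qed

text \<open>The coefficients are 0 and 1, which every ring map fixes.\<close>

lemma pmap_quotient_lift: "ring_map \<phi> \<Longrightarrow> pmap \<phi> (quotient_lift S) = quotient_lift S"
  unfolding quotient_lift_def pmap_sum
  by (rule sum.cong) (simp_all add: pmap_fmon ring_map_one ring_map_zero)

lemma to_group_ring_quotient_lift:
  assumes "S \<subseteq> pos"
  shows "to_group_ring (quotient_lift S) = (\<Sum>\<beta>\<in>S. fmon (reflection \<beta>) 1)"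
proof -
  let ?I = "inversions (rword (longest_element R \<Delta>))"
  note inv = inversions_longest[OF reduced_rword[OF longest_W]]
  have "to_group_ring (quotient_lift S) = (\<Sum>x\<in>set ?I. fmon (reflection (fst x)) (if fst x \<in> S then 1 else 0))"
    unfolding quotient_lift_def to_group_ring_sum to_group_ring_fmon
  proof (rule sum.cong[OF refl])
    fix x assume "x \<in> set ?I"
    then have "word (snd x) = reflection (fst x)"
      using inversions_word[OF rword_lists[OF longest_W], of "fst x" "snd x"] by simp
    then show "fmon (word (snd x)) (if fst x \<in> S then 1 else 0)
        = fmon (reflection (fst x)) (if fst x \<in> S then 1 else (0::int))" by (simp only:)
  qed
  also have "\<dots> = (\<Sum>\<beta>\<in>fst ` set ?I. fmon (reflection \<beta>) (if \<beta> \<in> S then 1 else 0))"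
    using inv(1) by (subst sum.reindex) (simp_all add: distinct_map o_def)
  also have "fst ` set ?I = pos" using inv(2) by simp
  also have "(\<Sum>\<beta>\<in>pos. fmon (reflection \<beta>) (if \<beta> \<in> S then 1 else (0::int)))
      = (\<Sum>\<beta>\<in>S. fmon (reflection \<beta>) (if \<beta> \<in> S then 1 else 0))"
    using assms finite_pos by (intro sum.mono_neutral_right) auto
  also have "\<dots> = (\<Sum>\<beta>\<in>S. fmon (reflection \<beta>) 1)"
    by (rule sum.cong) simp_all
  finally show ?thesis .
qed

text \<open>At positive roots the parameter is \<open>d\<close> or 0, so the square minus 1 can be
  divided by \<open>d\<close> term by term.\<close>

lemma square_quotient:
  fixes P Q d :: "'k::field"
  assumes d: "d \<noteq> 0" and col: "\<And>\<beta>. \<beta> \<in> pos \<Longrightarrow> colour P Q \<beta> = (if \<beta> \<in> S then d else 0)"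
    and t: "t = hecke_class R \<Delta> P Q (fmon (rword (longest_element R \<Delta>)) 1)"
  defines "H \<equiv> hecke_algebra R \<Delta> P Q"
  shows "hecke_scalar R \<Delta> P Q (inverse d) \<otimes>\<^bsub>H\<^esub> (t [^]\<^bsub>H\<^esub> (2::nat) \<ominus>\<^bsub>H\<^esub> \<one>\<^bsub>H\<^esub>)
    = hecke_class R \<Delta> P Q (quotient_lift S)"
proof -
  interpret H: ring H unfolding H_def by (rule ring_hecke_algebra)
  define ws where "ws = rword (longest_element R \<Delta>)"
  note red = reduced_rword[OF longest_W, folded ws_def]
  note inv = inversions_longest[OF red]
  have ws: "ws \<in> lists \<Delta>" unfolding ws_def by (rule rword_lists[OF longest_W])
  let ?X = "\<Sum>(\<beta>, p)\<leftarrow>inversions ws. fmon p (colour P Q \<beta>)"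
  have w1: "fmon ws (1::'k) \<in> F" "fmon [] a \<in> F" for a :: 'k using ws by (simp_all add: fmon_F)
  have tc: "t \<in> carrier H" unfolding t H_def carrier_hecke_algebra using w1 ws_def by blast
  have dist: "distinct (inversions ws)" using inv(1) by (simp add: distinct_map)
  have pl: "snd x \<in> lists \<Delta>" if "x \<in> set (inversions ws)" for x
    using inversions_word[OF ws, of "fst x" "snd x"] that by simp
  have X: "?X = (\<Sum>x\<in>set (inversions ws). fmon (snd x) (colour P Q (fst x)))"
    unfolding sum_list_distinct_conv_sum_set[OF dist] by (simp add: case_prod_beta)
  have XF: "?X \<in> F" unfolding X by (intro sum_F fmon_F pl)
  have "t [^]\<^bsub>H\<^esub> (2::nat) = t \<otimes>\<^bsub>H\<^esub> t"
    using tc by (simp add: numeral_2_eq_2)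
  also have "\<dots> = hecke_class R \<Delta> P Q (fmon (ws @ ws) 1)"
    unfolding t H_def ws_def[symmetric] hecke_class_mult[OF w1(1) w1(1)] by (simp add: fmul_mon)
  \<comment> \<open>The second factor is replaced by its reversal, a reduced word of the same
    involution.\<close>
  also have "\<dots> = hecke_class R \<Delta> P Q (fmon (ws @ rev ws) 1)"
    using fcong_left[OF fcong_reduced[OF red reduced_longest_rev[OF red]] w1(1), of P Q]
    by (simp add: hecke_class_eq_iff fmul_mon)
  also have "\<dots> = hecke_class R \<Delta> P Q (fmon [] 1 + ?X)"
    unfolding hecke_class_eq_iff by (rule fcong_palindrome[OF ws])
  finally have "t [^]\<^bsub>H\<^esub> (2::nat) \<ominus>\<^bsub>H\<^esub> \<one>\<^bsub>H\<^esub> = hecke_class R \<Delta> P Q (fmon [] 1 + ?X - fmon [] 1)"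
    unfolding H_def hecke_class_one using hecke_class_minus[OF add_F[OF w1(2) XF] w1(2)] by simp
  also have "fmon [] 1 + ?X - fmon [] 1 = ?X" by simp
  finally have "hecke_scalar R \<Delta> P Q (inverse d) \<otimes>\<^bsub>H\<^esub> (t [^]\<^bsub>H\<^esub> (2::nat) \<ominus>\<^bsub>H\<^esub> \<one>\<^bsub>H\<^esub>)
      = hecke_class R \<Delta> P Q (fmul (fmon [] (inverse d)) ?X)"
    unfolding H_def hecke_scalar_def using hecke_class_mult[OF w1(2) XF] by simp
  also have "fmul (fmon [] (inverse d)) ?X = quotient_lift S"
    unfolding X fmul_sum_right quotient_lift_def ws_def[symmetric]
  proof (rule sum.cong[OF refl])
    fix x assume "x \<in> set (inversions ws)"
    then have "fst x \<in> pos" using inv(2) by auto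
    then show "fmul (fmon [] (inverse d)) (fmon (snd x) (colour P Q (fst x)))
        = fmon (snd x) (if fst x \<in> S then 1 else 0)"
      using d by (simp add: fmul_mon col)
  qed
  finally show ?thesis .
qed

end

section \<open>Laurent polynomials\<close>

text \<open>By biadditivity, multiplicativity has to be checked on monomials only; the inclusions
  and evaluations of Laurent polynomials all have this form.\<close>

lemma ring_map_psum:
  fixes h :: "'k::comm_monoid_add \<Rightarrow> 'a::comm_ring_1 \<Rightarrow> 'b::comm_ring_1"
  assumes zero: "\<And>k. h k 0 = 0" and add: "\<And>k a b. h k (a + b) = h k a + h k b"
    and one: "h 0 1 = 1" and mult: "\<And>k l a b. h (k + l) (a * b) = h k a * h l b"
  shows "ring_map (psum h)"
  unfolding ring_map_def
proof (intro conjI allI)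
  have "psum h (fmon 0 1) = 1" by (simp only: psum_single[of h, OF zero] one)
  then show "psum h 1 = 1" by (simp only: single_one)
  show padd: "psum h (x + y) = psum h x + psum h y" for x y
    by (rule psum_add[OF zero add])
  show "psum h (x * y) = psum h x * psum h y" for x y
  proof (induction x rule: poly_mapping_induct_UNIV)
    case x: (single k a)
    show ?case
      by (induction y rule: poly_mapping_induct_UNIV)
        (simp_all add: mult_single psum_single zero mult padd distrib_left)
  qed (simp_all add: padd distrib_right)
qed

lemma ring_map_injI:
  assumes "ring_map \<phi>" "\<And>x. \<phi> x = 0 \<Longrightarrow> x = 0" shows "inj \<phi>"
proof (rule injI)
  fix x y assume "\<phi> x = \<phi> y"
  then have "\<phi> (x - y) = 0" by (simp add: ring_map_diff[OF assms(1)])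
  then show "x = y" using assms(2)[of "x - y"] by simp
qed

lemma ring_map_of_int: assumes "ring_map \<phi>" shows "\<phi> (of_int c) = of_int c"
proof -
  have "\<phi> (of_nat n) = of_nat n" for n
    by (induction n) (simp_all add: ring_map_zero[OF assms] ring_map_one[OF assms] ring_map_add[OF assms])
  then show ?thesis
    by (cases c rule: int_cases2) (simp_all add: ring_map_uminus[OF assms])
qed

lemma to_fract_of_int: "to_fract (of_int c) = of_int c"
  by (rule ring_map_of_int) (simp add: ring_map_def)

lemma to_fract_power: "to_fract (x ^ n) = to_fract x ^ n"
  by (induction n) simp_all

section \<open>The variables, the inclusions and the evaluations\<close>

lemma rvar_eq: "rvar = to_fract (Polynomial.monom 1 1)"
  by (simp add: rvar_def to_fract_def monom_altdef)

lemma rvar_p_eq: "rvar_p = to_fract (Polynomial.monom (Polynomial.monom 1 1) 0)"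
  by (simp add: rvar_p_def to_fract_def monom_altdef)

lemma rvar_q_eq: "rvar_q = to_fract (Polynomial.monom 1 1)"
  by (simp add: rvar_q_def to_fract_def monom_altdef)

lemma rvar_nonzero: "rvar \<noteq> 0" "rvar_p \<noteq> 0" "rvar_q \<noteq> 0"
  by (simp_all add: rvar_eq rvar_p_eq rvar_q_eq)

lemma laurent_incl_psum: "laurent_incl = psum (\<lambda>a c. of_int c * rvar powi a)"
  by (simp add: fun_eq_iff laurent_incl_def psum_def)

lemma laurent2_incl_psum:
  "laurent2_incl = psum (\<lambda>k c. of_int c * rvar_p powi fst k * rvar_q powi snd k)"
  by (simp add: fun_eq_iff laurent2_incl_def psum_def case_prod_beta)

lemma laurent_at_1_psum: "laurent_at_1 = psum (\<lambda>a c. c)"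
  by (simp add: fun_eq_iff laurent_at_1_def psum_def)

lemma laurent2_at_p1_psum: "laurent2_at_p1 = psum (\<lambda>k c. fmon (snd k) c)"
  by (simp add: fun_eq_iff laurent2_at_p1_def psum_def case_prod_beta)

lemma laurent2_at_q1_psum: "laurent2_at_q1 = psum (\<lambda>k c. fmon (fst k) c)"
  by (simp add: fun_eq_iff laurent2_at_q1_def psum_def case_prod_beta)

lemma laurent2_at_pq1_psum: "laurent2_at_pq1 = psum (\<lambda>k c. c)"
  by (simp add: fun_eq_iff laurent2_at_pq1_def psum_def)

lemma ring_map_laurent_incl: "ring_map laurent_incl"
  unfolding laurent_incl_psum
  by (rule ring_map_psum) (simp_all add: distrib_right power_int_add rvar_nonzero)

lemma ring_map_laurent2_incl: "ring_map laurent2_incl"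
  unfolding laurent2_incl_psum
  by (rule ring_map_psum) (simp_all add: distrib_right power_int_add rvar_nonzero)

lemma ring_map_laurent_at_1: "ring_map laurent_at_1"
  unfolding laurent_at_1_psum by (rule ring_map_psum) simp_all

lemma ring_map_laurent2_at_p1: "ring_map laurent2_at_p1"
  unfolding laurent2_at_p1_psum
  by (rule ring_map_psum) (simp_all add: single_add mult_single)

lemma ring_map_laurent2_at_q1: "ring_map laurent2_at_q1"
  unfolding laurent2_at_q1_psum
  by (rule ring_map_psum) (simp_all add: single_add mult_single)

lemma ring_map_laurent2_at_pq1: "ring_map laurent2_at_pq1"
  unfolding laurent2_at_pq1_psum by (rule ring_map_psum) simp_all

text \<open>After multiplication with a high power of the variables, the coefficients can be read off from
  an identity of polynomials.\<close>

lemma inj_laurent_incl: "inj laurent_incl"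
proof (rule ring_map_injI[OF ring_map_laurent_incl])
  fix f assume f: "laurent_incl f = 0"
  let ?K = "Poly_Mapping.keys f" and ?c = "Poly_Mapping.lookup f"
  \<comment> \<open>A bound for the absolute values of all exponents, so that the shift makes them
    nonnegative.\<close>
  define N where "N = (\<Sum>a\<in>?K. \<bar>a\<bar>)"
  have N: "0 \<le> a + N" if "a \<in> ?K" for a
    using member_le_sum[of a ?K abs] that by (simp add: N_def)
  have pow: "rvar powi (a + N) = to_fract (Polynomial.monom 1 (nat (a + N)))" if "a \<in> ?K" for a
  proof -
    have "rvar powi (a + N) = rvar ^ nat (a + N)" using N[OF that] by (simp add: power_int_def)
    also have "\<dots> = to_fract (Polynomial.monom 1 (nat (a + N)))"
      by (simp add: rvar_eq to_fract_power[symmetric] monom_power)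
    finally show ?thesis .
  qed
  have "0 = rvar powi N * laurent_incl f" using f by simp
  also have "\<dots> = (\<Sum>a\<in>?K. of_int (?c a) * rvar powi (a + N))"
    by (simp add: laurent_incl_def sum_distrib_left power_int_add rvar_nonzero mult.commute mult.left_commute)
  also have "\<dots> = (\<Sum>a\<in>?K. to_fract (Polynomial.monom (of_int (?c a)) (nat (a + N))))"
  proof (rule sum.cong[OF refl])
    fix a assume "a \<in> ?K"
    then have "of_int (?c a) * rvar powi (a + N) = to_fract (of_int (?c a) * Polynomial.monom 1 (nat (a + N)))"
      by (simp add: pow to_fract_of_int)
    then show "of_int (?c a) * rvar powi (a + N) = to_fract (Polynomial.monom (of_int (?c a)) (nat (a + N)))"
      by (simp add: of_int_poly smult_monom)
  qed
  finally have "to_fract (\<Sum>a\<in>?K. Polynomial.monom (of_int (?c a)) (nat (a + N))) = (0 :: ratfun)" by simp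
  then have z: "(\<Sum>a\<in>?K. Polynomial.monom (of_int (?c a)) (nat (a + N))) = (0 :: complex poly)"
    by (simp only: to_fract_eq_0_iff)
  show "f = 0"
  proof (rule poly_mapping_eqI)
    fix b
    show "?c b = Poly_Mapping.lookup 0 b"
    proof (cases "b \<in> ?K")
      case True
      \<comment> \<open>Shifted exponents stay distinct, so the coefficient at \<open>b + N\<close>
        isolates the one at \<open>b\<close>.\<close>
      have "(0::complex) = (\<Sum>a\<in>?K. Polynomial.coeff (Polynomial.monom (of_int (?c a)) (nat (a + N))) (nat (b + N)))"
        using arg_cong[OF z, of "\<lambda>p. Polynomial.coeff p (nat (b + N))"] by (simp add: coeff_sum)
      also have "\<dots> = (\<Sum>a\<in>?K. if a = b then of_int (?c a) else 0)"
        using N True by (intro sum.cong refl) (auto simp: nat_eq_iff)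
      also have "\<dots> = (of_int (?c b) :: complex)" using True by simp
      finally show ?thesis by simp
    next
      case False
      then show ?thesis by (simp add: in_keys_iff)
    qed
  qed
qed

lemma inj_laurent2_incl: "inj laurent2_incl"
proof (rule ring_map_injI[OF ring_map_laurent2_incl])
  fix f assume f: "laurent2_incl f = 0"
  let ?K = "Poly_Mapping.keys f" and ?c = "Poly_Mapping.lookup f"
  define N where "N = (\<Sum>k\<in>?K. \<bar>fst k\<bar> + \<bar>snd k\<bar>)"
  have N: "0 \<le> fst k + N" "0 \<le> snd k + N" if "k \<in> ?K" for k
    using member_le_sum[of k ?K "\<lambda>k. \<bar>fst k\<bar> + \<bar>snd k\<bar>"] that by (simp_all add: N_def)
  \<comment> \<open>\<open>rvar_p\<close> is the inner variable of the nested polynomials and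
    \<open>rvar_q\<close> the outer one, hence the order of the exponents.\<close>
  let ?m = "\<lambda>c k. Polynomial.monom (Polynomial.monom c (nat (fst k + N))) (nat (snd k + N))"
  have pow: "rvar_p powi (fst k + N) * rvar_q powi (snd k + N) = to_fract (?m 1 k)" if "k \<in> ?K" for k
  proof -
    have "rvar_p powi (fst k + N) = rvar_p ^ nat (fst k + N)"
      "rvar_q powi (snd k + N) = rvar_q ^ nat (snd k + N)"
      using N[OF that] by (simp_all add: power_int_def)
    moreover have "rvar_p ^ nat (fst k + N) * rvar_q ^ nat (snd k + N) = to_fract (?m 1 k)"
      by (simp add: rvar_p_eq rvar_q_eq to_fract_power[symmetric] to_fract_mult[symmetric] monom_power
          mult_monom del: to_fract_mult)
    ultimately show ?thesis by simp
  qed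
  have "0 = rvar_p powi N * rvar_q powi N * laurent2_incl f" using f by simp
  also have "\<dots> = (\<Sum>k\<in>?K. of_int (?c k) * (rvar_p powi (fst k + N) * rvar_q powi (snd k + N)))"
    by (simp add: laurent2_incl_def sum_distrib_left power_int_add rvar_nonzero case_prod_beta ac_simps)
  also have "\<dots> = (\<Sum>k\<in>?K. to_fract (?m (of_int (?c k)) k))"
  proof (rule sum.cong[OF refl])
    fix k assume "k \<in> ?K"
    then have "of_int (?c k) * (rvar_p powi (fst k + N) * rvar_q powi (snd k + N)) = to_fract (of_int (?c k) * ?m 1 k)"
      by (simp only: pow to_fract_mult to_fract_of_int)
    also have "of_int (?c k) * ?m 1 k = ?m (of_int (?c k)) k"
      by (simp add: of_int_poly smult_monom)
    finally show "of_int (?c k) * (rvar_p powi (fst k + N) * rvar_q powi (snd k + N)) = to_fract (?m (of_int (?c k)) k)" .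
  qed
  finally have "to_fract (\<Sum>k\<in>?K. ?m (of_int (?c k)) k) = (0 :: ratfun2)" by simp
  then have z: "(\<Sum>k\<in>?K. ?m (of_int (?c k)) k) = (0 :: complex poly poly)"
    by (simp only: to_fract_eq_0_iff)
  show "f = 0"
  proof (rule poly_mapping_eqI)
    fix b
    show "?c b = Poly_Mapping.lookup 0 b"
    proof (cases "b \<in> ?K")
      case True
      have "(0::complex) = (\<Sum>k\<in>?K. Polynomial.coeff (Polynomial.coeff (?m (of_int (?c k)) k) (nat (snd b + N))) (nat (fst b + N)))"
        using arg_cong[OF z, of "\<lambda>p. Polynomial.coeff (Polynomial.coeff p (nat (snd b + N))) (nat (fst b + N))"] by (simp add: coeff_sum)
      also have "\<dots> = (\<Sum>k\<in>?K. if k = b then of_int (?c k) else 0)"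
      proof (rule sum.cong[OF refl])
        fix k assume "k \<in> ?K"
        then have "nat (fst k + N) = nat (fst b + N) \<longleftrightarrow> fst k = fst b"
          "nat (snd k + N) = nat (snd b + N) \<longleftrightarrow> snd k = snd b"
          using N[of k] N[OF True] by (simp_all add: nat_eq_iff)
        then show "Polynomial.coeff (Polynomial.coeff (?m (of_int (?c k)) k) (nat (snd b + N))) (nat (fst b + N))
            = (if k = b then of_int (?c k) else 0)"
          by (auto simp: prod_eq_iff)
      qed
      also have "\<dots> = (of_int (?c b) :: complex)" using True by simp
      finally show ?thesis by simp
    next
      case False
      then show ?thesis by (simp add: in_keys_iff)
    qed
  qed
qed

lemma laurent_incl_q: "laurent_incl (lmonom 1 - lmonom (- 1)) = rvar - inverse rvar"
  unfolding ring_map_diff[OF ring_map_laurent_incl]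
  by (simp add: laurent_incl_psum psum_single power_int_minus)

text \<open>Injectivity of the inclusion reduces this to a coefficient of a Laurent
  polynomial.\<close>

lemma rvar_diff_nonzero: "rvar - inverse rvar \<noteq> 0"
proof
  assume "rvar - inverse rvar = 0"
  then have "laurent_incl (lmonom 1 - lmonom (- 1)) = laurent_incl 0"
    by (simp add: laurent_incl_q ring_map_zero[OF ring_map_laurent_incl])
  then have "lmonom 1 - lmonom (- 1) = 0" by (rule injD[OF inj_laurent_incl])
  then have "Poly_Mapping.lookup (lmonom 1 - lmonom (- 1)) 1 = 0" by simp
  then show False by (simp add: lookup_minus lookup_single)
qed

lemma laurent2_incl_pq:
  "laurent2_incl (lmonom2 1 0 - lmonom2 (- 1) 0) = rvar_p - inverse rvar_p"
  "laurent2_incl (lmonom2 0 1 - lmonom2 0 (- 1)) = rvar_q - inverse rvar_q"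
  unfolding ring_map_diff[OF ring_map_laurent2_incl]
  by (simp_all add: laurent2_incl_psum psum_single power_int_minus)

lemma laurent_at_1_q: "laurent_at_1 (lmonom 1 - lmonom (- 1)) = 0"
  unfolding ring_map_diff[OF ring_map_laurent_at_1] by (simp add: laurent_at_1_psum psum_single)

lemma laurent2_at_p1_pq:
  "laurent2_at_p1 (lmonom2 1 0 - lmonom2 (- 1) 0) = 0"
  "laurent2_at_p1 (lmonom2 0 1 - lmonom2 0 (- 1)) = lmonom 1 - lmonom (- 1)"
  unfolding ring_map_diff[OF ring_map_laurent2_at_p1]
  by (simp_all add: laurent2_at_p1_psum psum_single del: single_one)

lemma laurent2_at_q1_pq:
  "laurent2_at_q1 (lmonom2 1 0 - lmonom2 (- 1) 0) = lmonom 1 - lmonom (- 1)"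
  "laurent2_at_q1 (lmonom2 0 1 - lmonom2 0 (- 1)) = 0"
  unfolding ring_map_diff[OF ring_map_laurent2_at_q1]
  by (simp_all add: laurent2_at_q1_psum psum_single del: single_one)

lemma laurent2_at_pq1_pq:
  "laurent2_at_pq1 (lmonom2 1 0 - lmonom2 (- 1) 0) = 0"
  "laurent2_at_pq1 (lmonom2 0 1 - lmonom2 0 (- 1)) = 0"
  unfolding ring_map_diff[OF ring_map_laurent2_at_pq1]
  by (simp_all add: laurent2_at_pq1_psum psum_single)

section \<open>Specializations of the longest standard basis element\<close>

context root_basis
begin

abbreviation "w0 \<equiv> longest_element R \<Delta>"

text \<open>The monomial of a reduced word is an integral lift with coefficient 1, so specializing
  moves only the parameters.\<close>

lemma specialize2_T:
  assumes "ring_map \<phi>"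
  shows "specialize R \<Delta> (lmonom2 1 0 - lmonom2 (- 1) 0) (lmonom2 0 1 - lmonom2 0 (- 1)) laurent2_incl \<phi> (T_pq R \<Delta> w0)
    = hecke_class R \<Delta> (\<phi> (lmonom2 1 0 - lmonom2 (- 1) 0)) (\<phi> (lmonom2 0 1 - lmonom2 0 (- 1))) (fmon (rword w0) 1)"
  unfolding T_pq_def hecke_T_eq[OF longest_W]
  using specialize_class[OF ring_map_laurent2_incl inj_laurent2_incl assms
      fmon_F[OF rword_lists[OF longest_W], of 1], of "lmonom2 1 0 - lmonom2 (- 1) 0" "lmonom2 0 1 - lmonom2 0 (- 1)"]
  unfolding pmap_fmon[OF ring_map_laurent2_incl] pmap_fmon[OF assms] ring_map_one[OF ring_map_laurent2_incl]
    ring_map_one[OF assms] laurent2_incl_pq .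

lemma at_p1_T: "at_p1 R \<Delta> (T_pq R \<Delta> w0) = hecke_class R \<Delta> 0 (rvar - inverse rvar) (fmon (rword w0) 1)"
  unfolding at_p1_def specialize2_T[OF ring_map_laurent2_at_p1] laurent2_at_p1_pq
    base_change_class[OF ring_map_laurent_incl] laurent_incl_q ring_map_zero[OF ring_map_laurent_incl]
    pmap_fmon[OF ring_map_laurent_incl] ring_map_one[OF ring_map_laurent_incl] ..

lemma at_q1_T: "at_q1 R \<Delta> (T_pq R \<Delta> w0) = hecke_class R \<Delta> (rvar - inverse rvar) 0 (fmon (rword w0) 1)"
  unfolding at_q1_def specialize2_T[OF ring_map_laurent2_at_q1] laurent2_at_q1_pq
    base_change_class[OF ring_map_laurent_incl] laurent_incl_q ring_map_zero[OF ring_map_laurent_incl]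
    pmap_fmon[OF ring_map_laurent_incl] ring_map_one[OF ring_map_laurent_incl] ..

lemma at_pq1_T: "at_pq1 R \<Delta> (T_pq R \<Delta> w0) = fmon w0 1"
proof -
  have "word (rword w0) = w0"
    using reduced_rword[OF longest_W] by (simp add: reduced_expression_def)
  then show ?thesis
    unfolding at_pq1_def specialize2_T[OF ring_map_laurent2_at_pq1] laurent2_at_pq1_pq
      hecke_to_group_ring_class to_group_ring_fmon by simp
qed

lemma at_p1_q1_class:
  assumes "x \<in> F"
  shows "at_p1_q1 R \<Delta> (hecke_class R \<Delta> 0 (rvar - inverse rvar) (pmap laurent_incl x))
    = to_group_ring (pmap laurent_at_1 x)"
  using specialize_class[OF ring_map_laurent_incl inj_laurent_incl ring_map_laurent_at_1 assms,
      of 0 "lmonom 1 - lmonom (- 1)"]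
  unfolding at_p1_q1_def laurent_incl_q laurent_at_1_q ring_map_zero[OF ring_map_laurent_incl]
    ring_map_zero[OF ring_map_laurent_at_1]
  by (simp only: hecke_to_group_ring_class)

lemma at_q1_p1_class:
  assumes "x \<in> F"
  shows "at_q1_p1 R \<Delta> (hecke_class R \<Delta> (rvar - inverse rvar) 0 (pmap laurent_incl x))
    = to_group_ring (pmap laurent_at_1 x)"
  using specialize_class[OF ring_map_laurent_incl inj_laurent_incl ring_map_laurent_at_1 assms,
      of "lmonom 1 - lmonom (- 1)" 0]
  unfolding at_q1_p1_def laurent_incl_q laurent_at_1_q ring_map_zero[OF ring_map_laurent_incl]
    ring_map_zero[OF ring_map_laurent_at_1]
  by (simp only: hecke_to_group_ring_class)

text \<open>With first parameter 0, the parameter is nonzero exactly at the long roots.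
  \<open>t\<close> is left open so that both the value at p = 1 and the one-parameter element can be
  inserted.\<close>

lemma square_q:
  assumes "t = hecke_class R \<Delta> 0 (rvar - inverse rvar) (fmon (rword w0) 1)"
  shows "at_p1_q1 R \<Delta> (square_quot_q R \<Delta> t) = (\<Sum>\<alpha>\<in>long_positive_roots R \<Delta>. fmon (reflection \<alpha>) 1)"
proof -
  let ?S = "long_positive_roots R \<Delta>"
  have col: "colour 0 (rvar - inverse rvar) \<beta> = (if \<beta> \<in> ?S then rvar - inverse rvar else 0)"
    if "\<beta> \<in> pos" for \<beta>
    using that by (simp add: colour_def long_positive_roots_def)
  have "square_quot_q R \<Delta> t = hecke_class R \<Delta> 0 (rvar - inverse rvar) (pmap laurent_incl (quotient_lift ?S))"
    unfolding square_quot_q_def hecke_q_def pmap_quotient_lift[OF ring_map_laurent_incl]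
    by (rule square_quotient[OF rvar_diff_nonzero col assms])
  then have "at_p1_q1 R \<Delta> (square_quot_q R \<Delta> t) = to_group_ring (quotient_lift ?S)"
    by (simp only: at_p1_q1_class[OF quotient_lift_F] pmap_quotient_lift[OF ring_map_laurent_at_1])
  then show ?thesis
    by (subst (asm) to_group_ring_quotient_lift) (auto simp: long_positive_roots_def)
qed

lemma square_p:
  assumes "t = hecke_class R \<Delta> (rvar - inverse rvar) 0 (fmon (rword w0) 1)"
  shows "at_q1_p1 R \<Delta> (square_quot_p R \<Delta> t) = (\<Sum>\<alpha>\<in>short_positive_roots R \<Delta>. fmon (reflection \<alpha>) 1)"
proof -
  let ?S = "short_positive_roots R \<Delta>"
  have col: "colour (rvar - inverse rvar) 0 \<beta> = (if \<beta> \<in> ?S then rvar - inverse rvar else 0)"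
    if "\<beta> \<in> pos" for \<beta>
    using that by (simp add: colour_def short_positive_roots_def)
  have "square_quot_p R \<Delta> t = hecke_class R \<Delta> (rvar - inverse rvar) 0 (pmap laurent_incl (quotient_lift ?S))"
    unfolding square_quot_p_def hecke_p_def pmap_quotient_lift[OF ring_map_laurent_incl]
    by (rule square_quotient[OF rvar_diff_nonzero col assms])
  then have "at_q1_p1 R \<Delta> (square_quot_p R \<Delta> t) = to_group_ring (quotient_lift ?S)"
    by (simp only: at_q1_p1_class[OF quotient_lift_F] pmap_quotient_lift[OF ring_map_laurent_at_1])
  then show ?thesis
    by (subst (asm) to_group_ring_quotient_lift) (auto simp: short_positive_roots_def)
qed

lemma T_q_class: "T_q R \<Delta> w0 = hecke_class R \<Delta> 0 (rvar - inverse rvar) (fmon (rword w0) 1)"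
  unfolding T_q_def by (rule hecke_T_eq[OF longest_W])

lemma at_p1_q1_T: "at_p1_q1 R \<Delta> (T_q R \<Delta> w0) = fmon w0 1"
proof -
  have "word (rword w0) = w0"
    using reduced_rword[OF longest_W] by (simp add: reduced_expression_def)
  then show ?thesis
    using at_p1_q1_class[OF fmon_F[OF rword_lists[OF longest_W], of 1]]
    unfolding T_q_class pmap_fmon[OF ring_map_laurent_incl] pmap_fmon[OF ring_map_laurent_at_1]
      ring_map_one[OF ring_map_laurent_incl] ring_map_one[OF ring_map_laurent_at_1] to_group_ring_fmon by simp
qed

end

theorem proposition2p8:
  fixes R \<Delta> :: "'v::euclidean_space set"
  assumes "root_system R" and "simple_roots R \<Delta>"
  shows
   "(at_p1_q1 R \<Delta> (square_quot_q R \<Delta> (at_p1 R \<Delta> (T_pq R \<Delta> (longest_element R \<Delta>))))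
       = (\<Sum>\<alpha>\<in>long_positive_roots R \<Delta>. Poly_Mapping.single (reflection \<alpha>) 1)
     \<and> (\<Sum>\<alpha>\<in>long_positive_roots R \<Delta>. Poly_Mapping.single (reflection \<alpha>) 1) = z_long R \<Delta>)
    \<and> (at_q1_p1 R \<Delta> (square_quot_p R \<Delta> (at_q1 R \<Delta> (T_pq R \<Delta> (longest_element R \<Delta>))))
       = (\<Sum>\<alpha>\<in>short_positive_roots R \<Delta>. Poly_Mapping.single (reflection \<alpha>) 1)
     \<and> (\<Sum>\<alpha>\<in>short_positive_roots R \<Delta>. Poly_Mapping.single (reflection \<alpha>) 1) = z_short R \<Delta>)
    \<and> (at_pq1 R \<Delta> (T_pq R \<Delta> (longest_element R \<Delta>))
       = Poly_Mapping.single (longest_element R \<Delta>) 1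
     \<and> Poly_Mapping.single (longest_element R \<Delta>) 1 = z_zero R \<Delta>)
    \<and> (\<comment> \<open>one root length: the algebra \<open>H(q\<^sup>2)\<close> over \<open>\<complex>(q)\<close>\<close>
       short_positive_roots R \<Delta> = {} \<longrightarrow>
         at_p1_q1 R \<Delta> (square_quot_q R \<Delta> (T_q R \<Delta> (longest_element R \<Delta>))) = z_long R \<Delta>
       \<and> at_p1_q1 R \<Delta> (T_q R \<Delta> (longest_element R \<Delta>)) = z_zero R \<Delta>)"
proof -
  interpret root_basis R \<Delta> using assms by unfold_locales
  \<comment> \<open>The clause for one root length is the computation for long roots applied to
    \<open>T_q\<close>, whose class is the same.\<close>
  show ?thesis
    using square_q[OF at_p1_T] square_p[OF at_q1_T] at_pq1_T square_q[OF T_q_class] at_p1_q1_T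
    unfolding z_long_def z_short_def z_zero_def by blast
qed

end
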